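(* Let $X$ be a Hilbert space. For a fixed $T>0$ and any $t\in[0,T]$ assume that there exists an inner product $(\cdot,\cdot)_t$ on $X$, with associated norm $\|\cdot\|_t$, depending "smoothly" on $t$ in the following sense: there exists $c>0$ such that $$\frac{d}{dt}(u,u)_t\le 2c\,(u,u)_t\qquad\forall u\in X,\ t\in[0,T].$$ For every $t\in[0,T]$ let $A(t)$ be a (possibly nonlinear) operator in $X$, and assume that: (i) for all $t\in[0,T]$, $A(t)$ is single-valued and is a maximal quasi-monotone operator for the inner product $(\cdot,\cdot)_t$, in other words, there exists a non-negative real number $\omega$ (independent of $t\in[0,T]$) such that $A(t)+\omega\mathbb I$ is a maximal monotone operator for the inner product $(\cdot,\cdot)_t$; (ii) the domain $D(A(t))=D$ of $A(t)$ is independent of $t$, for all $t\in[0,T]$; (iii) there exists a positive constant $L$ such that $$\|A(t)u-A(s)u\|\le L|t-s|\,(1+\|u\|+\|A(s)u\|)\qquad\forall u\in D,\ s,t\in[0,T],$$ where, for shortness, $\|\cdot\|_0$ is denoted by $\|\cdot\|$. Then for all $a\in D$ the Cauchy problem $$\frac{du}{dt}(t)+A(t)u(t)=0\ \text{ for } 0\le t\le T,\qquad u(0)=a,$$ has a unique solution $u\in C([0,T];X)$ such that $u(t)$ belongs to $D$ for all $t\in[0,T]$, and its strong derivative $\frac{du}{dt}(t)=-A(t)u(t)$ exists and is continuous except at a countable number of points $t$.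
   Context: $\mathbb I$ is the identity operator on $X$. An operator $A$ with domain $D(A)\subset X$ is monotone for an inner product $(\cdot,\cdot)$ if $\Re(Au-Av,u-v)\ge 0$ for all $u,v\in D(A)$; it is maximal monotone if it is monotone and has no proper monotone (possibly multivalued) extension.
   Formalization: Each inner product (·,·)_t is assumed to make X complete (a Hilbert inner product), and ‖·‖_0 to be equivalent to the norm of X; without completeness for (·,·)_t the claim that du/dt is continuous except at countably many t is false. *)

theory Defs
  imports "HOL-Analysis.Analysis"
begin

text \<open>
  Scalar fields: the embedding exhibits \<open>'a\<close> as a real subalgebra of the complex numbers, so up to
  isomorphism the instances are exactly the reals and the complex numbers.
\<close>

class real_or_complex = real_field +
  fixes to_complex :: "'a \<Rightarrow> complex"
  assumes to_complex_add: "to_complex (x + y) = to_complex x + to_complex y"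
    and to_complex_mult: "to_complex (x * y) = to_complex x * to_complex y"
    and to_complex_of_real: "to_complex (r *\<^sub>R 1) = of_real r"

instantiation real :: real_or_complex
begin
definition "to_complex = complex_of_real"
instance by standard (simp_all only: to_complex_real_def of_real_add of_real_mult real_scaleR_def mult_1_right)
end

instantiation complex :: real_or_complex
begin
definition "to_complex = (\<lambda>z::complex. z)"
instance by standard (simp_all only: to_complex_complex_def scaleR_conv_of_real mult_1_right)
end

definition inner_product ::
    "('k::real_or_complex \<Rightarrow> 'a \<Rightarrow> 'a) \<Rightarrow> ('a::real_vector \<Rightarrow> 'a \<Rightarrow> 'k) \<Rightarrow> bool" where
  "inner_product sm ip \<longleftrightarrow>
     vector_space sm \<and> (\<forall>r x. sm (of_real r) x = r *\<^sub>R x) \<and>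
     (\<forall>x y z. ip (x + y) z = ip x z + ip y z) \<and>
     (\<forall>a x y. ip (sm a x) y = a * ip x y) \<and>
     (\<forall>x y. to_complex (ip y x) = cnj (to_complex (ip x y))) \<and>
     (\<forall>x. x \<noteq> 0 \<longrightarrow> 0 < Re (to_complex (ip x x)))"

definition ip_norm :: "('a \<Rightarrow> 'a \<Rightarrow> 'k::real_or_complex) \<Rightarrow> 'a \<Rightarrow> real" where
  "ip_norm ip x = sqrt (Re (to_complex (ip x x)))"

text \<open>Completeness refers to the norm of \<open>ip\<close>, which need not be the norm of the type.\<close>

definition hilbert_inner_product ::
    "('k::real_or_complex \<Rightarrow> 'a \<Rightarrow> 'a) \<Rightarrow> ('a::real_vector \<Rightarrow> 'a \<Rightarrow> 'k) \<Rightarrow> bool" where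
  "hilbert_inner_product sm ip \<longleftrightarrow>
     inner_product sm ip \<and>
     (\<forall>x::nat \<Rightarrow> 'a.
        (\<forall>e>0. \<exists>N. \<forall>m\<ge>N. \<forall>n\<ge>N. ip_norm ip (x m - x n) < e) \<longrightarrow>
        (\<exists>l. (\<lambda>n. ip_norm ip (x n - l)) \<longlonglongrightarrow> 0))"

text \<open>
  A possibly multivalued operator is identified with its graph; \<open>(u, v) \<in> A\<close> means \<open>v \<in> A u\<close>
  and \<open>Domain A\<close> is its domain.
\<close>

type_synonym 'a operator = "('a \<times> 'a) set"

text \<open>The value \<open>A u\<close>; meaningful only if \<open>A\<close> is single-valued and \<open>u \<in> Domain A\<close>.\<close>

definition op_apply :: "'a operator \<Rightarrow> 'a \<Rightarrow> 'a" where
  "op_apply A u = (THE v. (u, v) \<in> A)"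

definition op_shift :: "'a::real_vector operator \<Rightarrow> real \<Rightarrow> 'a operator" where
  "op_shift A \<omega> = {(u, v + \<omega> *\<^sub>R u) | u v. (u, v) \<in> A}"

definition monotone_operator ::
    "('a::real_vector \<Rightarrow> 'a \<Rightarrow> 'k::real_or_complex) \<Rightarrow> 'a operator \<Rightarrow> bool" where
  "monotone_operator ip A \<longleftrightarrow>
     (\<forall>u v u' v'. (u, v) \<in> A \<longrightarrow> (u', v') \<in> A \<longrightarrow> 0 \<le> Re (to_complex (ip (v - v') (u - u'))))"

definition maximal_monotone_operator ::
    "('a::real_vector \<Rightarrow> 'a \<Rightarrow> 'k::real_or_complex) \<Rightarrow> 'a operator \<Rightarrow> bool" where
  "maximal_monotone_operator ip A \<longleftrightarrow>
     monotone_operator ip A \<and> (\<forall>B. monotone_operator ip B \<longrightarrow> A \<subseteq> B \<longrightarrow> B = A)"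

text \<open>
  Solutions of \<open>u' + A(t) u = 0\<close> on \<open>{0..T}\<close>: outside a countable set of times the strong
  derivative (one-sided at the end points) exists, equals \<open>- A(t) u(t)\<close> and is continuous, the
  latter as a function on the set of times at which it exists.
\<close>

definition cauchy_solution ::
    "real \<Rightarrow> 'a set \<Rightarrow> (real \<Rightarrow> 'a operator) \<Rightarrow> 'a \<Rightarrow> (real \<Rightarrow> 'a::real_normed_vector) \<Rightarrow> bool" where
  "cauchy_solution T D A a u \<longleftrightarrow>
     continuous_on {0..T} u \<and> u 0 = a \<and> (\<forall>t\<in>{0..T}. u t \<in> D) \<and>
     (\<exists>N. countable N \<and>
        (\<forall>t\<in>{0..T} - N.
           (u has_vector_derivative - op_apply (A t) (u t)) (at t within {0..T}) \<and>
           continuous (at t within {s \<in> {0..T}. u differentiable (at s within {0..T})})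
             (\<lambda>s. vector_derivative u (at s within {0..T}))))"

end

(*
  For the parameter t fixed, the real part of the inner product is a real Hilbert form. Minty's
  theorem (obtained by minimising the Fitzpatrick function) makes the implicit Euler scheme for
  u' + A(t) u = 0 solvable; quasi-monotonicity and the Lipschitz condition bound A(t_k) u_k, and two
  Euler interpolants with steps h and h' differ by O(sqrt (h + h')). The limit u stays in D, since a
  bounded sequence in the graph of a maximal monotone operator has its limit point in the domain. At
  every t < T the right derivative of u is - A(t) u(t). Comparing u(. + h) with u shows that
  |A(t) u(t)|_t^2 is, after an exponential factor and a linear term are removed, a decreasing function of t,
  so it is continuous outside a countable set; there weak continuity of A(t) u(t) becomes strong
  continuity, and the right derivative a two-sided continuous one. Uniqueness is Gronwall's inequality.

  The hypotheses bound the growth of |x|_t but not its decay, so the lower bound for these norms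
  uniform in t comes from the last one: |x|_T is complete, hence equivalent to |x|_0 by Baire's theorem.
*)
theory Submission imports Defs begin

text \<open>The derivative of (u,u)_t is bounded only from above, so energy estimates run forward in
  time. They use right derivatives, the only ones available at the kinks of an Euler interpolant.
  Exceptional sets have to be tolerated as well, because uniqueness concerns functions that satisfy
  the equation only outside a countable set. Quasi-monotonicity at time t compares values of A(t)
  only. Before it applies, a value of A(s) is replaced by the value of A(t) at the same point, at
  the cost of L|t-s| times a quantity bounded a priori. For the scheme this consistency error has
  the size of the step and enters linearly into the inequality for the squared distance of two
  interpolants; hence the square root in the rate. No weak topology is used. Where weak limits are
  customary, bounded Yosida approximations converge in norm. Demicontinuity at x is needed only as a
  lower bound for the pairing of nearby values with the value y at x itself, since it is always
  inserted into the square of a difference from y or into the pairing with y.\<close>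

section \<open>Real functions with one-sided derivatives, and quadratic forms\<close>

text \<open>If \<open>f\<close> increased, so would a slightly tilted \<open>g\<close> with strictly
  negative right derivatives. A level missed by \<open>g\<close> on \<open>N\<close> is crossed for
  the last time at a point outside \<open>N\<close>, where \<open>g\<close> must drop to the right
  and come below the level again.\<close>

lemma antimono_if_right_deriv_nonpos:
  fixes f :: "real \<Rightarrow> real"
  assumes ab: "a \<le> b" and cont: "continuous_on {a..b} f" and N: "countable N"
    and deriv: "\<And>t. t \<in> {a..<b} - N \<Longrightarrow> \<exists>d\<le>0. (f has_real_derivative d) (at t within {t..b})"
  shows "f b \<le> f a"
proof (rule ccontr)
  assume "\<not> f b \<le> f a"
  then have fab: "f a < f b" and "a < b" using ab by (auto simp: not_le order_le_less)
  \<comment> \<open>Half the mean slope, so that the tilted function still rises from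
    \<open>a\<close> to \<open>b\<close>.\<close>
  define e where "e = (f b - f a) / (2 * (b - a))"
  have e: "e > 0" using fab \<open>a < b\<close> by (simp add: e_def)
  define g where "g t = f t - e * (t - a)" for t
  have ga: "g a = f a" by (simp add: g_def)
  have "g b = (f a + f b) / 2" using \<open>a < b\<close> by (simp add: g_def e_def field_simps)
  then have gab: "g a < g b" using fab ga by simp
  have gcont: "continuous_on {a..b} g" unfolding g_def by (intro continuous_intros cont)
  \<comment> \<open>Only countably many levels are attained on \<open>N\<close>; the level
    \<open>y\<close> avoids them, which keeps the last crossing out of \<open>N\<close>.\<close>
  have "uncountable {g a<..<g b}" using gab by (simp add: uncountable_open_interval)
  moreover have "countable (g ` N)" using N by simp
  ultimately obtain y where y: "g a < y" "y < g b" "y \<notin> g ` N"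
    by (metis countable_subset greaterThanLessThan_iff subsetI)
  define S where "S = {t \<in> {a..b}. g t \<le> y}"
  have "closed S" unfolding S_def
    by (intro continuous_closed_preimage_constant continuous_on_closed_Collect_le gcont continuous_intros)
  have "a \<in> S" using y(1) ab by (simp add: S_def)
  then have bdd: "bdd_above S" and ne: "S \<noteq> {}" by (auto simp: S_def bdd_above_def)
  define s where "s = Sup S"
  have sS: "s \<in> S" unfolding s_def by (rule closed_contains_Sup[OF ne bdd \<open>closed S\<close>])
  have up: "t \<le> s" if "t \<in> S" for t unfolding s_def using bdd that by (rule cSup_upper[rotated])
  have s: "a \<le> s" "s \<le> b" "g s \<le> y" using sS by (auto simp: S_def)
  have "s < b" using s y(2) by (cases "s = b") auto
  have "\<exists>t\<ge>s. t \<le> b \<and> g t = y"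
    using s y(2) continuous_on_subset[OF gcont] by (intro IVT') auto
  then obtain t where t: "s \<le> t" "t \<le> b" "g t = y" by blast
  then have "t \<in> S" using s by (auto simp: S_def)
  then have gs: "g s = y" using t up[of t] by simp
  then have "s \<notin> N" using y(3) by blast
  then obtain d where d: "d \<le> 0" "(f has_real_derivative d) (at s within {s..b})"
    using deriv[of s] s \<open>s < b\<close> by auto
  have "(g has_real_derivative d - e) (at s within {s..b})"
    unfolding g_def by (auto intro!: derivative_eq_intros d)
  then obtain h0 where h0: "h0 > 0" "\<And>h. h > 0 \<Longrightarrow> s + h \<in> {s..b} \<Longrightarrow> h < h0 \<Longrightarrow> g (s + h) < g s"
    using has_real_derivative_neg_dec_right[of g "d - e" s "{s..b}"] d e by auto
  define h where "h = min (h0/2) (b - s)"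
  have h: "h > 0" "s + h \<in> {s..b}" "h < h0" using h0(1) \<open>s < b\<close> by (auto simp: h_def)
  have "s + h \<in> S" using h0(2)[OF h] h(1,2) gs s by (auto simp: S_def)
  then show False using up[of "s + h"] h(1) by simp
qed

text \<open>The integrating factor is at most 1, so after multiplication the source
  \<open>\<kappa>\<close> is still compensated by a linear term of slope
  \<open>\<kappa>\<close>.\<close>

lemma right_gronwall:
  fixes f :: "real \<Rightarrow> real"
  assumes ab: "a \<le> b" and cont: "continuous_on {a..b} f" and N: "countable N"
    and nonneg: "0 \<le> \<beta>" "0 \<le> \<kappa>"
    and deriv: "\<And>t. t \<in> {a..<b} - N \<Longrightarrow>
      \<exists>d. (f has_real_derivative d) (at t within {t..b}) \<and> d \<le> \<beta> * f t + \<kappa>"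
  shows "f b \<le> exp (\<beta> * (b - a)) * (f a + \<kappa> * (b - a))"
proof -
  define g where "g t = exp (- \<beta> * (t - a)) * f t - \<kappa> * (t - a)" for t
  have "g b \<le> g a"
  proof (rule antimono_if_right_deriv_nonpos[OF ab _ N])
    show "continuous_on {a..b} g" unfolding g_def by (intro continuous_intros cont)
    fix t assume t: "t \<in> {a..<b} - N"
    then obtain d where d: "(f has_real_derivative d) (at t within {t..b})" "d \<le> \<beta> * f t + \<kappa>"
      using deriv by blast
    let ?E = "exp (- \<beta> * (t - a))"
    have D: "(g has_real_derivative ?E * (d - \<beta> * f t) - \<kappa>) (at t within {t..b})"
      unfolding g_def by (auto intro!: derivative_eq_intros d simp: algebra_simps)
    have E: "?E \<le> 1" using t nonneg by simp
    have "?E * (d - \<beta> * f t) \<le> ?E * \<kappa>" using d(2) by (intro mult_left_mono) auto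
    also have "\<dots> \<le> 1 * \<kappa>" using E nonneg by (intro mult_right_mono) auto
    finally have "?E * (d - \<beta> * f t) - \<kappa> \<le> 0" by simp
    with D show "\<exists>d\<le>0. (g has_real_derivative d) (at t within {t..b})" by blast
  qed
  then have "exp (- \<beta> * (b - a)) * f b \<le> f a + \<kappa> * (b - a)" by (simp add: g_def)
  then have "exp (\<beta> * (b - a)) * (exp (- \<beta> * (b - a)) * f b) \<le> exp (\<beta> * (b - a)) * (f a + \<kappa> * (b - a))"
    by (rule mult_left_mono) simp
  then show ?thesis by (simp add: mult.assoc[symmetric] exp_add[symmetric])
qed

text \<open>Definiteness is left out on purpose: besides the inner products, the locale is applied
  to the difference form \<open>\<sigma>\<close> in \<open>pairing_diff_le\<close>, which may
  degenerate.\<close>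

locale psd_form =
  fixes r :: "'a::real_normed_vector \<Rightarrow> 'a \<Rightarrow> real"
  assumes add_left: "r (x + y) z = r x z + r y z"
    and scale_left: "r (a *\<^sub>R x) y = a * r x y"
    and sym: "r x y = r y x"
    and nonneg: "0 \<le> r x x"
begin

lemma add_right: "r z (x + y) = r z x + r z y" using add_left sym by metis
lemma scale_right: "r x (a *\<^sub>R y) = a * r x y" using scale_left sym by metis
lemma minus_left: "r (- x) y = - r x y" using scale_left[of "-1" x y] by simp
lemma minus_right: "r x (- y) = - r x y" using scale_right[of x "-1" y] by simp
lemma diff_left: "r (x - y) z = r x z - r y z" using add_left[of x "-y" z] minus_left by simp
lemma diff_right: "r z (x - y) = r z x - r z y" using add_right[of z x "-y"] minus_right by simp
lemma zero_left [simp]: "r 0 x = 0" using scale_left[of 0 0 x] by simp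

lemmas bilinear_simps = add_left add_right scale_left scale_right minus_left minus_right diff_left diff_right

lemma square_add: "r (x + y) (x + y) = r x x + 2 * r x y + r y y"
  using sym[of x y] by (simp add: bilinear_simps)

lemma square_diff: "r (x - y) (x - y) = r x x - 2 * r x y + r y y"
  using sym[of x y] by (simp add: bilinear_simps)

lemma Cauchy_Schwarz: "(r x y)\<^sup>2 \<le> r x x * r y y"
proof -
  have *: "0 \<le> r x x - 2 * s * r x y + s\<^sup>2 * r y y" for s
    using nonneg[of "x - s *\<^sub>R y"] 
    unfolding square_diff by (simp add: bilinear_simps power2_eq_square mult.assoc)
  show ?thesis
  proof (cases "r y y = 0")
    case True
    have "r x y = 0"
    proof (rule ccontr)
      assume "r x y \<noteq> 0"
      \<comment> \<open>For \<open>r y y = 0\<close> the quadratic in \<open>s\<close> is affine,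
        and this \<open>s\<close> gives it the value -1.\<close>
      then show False using *[of "(r x x + 1) / (2 * r x y)"] True by (simp add: field_simps)
    qed
    then show ?thesis using True by simp
  next
    case False
    then have "r y y > 0" using nonneg[of y] by simp
    then show ?thesis using *[of "r x y / r y y"]
      by (simp add: field_simps power2_eq_square)
  qed
qed

definition nr :: "'a \<Rightarrow> real" where "nr x = sqrt (r x x)"

lemma nr_nonneg [simp]: "0 \<le> nr x" by (simp add: nr_def nonneg)
lemma nr_square: "(nr x)\<^sup>2 = r x x" by (simp add: nr_def nonneg)
lemma nr_zero [simp]: "nr 0 = 0" by (simp add: nr_def)

lemma abs_le_nr: "\<bar>r x y\<bar> \<le> nr x * nr y"
proof -
  have "\<bar>r x y\<bar> = sqrt ((r x y)\<^sup>2)" by simp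
  also have "\<dots> \<le> sqrt (r x x * r y y)" using Cauchy_Schwarz by (intro real_sqrt_le_mono)
  finally show ?thesis by (simp add: nr_def real_sqrt_mult)
qed

lemma le_nr: "r x y \<le> nr x * nr y" using abs_le_nr[of x y] by simp

lemma nr_scale: "nr (a *\<^sub>R x) = \<bar>a\<bar> * nr x"
proof -
  have "nr (a *\<^sub>R x) = sqrt (a\<^sup>2 * r x x)" by (simp add: nr_def bilinear_simps power2_eq_square mult.assoc)
  then show ?thesis by (simp add: real_sqrt_mult nr_def)
qed

lemma nr_minus: "nr (- x) = nr x" using nr_scale[of "-1" x] by simp

lemma nr_diff_commute: "nr (x - y) = nr (y - x)" using nr_minus[of "x - y"] by simp

lemma nr_triangle: "nr (x + y) \<le> nr x + nr y"
proof (rule power2_le_imp_le)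
  have "(nr (x + y))\<^sup>2 = r x x + 2 * r x y + r y y" by (simp add: nr_square square_add)
  also have "\<dots> \<le> (nr x + nr y)\<^sup>2"
    using le_nr[of x y] by (simp add: power2_sum nr_square)
  finally show "(nr (x + y))\<^sup>2 \<le> (nr x + nr y)\<^sup>2" .
qed simp

lemma nr_triangle_diff: "nr (x - z) \<le> nr (x - y) + nr (y - z)"
  using nr_triangle[of "x - y" "y - z"] by simp

lemma square_sum_le: "r (x + y) (x + y) \<le> 2 * r x x + 2 * r y y"
  using nonneg[of "x - y"] unfolding square_add square_diff by simp

end

text \<open>\<open>m\<close> and \<open>M\<close> are parameters, so that one pair of constants can
  later serve the forms of all times at once.\<close>

locale equiv_form = psd_form r for r :: "'a::real_normed_vector \<Rightarrow> 'a \<Rightarrow> real" +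
  fixes m M :: real
  assumes m_pos: "0 < m" and M_pos: "0 < M"
    and lower: "m * norm x \<le> nr x"
    and upper: "nr x \<le> M * norm x"
begin

lemma le_norm: "\<bar>r x y\<bar> \<le> M\<^sup>2 * norm x * norm y"
proof -
  have "nr x * nr y \<le> (M * norm x) * (M * norm y)"
    using upper M_pos by (intro mult_mono) auto
  then show ?thesis using abs_le_nr[of x y] by (simp add: power2_eq_square mult_ac)
qed

lemma bounded_bilinear: "bounded_bilinear r"
proof
  show "\<exists>K. \<forall>a b. norm (r a b) \<le> norm a * norm b * K"
    using le_norm by (intro exI[of _ "M\<^sup>2"]) (simp add: mult_ac)
qed (simp_all add: bilinear_simps)

lemmas tendsto_form [tendsto_intros] = bounded_bilinear.tendsto[OF bounded_bilinear]
lemmas continuous_on_form [continuous_intros] = bounded_bilinear.continuous_on[OF bounded_bilinear]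

lemma lower_square: "m\<^sup>2 * (norm x)\<^sup>2 \<le> r x x"
  using power_mono[OF lower[of x], of 2] m_pos by (simp add: nr_square power_mult_distrib)

lemma upper_square: "r x x \<le> M\<^sup>2 * (norm x)\<^sup>2"
  using power_mono[OF upper[of x], of 2] by (simp add: nr_square power_mult_distrib)

lemma norm_le_nr: "norm x \<le> nr x / m"
  using lower[of x] m_pos by (simp add: field_simps)

lemma nr_eq_0: "nr x = 0 \<Longrightarrow> x = 0"
  using lower[of x] m_pos by (simp add: mult_le_0_iff)

lemma tendsto_nr [tendsto_intros]: "(f \<longlongrightarrow> l) F \<Longrightarrow> ((\<lambda>x. nr (f x)) \<longlongrightarrow> nr l) F"
  unfolding nr_def by (intro tendsto_intros)

text \<open>Pairing \<open>w\<close> with its total increment \<open>e\<close> reduces this to a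
  scalar function whose right derivative is at most \<open>K * nr e\<close>; a factor
  \<open>nr e\<close> is then cancelled.\<close>

lemma right_deriv_bound:
  assumes ab: "a \<le> b" and cont: "continuous_on {a..b} w" and "0 \<le> K"
    and deriv: "\<And>t. t \<in> {a..<b} \<Longrightarrow> \<exists>w'. (w has_vector_derivative w') (at t within {t..b}) \<and> nr w' \<le> K"
  shows "nr (w b - w a) \<le> K * (b - a)"
proof -
  define e where "e = w b - w a"
  have "r (w b - w a) e \<le> exp (0 * (b - a)) * (r (w a - w a) e + K * nr e * (b - a))"
  proof (rule right_gronwall[where N = "{}" and f = "\<lambda>t. r (w t - w a) e"])
    show "continuous_on {a..b} (\<lambda>t. r (w t - w a) e)" by (intro continuous_intros cont)
    fix t assume "t \<in> {a..<b} - {}"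
    then obtain w' where w': "(w has_vector_derivative w') (at t within {t..b})" "nr w' \<le> K"
      using deriv by auto
    have "((\<lambda>t. r (w t - w a) e) has_vector_derivative r w' e) (at t within {t..b})"
      using bounded_linear.has_vector_derivative[OF bounded_bilinear.bounded_linear_left[OF bounded_bilinear, of e], of "\<lambda>t. w t - w a" w' "at t within {t..b}"]
        has_vector_derivative_diff[OF w'(1) has_vector_derivative_const[of "w a"]] by simp
    moreover have "r w' e \<le> K * nr e"
      using le_nr[of w' e] mult_right_mono[OF w'(2) nr_nonneg[of e]] by simp
    ultimately show "\<exists>d. ((\<lambda>t. r (w t - w a) e) has_real_derivative d) (at t within {t..b}) \<and> d \<le> 0 * r (w t - w a) e + K * nr e"
      unfolding has_real_derivative_iff_has_vector_derivative by auto
  qed (use ab \<open>0 \<le> K\<close> in auto)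
  then have *: "nr e * nr e \<le> nr e * (K * (b - a))"
    using nr_square[of e] by (simp add: e_def power2_eq_square mult_ac)
  have "0 \<le> K * (b - a)" using \<open>0 \<le> K\<close> ab by simp
  then have "nr e \<le> K * (b - a)"
    using * nr_nonneg[of e] by (cases "nr e = 0") (auto simp: mult_le_cancel_left)
  then show ?thesis by (simp add: e_def)
qed

end

section \<open>Maximal monotone operators in a Hilbert space\<close>

locale hilbert_form = equiv_form r m M for r :: "'a::real_normed_vector \<Rightarrow> 'a \<Rightarrow> real" and m M +
  assumes complete_UNIV: "complete (UNIV :: 'a set)"
begin

text \<open>The common form of three limits: minimising sequences, Yosida approximations and Euler
  interpolants all satisfy such a bound with separated errors.\<close>

lemma convergent_if_square_le:
  assumes le: "\<And>i j. r (x i - x j) (x i - x j) \<le> e i + e j" and e: "e \<longlonglongrightarrow> 0"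
  shows "\<exists>l. x \<longlonglongrightarrow> (l :: 'a)"
proof -
  have "Cauchy x"
  proof (rule metric_CauchyI)
    fix \<epsilon> :: real assume "0 < \<epsilon>"
    define \<eta> where "\<eta> = m\<^sup>2 * \<epsilon>\<^sup>2 / 2"
    have "\<eta> > 0" using \<open>0 < \<epsilon>\<close> m_pos by (simp add: \<eta>_def)
    then obtain N where N: "\<And>n. n \<ge> N \<Longrightarrow> e n < \<eta>"
      using order_tendstoD(2)[OF e] by (auto simp: eventually_sequentially)
    show "\<exists>N. \<forall>i\<ge>N. \<forall>j\<ge>N. dist (x i) (x j) < \<epsilon>"
    proof (intro exI allI impI)
      fix i j assume "N \<le> i" "N \<le> j"
      then have "m\<^sup>2 * (norm (x i - x j))\<^sup>2 < m\<^sup>2 * \<epsilon>\<^sup>2"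
        using lower_square[of "x i - x j"] le[of i j] N[of i] N[of j] by (simp add: \<eta>_def)
      then have "(norm (x i - x j))\<^sup>2 < \<epsilon>\<^sup>2" using m_pos by simp
      then show "dist (x i) (x j) < \<epsilon>" using \<open>0 < \<epsilon>\<close> by (simp add: dist_norm power2_less_imp_less)
    qed
  qed
  then show ?thesis using complete_UNIV by (metis UNIV_I complete_def)
qed

text \<open>Maximality is phrased pointwise: a pair monotonically related to the whole graph lies in
  it. This is the form in which maximality is applied, and it follows from the absence of proper
  monotone extensions.\<close>

definition maximal :: "'a operator \<Rightarrow> bool" where
  "maximal B \<longleftrightarrow> (\<forall>a b a' b'. (a, b) \<in> B \<longrightarrow> (a', b') \<in> B \<longrightarrow> 0 \<le> r (b - b') (a - a')) \<and>
     (\<forall>x y. (\<forall>a b. (a, b) \<in> B \<longrightarrow> 0 \<le> r (b - y) (a - x)) \<longrightarrow> (x, y) \<in> B)"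

lemma maximalD: "maximal B \<Longrightarrow> (a, b) \<in> B \<Longrightarrow> (a', b') \<in> B \<Longrightarrow> 0 \<le> r (b - b') (a - a')"
  unfolding maximal_def by blast

lemma maximal_memI: "maximal B \<Longrightarrow> (\<And>a b. (a, b) \<in> B \<Longrightarrow> 0 \<le> r (b - y) (a - x)) \<Longrightarrow> (x, y) \<in> B"
  unfolding maximal_def by blast

text \<open>
  The triples \<open>(x, y, \<rho>)\<close> below form the epigraph of the Fitzpatrick function of \<open>B\<close>, which dominates
  \<open>r x y\<close>. The minimiser of \<open>\<rho> + (r x x + r y y) / 2\<close> over it exists by the parallelogram identity,
  and its optimality condition says that \<open>(- y, - x)\<close> is monotonically related to \<open>B\<close>.
\<close>

lemma minty_zero:
  assumes B: "maximal B"
  shows "\<exists>a b. (a, b) \<in> B \<and> a + b = 0"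
proof -
  define E where "E x y \<rho> \<longleftrightarrow> (\<forall>a b. (a, b) \<in> B \<longrightarrow> r x b + r a y - r a b \<le> \<rho>)" for x y and \<rho> :: real
  define J where "J x y \<rho> = \<rho> + r x x / 2 + r y y / 2" for x y and \<rho> :: real
  \<comment> \<open>A pair in \<open>B\<close> is tested with itself. For any other pair, maximality
    supplies a point of \<open>B\<close> that violates monotonicity, and the violation says exactly
    that the affine function of that point exceeds \<open>r x y\<close>.\<close>
  have E_ge: "r x y \<le> \<rho>" if "E x y \<rho>" for x y \<rho>
  proof (cases "(x, y) \<in> B")
    case True
    then have "r x y + r x y - r x y \<le> \<rho>" using that unfolding E_def by blast
    then show ?thesis by simp
  next
    case False
    then obtain a b where ab: "(a, b) \<in> B" "\<not> 0 \<le> r (b - y) (a - x)"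
      using maximal_memI[OF B] by blast
    then have "r x b + r a y - r a b \<le> \<rho>" using that unfolding E_def by blast
    then show ?thesis using ab(2) sym[of b a] sym[of b x] sym[of y a] sym[of y x]
      by (simp add: bilinear_simps)
  qed
  have J_ge: "r (x + y) (x + y) / 2 \<le> J x y \<rho>" if "E x y \<rho>" for x y \<rho>
    using E_ge[OF that] unfolding J_def square_add by simp
  have J_nonneg: "0 \<le> J x y \<rho>" if "E x y \<rho>" for x y \<rho>
    using J_ge[OF that] nonneg[of "x + y"] by simp
  \<comment> \<open>On the graph the Fitzpatrick function does not exceed the pairing; this is
    monotonicity rearranged.\<close>
  have E_B: "E a b (r a b)" if "(a, b) \<in> B" for a b
    unfolding E_def
  proof (intro allI impI)
    fix a' b' assume "(a', b') \<in> B"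
    from maximalD[OF B this that] show "r a b' + r a' b - r a' b' \<le> r a b"
      using sym[of b' a] sym[of b' a'] sym[of b a] sym[of b a'] by (simp add: bilinear_simps)
  qed
  \<comment> \<open>To an empty graph every pair would be vacuously related, hence would belong to
    it.\<close>
  have "\<exists>a b. (a, b) \<in> B" using maximal_memI[OF B, of 0 0] by blast
  then obtain a0 b0 where ab0: "(a0, b0) \<in> B" by blast
  define V where "V = {J x y \<rho> | x y \<rho>. E x y \<rho>}"
  have V_ne: "V \<noteq> {}" using E_B[OF ab0] by (auto simp: V_def)
  have V_bdd: "bdd_below V" using J_nonneg by (auto simp: V_def bdd_below_def)
  define j where "j = Inf V"
  have j_le: "j \<le> J x y \<rho>" if "E x y \<rho>" for x y \<rho>
    unfolding j_def using that by (intro cInf_lower V_bdd) (auto simp: V_def)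
  define e where "e n = 1 / real (Suc n)" for n
  have "e \<longlonglongrightarrow> 0" unfolding e_def using LIMSEQ_inverse_real_of_nat by (simp add: inverse_eq_divide)
  have "\<exists>x y \<rho>. E x y \<rho> \<and> J x y \<rho> < j + e n" for n
  proof -
    have "Inf V < j + e n" by (simp add: j_def e_def)
    then show ?thesis using cInf_less_iff[OF V_ne V_bdd] by (auto simp: V_def)
  qed
  then obtain xs ys \<rho>s where
    seq: "\<And>n. E (xs n) (ys n) (\<rho>s n)" "\<And>n. J (xs n) (ys n) (\<rho>s n) < j + e n"
    by metis
  have E_convex: "E ((1 - s) *\<^sub>R x + s *\<^sub>R x') ((1 - s) *\<^sub>R y + s *\<^sub>R y') ((1 - s) * \<rho> + s * \<rho>')"
    if "E x y \<rho>" "E x' y' \<rho>'" "0 \<le> s" "s \<le> 1" for x y \<rho> x' y' \<rho>' s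
    unfolding E_def
  proof (intro allI impI)
    fix a b assume "(a, b) \<in> B"
    then have "r x b + r a y - r a b \<le> \<rho>" "r x' b + r a y' - r a b \<le> \<rho>'"
      using that unfolding E_def by blast+
    then have "(1 - s) * (r x b + r a y - r a b) + s * (r x' b + r a y' - r a b) \<le> (1 - s) * \<rho> + s * \<rho>'"
      using that by (intro add_mono mult_left_mono) auto
    then show "r ((1 - s) *\<^sub>R x + s *\<^sub>R x') b + r a ((1 - s) *\<^sub>R y + s *\<^sub>R y') - r a b \<le> (1 - s) * \<rho> + s * \<rho>'"
      by (simp add: bilinear_simps algebra_simps)
  qed
  \<comment> \<open>The parallelogram identity for a general convex combination:
    \<open>s = 1/2\<close> makes minimising sequences Cauchy, and \<open>s\<close> tending to 0
    yields the optimality condition.\<close>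
  have J_mid: "J ((1 - s) *\<^sub>R x + s *\<^sub>R x') ((1 - s) *\<^sub>R y + s *\<^sub>R y') ((1 - s) * \<rho> + s * \<rho>')
      = (1 - s) * J x y \<rho> + s * J x' y' \<rho>' - s * (1 - s) / 2 * (r (x - x') (x - x') + r (y - y') (y - y'))"
    for s x y \<rho> x' y' \<rho>'
    unfolding J_def square_diff square_add using sym[of x' x] sym[of y' y]
    by (simp add: bilinear_simps field_simps)
  have close: "r (xs i - xs k) (xs i - xs k) + r (ys i - ys k) (ys i - ys k) \<le> 4 * e i + 4 * e k" for i k
  proof -
    have "j \<le> 1 / 2 * J (xs i) (ys i) (\<rho>s i) + 1 / 2 * J (xs k) (ys k) (\<rho>s k)
        - 1 / 8 * (r (xs i - xs k) (xs i - xs k) + r (ys i - ys k) (ys i - ys k))"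
      using j_le[OF E_convex[OF seq(1)[of i] seq(1)[of k], of "1/2"]]
      unfolding J_mid by simp
    then show ?thesis using seq(2)[of i] seq(2)[of k] by argo
  qed
  have lim0: "(\<lambda>n. 4 * e n) \<longlonglongrightarrow> 0" using tendsto_mult_right_zero[OF \<open>e \<longlonglongrightarrow> 0\<close>, of 4] .
  obtain x where x: "xs \<longlonglongrightarrow> x"
    using convergent_if_square_le[of xs, OF _ lim0] close nonneg by (meson add_increasing2 dual_order.trans le_add_same_cancel1)
  obtain y where y: "ys \<longlonglongrightarrow> y"
    using convergent_if_square_le[of ys, OF _ lim0] close nonneg
    by (meson add_increasing dual_order.trans le_add_same_cancel2)
  define \<rho> where "\<rho> = j - r x x / 2 - r y y / 2"
  have Exy: "E x y \<rho>"
    unfolding E_def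
  proof (intro allI impI)
    fix a b assume ab: "(a, b) \<in> B"
    have le: "r (xs n) b + r a (ys n) - r a b \<le> j + e n - r (xs n) (xs n) / 2 - r (ys n) (ys n) / 2" for n
      using seq(1,2)[of n] ab unfolding E_def J_def by (smt (verit))
    have "(\<lambda>n. j + e n - r (xs n) (xs n) / 2 - r (ys n) (ys n) / 2) \<longlonglongrightarrow> j + 0 - r x x / 2 - r y y / 2"
      by (intro tendsto_intros x y \<open>e \<longlonglongrightarrow> 0\<close>) auto
    moreover have "(\<lambda>n. r (xs n) b + r a (ys n) - r a b) \<longlonglongrightarrow> r x b + r a y - r a b"
      by (intro tendsto_intros x y)
    ultimately show "r x b + r a y - r a b \<le> \<rho>"
      using le unfolding \<rho>_def by (intro LIMSEQ_le) auto
  qed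
  have Jxy: "J x y \<rho> = j" by (simp add: J_def \<rho>_def)
  have opt: "r x x + r y y + \<rho> \<le> r a b + r x a + r y b" if ab: "(a, b) \<in> B" for a b
  proof -
    define D where "D = r (x - a) (x - a) + r (y - b) (y - b)"
    \<comment> \<open>Minimality is tested along the segment towards a graph point and the result
      divided by \<open>s\<close>; the quadratic remainder keeps the term \<open>D / 2\<close> in
      the limit.\<close>
    have "J x y \<rho> + (1 - s) / 2 * D \<le> J a b (r a b)" if s: "0 < s" "s < 1" for s
    proof -
      have "j \<le> (1 - s) * j + s * J a b (r a b) - s * (1 - s) / 2 * D"
        using j_le[OF E_convex[OF Exy E_B[OF ab], of s]] s unfolding J_mid Jxy D_def by simp
      then have "s * (j + (1 - s) / 2 * D) \<le> s * J a b (r a b)" by (simp add: algebra_simps)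
      then show ?thesis using s Jxy by simp
    qed
    then have *: "\<forall>\<^sub>F s in at_right 0. J x y \<rho> + (1 - s) / 2 * D \<le> J a b (r a b)"
      unfolding eventually_at_right_field by (intro exI[of _ 1]) auto
    have "((\<lambda>s::real. J x y \<rho> + (1 - s) / 2 * D) \<longlongrightarrow> J x y \<rho> + (1 - 0) / 2 * D) (at_right 0)"
      by (intro tendsto_intros) auto
    from tendsto_upperbound[OF this *] have "J x y \<rho> + D / 2 \<le> J a b (r a b)" by simp
    then show ?thesis unfolding J_def D_def square_diff by argo
  qed
  \<comment> \<open>Replacing \<open>\<rho>\<close> by its lower bound \<open>r x y\<close>
    completes the square on the left and factors the right-hand side.\<close>
  have rel: "r (x + y) (x + y) \<le> r (b + x) (a + y)" if "(a, b) \<in> B" for a b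
    using opt[OF that] E_ge[OF Exy] sym[of a b] sym[of b y] sym[of x y]
    by (simp add: square_add bilinear_simps)
  have mem: "(- y, - x) \<in> B"
    by (rule maximal_memI[OF B]) (use rel nonneg[of "x + y"] in \<open>force simp: algebra_simps intro: order_trans\<close>)
  \<comment> \<open>At the pair \<open>(- y, - x)\<close> itself the right-hand side of
    \<open>rel\<close> vanishes.\<close>
  have "nr (x + y) = 0" using rel[OF mem] nonneg[of "x + y"] by (simp add: nr_def)
  then have "- y + - x = 0" using nr_eq_0[of "x + y"] by (simp add: add.commute neg_eq_iff_add_eq_0)
  with mem show ?thesis by blast
qed

text \<open>Translating the first component by \<open>z\<close> and scaling the second by
  \<open>\<mu>\<close> multiplies all pairings of differences by \<open>\<mu>\<close>, so maximality
  survives and the zero-sum case applies.\<close>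

theorem minty:
  assumes B: "maximal B" and "0 < \<mu>"
  shows "\<exists>p q. (p, q) \<in> B \<and> p + \<mu> *\<^sub>R q = z"
proof -
  define C where "C = {(a - z, \<mu> *\<^sub>R b) | a b. (a, b) \<in> B}"
  have "maximal C"
    unfolding maximal_def
  proof (intro conjI allI impI)
    fix a b a' b' assume "(a, b) \<in> C" "(a', b') \<in> C"
    then obtain \<alpha> \<beta> \<alpha>' \<beta>' where *: "(\<alpha>, \<beta>) \<in> B" "(\<alpha>', \<beta>') \<in> B"
      "a = \<alpha> - z" "b = \<mu> *\<^sub>R \<beta>" "a' = \<alpha>' - z" "b' = \<mu> *\<^sub>R \<beta>'" unfolding C_def by blast
    then have "r (b - b') (a - a') = \<mu> * r (\<beta> - \<beta>') (\<alpha> - \<alpha>')"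
      by (simp add: scale_left flip: scaleR_diff_right)
    then show "0 \<le> r (b - b') (a - a')" using maximalD[OF B *(1,2)] \<open>0 < \<mu>\<close> by simp
  next
    fix x y assume *: "\<forall>a b. (a, b) \<in> C \<longrightarrow> 0 \<le> r (b - y) (a - x)"
    have "(x + z, (1 / \<mu>) *\<^sub>R y) \<in> B"
    proof (rule maximal_memI[OF B])
      fix a b assume "(a, b) \<in> B"
      then have "0 \<le> r (\<mu> *\<^sub>R b - y) (a - z - x)" using * unfolding C_def by blast
      also have "\<mu> *\<^sub>R b - y = \<mu> *\<^sub>R (b - (1 / \<mu>) *\<^sub>R y)" using \<open>0 < \<mu>\<close> by (simp add: scaleR_diff_right)
      finally have "0 \<le> \<mu> * r (b - (1 / \<mu>) *\<^sub>R y) (a - z - x)" unfolding scale_left .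
      then have "0 \<le> r (b - (1 / \<mu>) *\<^sub>R y) (a - z - x)" using \<open>0 < \<mu>\<close> by (simp add: zero_le_mult_iff)
      then show "0 \<le> r (b - (1 / \<mu>) *\<^sub>R y) (a - (x + z))" by (simp add: algebra_simps)
    qed
    moreover have "x = x + z - z" "y = \<mu> *\<^sub>R ((1 / \<mu>) *\<^sub>R y)" using \<open>0 < \<mu>\<close> by auto
    ultimately show "(x, y) \<in> C" unfolding C_def by blast
  qed
  from minty_zero[OF this] obtain a b where "(a, b) \<in> B" "a - z + \<mu> *\<^sub>R b = 0"
    unfolding C_def by blast
  then show ?thesis by (intro exI[of _ a] exI[of _ b]) (simp add: algebra_simps)
qed

text \<open>
  Boundedness of the Yosida approximations \<open>q\<close> at \<open>x\<close> replaces weak compactness: their norms increase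
  as \<open>\<mu>\<close> decreases, which makes them a Cauchy sequence.
\<close>

lemma yosida_converges:
  assumes B: "maximal B"
    and bound: "\<forall>\<mu> p q. 0 < \<mu> \<longrightarrow> (p, q) \<in> B \<longrightarrow> p + \<mu> *\<^sub>R q = x \<longrightarrow> nr q \<le> K"
  shows "\<exists>y. (x, y) \<in> B \<and> (\<forall>\<epsilon>>0. \<exists>\<mu>>0. \<exists>p q. (p, q) \<in> B \<and> p + \<mu> *\<^sub>R q = x \<and> nr (q - y) < \<epsilon>)"
proof -
  define l where "l n = 1 / real (Suc n)" for n
  have l_pos: "0 < l n" for n by (simp add: l_def)
  have l_dec: "l k \<le> l n" if "n \<le> k" for n k using that by (simp add: l_def frac_le)
  have l_lim: "l \<longlonglongrightarrow> 0" unfolding l_def using LIMSEQ_inverse_real_of_nat by (simp add: inverse_eq_divide)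
  have "\<exists>p q. (p, q) \<in> B \<and> p + l n *\<^sub>R q = x" for n by (rule minty[OF B l_pos])
  then obtain p q where pq: "\<And>n. (p n, q n) \<in> B" "\<And>n. p n + l n *\<^sub>R q n = x" by metis
  have p_eq: "p n = x - l n *\<^sub>R q n" for n using pq(2)[of n] by (simp add: algebra_simps)
  define b where "b n = r (q n) (q n)" for n
  have b_le: "b n \<le> K\<^sup>2" for n
    using power_mono[OF bound[rule_format, OF l_pos pq(1,2)] nr_nonneg, of n 2] by (simp add: nr_square b_def)
  \<comment> \<open>Monotonicity between two Yosida points, with
    \<open>l i *\<^sub>R q i - l k *\<^sub>R q k\<close> split into half the sum and half the
    difference of the parameters. For \<open>i \<le> k\<close> both factors are nonnegative, so the
    squared norms \<open>b\<close> increase and their increments bound the squared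
    distances.\<close>
  have key: "(l i + l k) * r (q i - q k) (q i - q k) + (l i - l k) * (b i - b k) \<le> 0" for i k
    using maximalD[OF B pq(1)[of i] pq(1)[of k]] sym[of "q i" "q k"]
    unfolding p_eq b_def square_diff by (simp add: bilinear_simps algebra_simps)
  have step: "b i \<le> b k \<and> r (q i - q k) (q i - q k) \<le> b k - b i" if "i \<le> k" for i k
  proof -
    have lt: "l k < l i \<or> i = k" using that by (auto simp: l_def frac_less2 order_le_less)
    show ?thesis
    proof (cases "i = k")
      case False
      then have *: "l k < l i" using lt by simp
      have "(l i + l k) * r (q i - q k) (q i - q k) \<le> (l i - l k) * (b k - b i)"
        using key[of i k] by (simp add: algebra_simps)
      moreover have "(l i - l k) * r (q i - q k) (q i - q k) \<le> (l i + l k) * r (q i - q k) (q i - q k)"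
        using l_pos[of k] nonneg by (intro mult_right_mono) auto
      ultimately have "(l i - l k) * r (q i - q k) (q i - q k) \<le> (l i - l k) * (b k - b i)" by linarith
      then have "r (q i - q k) (q i - q k) \<le> b k - b i" using * by simp
      then show ?thesis using nonneg[of "q i - q k"] by linarith
    qed simp
  qed
  have "incseq b" using step by (simp add: incseq_def)
  then obtain L where L: "b \<longlonglongrightarrow> L" "\<And>n. b n \<le> L" using incseq_convergent[of b "K\<^sup>2"] b_le by metis
  have "\<exists>y. q \<longlonglongrightarrow> y"
  proof (rule convergent_if_square_le)
    show "(\<lambda>n. L - b n) \<longlonglongrightarrow> 0" using tendsto_diff[OF tendsto_const L(1), of L] by simp
    fix i k
    show "r (q i - q k) (q i - q k) \<le> (L - b i) + (L - b k)"
      using step[of i k] step[of k i] L(2)[of i] L(2)[of k] sym[of "q i" "q k"] square_diff[of "q i" "q k"] square_diff[of "q k" "q i"]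
      by (cases "i \<le> k") auto
  qed
  then obtain y where y: "q \<longlonglongrightarrow> y" by blast
  have p: "p \<longlonglongrightarrow> x"
    using tendsto_diff[OF tendsto_const tendsto_scaleR[OF l_lim y], of x] by (simp flip: p_eq)
  have "(x, y) \<in> B"
  proof (rule maximal_memI[OF B])
    fix a b' assume "(a, b') \<in> B"
    then have "0 \<le> r (b' - q n) (a - p n)" for n using maximalD[OF B] pq(1) by blast
    moreover have "(\<lambda>n. r (b' - q n) (a - p n)) \<longlonglongrightarrow> r (b' - y) (a - x)" by (intro tendsto_intros y p)
    ultimately show "0 \<le> r (b' - y) (a - x)" by (intro LIMSEQ_le_const) auto
  qed
  moreover have "\<exists>\<mu>>0. \<exists>p q. (p, q) \<in> B \<and> p + \<mu> *\<^sub>R q = x \<and> nr (q - y) < \<epsilon>" if "0 < \<epsilon>" for \<epsilon>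
  proof -
    have "(\<lambda>n. nr (q n - y)) \<longlonglongrightarrow> nr (y - y)" by (intro tendsto_intros y)
    then have "\<forall>\<^sub>F n in sequentially. nr (q n - y) < \<epsilon>"
      using order_tendstoD(2)[of _ "nr (y - y)" sequentially \<epsilon>] that by simp
    then obtain n where "nr (q n - y) < \<epsilon>" by (auto simp: eventually_sequentially)
    then show ?thesis using pq l_pos by blast
  qed
  ultimately show ?thesis by blast
qed

text \<open>Monotonicity between a graph point and a Yosida point of \<open>x\<close>. At fixed
  \<open>\<mu>\<close> the error vanishes as \<open>x'\<close> approaches \<open>x\<close>, which
  leaves a comparison of \<open>q\<close> with \<open>y'\<close> without any convergence of
  \<open>y'\<close>.\<close>

lemma yosida_test:
  assumes B: "maximal B" and "0 < \<mu>" "(p, q) \<in> B" "p + \<mu> *\<^sub>R q = x" "(x', y') \<in> B" and K: "nr y' \<le> K"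
  shows "r q q - (K + nr q) * nr (x' - x) / \<mu> \<le> r y' q"
proof -
  have "0 \<le> r (y' - q) (x' - p)" using maximalD[OF B] assms by blast
  also have "x' - p = (x' - x) + \<mu> *\<^sub>R q" using assms(4) by (simp add: algebra_simps)
  finally have "0 \<le> r (y' - q) (x' - x) + \<mu> * (r y' q - r q q)" by (simp add: bilinear_simps)
  moreover have "r (y' - q) (x' - x) \<le> (K + nr q) * nr (x' - x)"
  proof -
    have "nr (y' - q) \<le> K + nr q" using nr_triangle[of y' "- q"] K by (simp add: nr_minus)
    then show ?thesis using le_nr[of "y' - q" "x' - x"] by (meson mult_right_mono nr_nonneg order_trans)
  qed
  ultimately have "0 \<le> (K + nr q) * nr (x' - x) + \<mu> * (r y' q - r q q)" by linarith
  then show ?thesis using \<open>0 < \<mu>\<close> by (simp add: field_simps)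
qed

text \<open>The sequence \<open>ys\<close> need not converge. It serves as a test that bounds every
  Yosida approximation of \<open>x\<close> by \<open>K\<close>, and their limit is the required
  value.\<close>

lemma maximal_closed:
  assumes B: "maximal B" and xs: "xs \<longlonglongrightarrow> x"
    and ys: "\<forall>\<^sub>F n in sequentially. (xs n, ys n) \<in> B \<and> nr (ys n) \<le> K"
  shows "\<exists>y. (x, y) \<in> B \<and> nr y \<le> K"
proof -
  have bound: "nr q \<le> K" if q: "0 < \<mu>" "(p, q) \<in> B" "p + \<mu> *\<^sub>R q = x" for \<mu> p q
  proof -
    have "\<forall>\<^sub>F n in sequentially. r q q - (K + nr q) * nr (xs n - x) / \<mu> \<le> K * nr q"
    proof (rule eventually_mono[OF ys])
      fix n assume n: "(xs n, ys n) \<in> B \<and> nr (ys n) \<le> K"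
      then have "r (ys n) q \<le> K * nr q" using le_nr[of "ys n" q] by (meson mult_right_mono nr_nonneg order_trans)
      then show "r q q - (K + nr q) * nr (xs n - x) / \<mu> \<le> K * nr q"
        using yosida_test[OF B q, of "xs n" "ys n" K] n by simp
    qed
    moreover have "(\<lambda>n. r q q - (K + nr q) * nr (xs n - x) / \<mu>) \<longlonglongrightarrow> r q q - (K + nr q) * nr (x - x) / \<mu>"
      using q(1) by (intro tendsto_intros xs) auto
    ultimately have "r q q \<le> K * nr q" using tendsto_upperbound by fastforce
    then have "nr q * nr q \<le> K * nr q" using nr_square[of q] by (simp add: power2_eq_square)
    moreover have "0 \<le> K" using eventually_happens[OF ys] nr_nonneg order_trans by (metis sequentially_bot)
    ultimately show ?thesis using nr_nonneg[of q] by (cases "nr q = 0") auto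
  qed
  then have "\<forall>\<mu> p q. 0 < \<mu> \<longrightarrow> (p, q) \<in> B \<longrightarrow> p + \<mu> *\<^sub>R q = x \<longrightarrow> nr q \<le> K" by blast
  from yosida_converges[OF B this] obtain y where
    y: "(x, y) \<in> B" "\<And>\<epsilon>. \<epsilon> > 0 \<Longrightarrow> \<exists>\<mu>>0. \<exists>p q. (p, q) \<in> B \<and> p + \<mu> *\<^sub>R q = x \<and> nr (q - y) < \<epsilon>"
    by blast
  have "nr y \<le> K + \<epsilon>" if \<epsilon>: "\<epsilon> > 0" for \<epsilon>
  proof -
    obtain \<mu> p q where *: "\<mu> > 0" "(p, q) \<in> B" "p + \<mu> *\<^sub>R q = x" "nr (q - y) < \<epsilon>" using y(2)[OF \<epsilon>] by blast
    have "nr y \<le> nr q + nr (y - q)" using nr_triangle[of q "y - q"] by simp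
    then show ?thesis using bound[OF *(1-3)] *(4) nr_diff_commute[of y q] by simp
  qed
  then have "nr y \<le> K" by (rule field_le_epsilon)
  then show ?thesis using y(1) by blast
qed

text \<open>Since \<open>y\<close> is the only value at \<open>x\<close>, the Yosida approximations
  come close to it. One of them, \<open>q\<close>, is fixed, and then \<open>x'\<close> is taken
  close to \<open>x\<close> relative to its parameter \<open>\<mu>\<close>, so that
  \<open>yosida_test\<close> bounds \<open>r y' q\<close> and hence \<open>r y' y\<close> from
  below.\<close>

lemma maximal_demicontinuous:
  assumes B: "maximal B" and xy: "(x, y) \<in> B" and uniq: "\<And>y'. (x, y') \<in> B \<Longrightarrow> y' = y"
    and "0 < \<epsilon>" "0 \<le> K"
  shows "\<exists>\<delta>>0. \<forall>x' y'. (x', y') \<in> B \<longrightarrow> nr (x' - x) < \<delta> \<longrightarrow> nr y' \<le> K \<longrightarrow> r y y - \<epsilon> \<le> r y' y"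
proof -
  have bound: "nr q \<le> nr y" if q: "0 < \<mu>" "(p, q) \<in> B" "p + \<mu> *\<^sub>R q = x" for \<mu> p q
  proof -
    have "r q q \<le> nr y * nr q" using yosida_test[OF B q xy order_refl] le_nr[of y q] by simp
    then have "nr q * nr q \<le> nr y * nr q" using nr_square[of q] by (simp add: power2_eq_square)
    then show ?thesis using nr_nonneg[of q] nr_nonneg[of y] by (cases "nr q = 0") auto
  qed
  \<comment> \<open>Half of \<open>\<epsilon>\<close> pays for exchanging \<open>q\<close> and
    \<open>y\<close> in both arguments, which costs \<open>(K + 2 * nr y) * e\<close>.\<close>
  define e where "e = \<epsilon> / (2 * (K + 2 * nr y + 1))"
  have den: "K + 2 * nr y + 1 > 0" using nr_nonneg[of y] \<open>0 \<le> K\<close> by linarith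
  then have "e > 0" using \<open>0 < \<epsilon>\<close> by (simp add: e_def)
  obtain \<mu> p q where pq: "0 < \<mu>" "(p, q) \<in> B" "p + \<mu> *\<^sub>R q = x" "nr (q - y) < e"
    using yosida_converges[OF B, of x] bound uniq \<open>e > 0\<close> by metis
  \<comment> \<open>The other half pays for the error term of \<open>yosida_test\<close>, where
    \<open>nr q \<le> nr y\<close>.\<close>
  define \<delta> where "\<delta> = \<mu> * \<epsilon> / (2 * (K + nr y + 1))"
  have den2: "K + nr y + 1 > 0" using nr_nonneg[of y] \<open>0 \<le> K\<close> by linarith
  have "\<delta> > 0" using pq(1) \<open>0 < \<epsilon>\<close> den2 by (simp add: \<delta>_def)
  moreover have "r y y - \<epsilon> \<le> r y' y" if *: "(x', y') \<in> B" "nr (x' - x) < \<delta>" "nr y' \<le> K" for x' y'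
  proof -
    have "(K + nr q) * nr (x' - x) / \<mu> \<le> (K + nr y + 1) * \<delta> / \<mu>"
      using bound[OF pq(1-3)] * \<open>0 \<le> K\<close> pq(1) den2 by (intro divide_right_mono mult_mono) auto
    also have "\<dots> = \<epsilon> / 2"
    proof -
      have "k * (\<mu> * \<epsilon> / (2 * k)) / \<mu> = \<epsilon> / 2" if "k > 0" for k using that pq(1) by simp
      from this[OF den2] show ?thesis unfolding \<delta>_def .
    qed
    finally have 1: "r q q - \<epsilon> / 2 \<le> r y' q" using yosida_test[OF B pq(1-3) *(1,3)] by simp
    have ry: "r y' (q - y) \<le> K * e"
    proof -
      have "nr y' * nr (q - y) \<le> K * e" using * pq \<open>0 \<le> K\<close> by (intro mult_mono) auto
      then show ?thesis using le_nr[of y' "q - y"] by simp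
    qed
    have "r y (y - q) \<le> nr y * e"
    proof -
      have "nr y * nr (y - q) \<le> nr y * e"
        using pq nr_diff_commute[of y q] by (intro mult_left_mono) auto
      then show ?thesis using le_nr[of y "y - q"] by simp
    qed
    then have "r y y - 2 * nr y * e \<le> r q q" using nonneg[of "q - y"] sym[of q y]
      unfolding square_diff by (simp add: bilinear_simps)
    moreover have "r y' q - r y' y \<le> K * e" using ry by (simp add: bilinear_simps)
    moreover have "(K + 2 * nr y) * e \<le> \<epsilon> / 2"
    proof -
      have "(K + 2 * nr y) * e \<le> (K + 2 * nr y + 1) * e" using \<open>e > 0\<close> by (intro mult_right_mono) auto
      also have "\<dots> = \<epsilon> / 2"
      proof -
        have "k * (\<epsilon> / (2 * k)) = \<epsilon> / 2" if "k > 0" for k using that by simp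
        from this[OF den] show ?thesis unfolding e_def .
      qed
      finally show ?thesis .
    qed
    ultimately show ?thesis using 1 by (simp add: algebra_simps)
  qed
  ultimately show ?thesis by blast
qed

end

section \<open>Quasi-monotone operators, reduced to the monotone case by a shift\<close>

locale quasi_maximal = hilbert_form r m M for r :: "'a::real_normed_vector \<Rightarrow> 'a \<Rightarrow> real" and m M +
  fixes A :: "'a operator" and \<omega> :: real
  assumes maximal_shift: "maximal (op_shift A \<omega>)" and omega_nonneg: "0 \<le> \<omega>"
    and single: "single_valued A"
begin

lemma quasi_monotone:
  assumes "(u, v) \<in> A" "(u', v') \<in> A"
  shows "- \<omega> * r (u - u') (u - u') \<le> r (v - v') (u - u')"
proof -
  have "(u, v + \<omega> *\<^sub>R u) \<in> op_shift A \<omega>" "(u', v' + \<omega> *\<^sub>R u') \<in> op_shift A \<omega>"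
    using assms unfolding op_shift_def by blast+
  from maximalD[OF maximal_shift this] have "0 \<le> r ((v - v') + \<omega> *\<^sub>R (u - u')) (u - u')"
    by (simp add: algebra_simps)
  then show ?thesis unfolding add_left scale_left by simp
qed

text \<open>With \<open>k = 1 - h * \<omega>\<close>, the equation is \<open>k\<close> times the
  resolvent equation of the shifted operator with parameter \<open>h / k\<close> and right-hand side
  \<open>z / k\<close>.\<close>

lemma quasi_resolvent:
  assumes "0 < h" "h * \<omega> < 1"
  shows "\<exists>p q. (p, q) \<in> A \<and> p + h *\<^sub>R q = z"
proof -
  define k where "k = 1 - h * \<omega>"
  have k: "k > 0" using assms by (simp add: k_def)
  obtain p b where "(p, b) \<in> op_shift A \<omega>" "p + (h / k) *\<^sub>R b = (1 / k) *\<^sub>R z"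
    using minty[OF maximal_shift, of "h / k" "(1 / k) *\<^sub>R z"] k assms by auto
  then obtain q where q: "(p, q) \<in> A" "p + (h / k) *\<^sub>R (q + \<omega> *\<^sub>R p) = (1 / k) *\<^sub>R z"
    unfolding op_shift_def by blast
  have "k *\<^sub>R (p + (h / k) *\<^sub>R (q + \<omega> *\<^sub>R p)) = z" unfolding q(2) using k by simp
  then have "k *\<^sub>R p + h *\<^sub>R (q + \<omega> *\<^sub>R p) = z" using k by (simp add: scaleR_add_right)
  then have "p + h *\<^sub>R q = z" by (simp add: k_def algebra_simps)
  with q(1) show ?thesis by blast
qed

text \<open>Recentring the shift at \<open>x\<close> leaves the value of the operator at \<open>x\<close> unchanged.\<close>

lemma maximal_recentred: "maximal {(u, v + \<omega> *\<^sub>R (u - x)) | u v. (u, v) \<in> A}" (is "maximal ?B")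
  unfolding maximal_def
proof (intro conjI allI impI)
  fix a b a' b' assume "(a, b) \<in> ?B" "(a', b') \<in> ?B"
  then have *: "(a, b + \<omega> *\<^sub>R x) \<in> op_shift A \<omega>" "(a', b' + \<omega> *\<^sub>R x) \<in> op_shift A \<omega>"
    unfolding op_shift_def by (auto simp: algebra_simps)
  show "0 \<le> r (b - b') (a - a')" using maximalD[OF maximal_shift *] by simp
next
  fix u w assume *: "\<forall>a b. (a, b) \<in> ?B \<longrightarrow> 0 \<le> r (b - w) (a - u)"
  have "(u, w + \<omega> *\<^sub>R x) \<in> op_shift A \<omega>"
  proof (rule maximal_memI[OF maximal_shift])
    fix a b assume "(a, b) \<in> op_shift A \<omega>"
    then obtain v where v: "(a, v) \<in> A" "b = v + \<omega> *\<^sub>R a" unfolding op_shift_def by blast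
    then have "(a, v + \<omega> *\<^sub>R (a - x)) \<in> ?B" by blast
    then have "0 \<le> r (v + \<omega> *\<^sub>R (a - x) - w) (a - u)" using * by blast
    then show "0 \<le> r (b - (w + \<omega> *\<^sub>R x)) (a - u)" using v(2) by (simp add: algebra_simps)
  qed
  then obtain v where "(u, v) \<in> A" "w + \<omega> *\<^sub>R x = v + \<omega> *\<^sub>R u" unfolding op_shift_def by blast
  then have "(u, v) \<in> A" "w = v + \<omega> *\<^sub>R (u - x)" by (auto simp: algebra_simps)
  then show "(u, w) \<in> ?B" by blast
qed

text \<open>Recentring at the limit \<open>x\<close> perturbs the values by
  \<open>\<omega> *\<^sub>R (xs n - x)\<close>, which tends to 0 and is absorbed by the summand 1,
  while the value at \<open>x\<close> itself is unchanged.\<close>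

lemma quasi_closed:
  assumes xs: "xs \<longlonglongrightarrow> x" and ys: "\<forall>\<^sub>F n in sequentially. (xs n, ys n) \<in> A \<and> nr (ys n) \<le> K"
  shows "\<exists>y. (x, y) \<in> A \<and> nr y \<le> K + 1"
proof -
  let ?B = "{(u, v + \<omega> *\<^sub>R (u - x)) | u v. (u, v) \<in> A}"
  have lim: "(\<lambda>n. \<omega> * nr (xs n - x)) \<longlonglongrightarrow> \<omega> * nr (x - x)" by (intro tendsto_intros xs)
  have "\<forall>\<^sub>F n in sequentially. \<omega> * nr (xs n - x) < 1"
    using order_tendstoD(2)[OF lim, of 1] by simp
  with ys have ev: "\<forall>\<^sub>F n in sequentially. (xs n, ys n + \<omega> *\<^sub>R (xs n - x)) \<in> ?B \<and> nr (ys n + \<omega> *\<^sub>R (xs n - x)) \<le> K + 1"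
  proof eventually_elim
    case (elim n)
    have "nr (ys n + \<omega> *\<^sub>R (xs n - x)) \<le> nr (ys n) + \<omega> * nr (xs n - x)"
      using nr_triangle[of "ys n" "\<omega> *\<^sub>R (xs n - x)"] omega_nonneg by (simp add: nr_scale)
    then show ?case using elim by auto
  qed
  from maximal_closed[OF maximal_recentred xs this] show ?thesis by auto
qed

lemma quasi_demicontinuous:
  assumes xy: "(x, y) \<in> A" and "0 < \<epsilon>" "0 \<le> K"
  shows "\<exists>\<delta>>0. \<forall>x' y'. (x', y') \<in> A \<longrightarrow> nr (x' - x) < \<delta> \<longrightarrow> nr y' \<le> K \<longrightarrow> r y y - \<epsilon> \<le> r y' y"
proof -
  let ?B = "{(u, v + \<omega> *\<^sub>R (u - x)) | u v. (u, v) \<in> A}"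
  have mem: "(x, y) \<in> ?B" using xy by force
  have uniq: "y' = y" if "(x, y') \<in> ?B" for y' using that xy single by (auto simp: single_valued_def)
  obtain \<delta> where \<delta>: "\<delta> > 0" "\<And>x' y'. (x', y') \<in> ?B \<Longrightarrow> nr (x' - x) < \<delta> \<Longrightarrow> nr y' \<le> K + 1 \<Longrightarrow> r y y - \<epsilon> / 2 \<le> r y' y"
    using maximal_demicontinuous[OF maximal_recentred mem uniq, of "\<epsilon> / 2" "K + 1"] assms(2,3) by auto
  define k where "k = 2 * (\<omega> + 1) * (nr y + 1)"
  have k: "k > 0" using omega_nonneg nr_nonneg[of y] unfolding k_def by (intro mult_pos_pos add_nonneg_pos) auto
  \<comment> \<open>The three bounds serve the recentred graph, keep the recentred value below
    \<open>K + 1\<close>, and make the pairing of the recentring term with \<open>y\<close> at most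
    \<open>\<epsilon> / 2\<close>.\<close>
  define \<delta>' where "\<delta>' = min \<delta> (min (1 / (\<omega> + 1)) (\<epsilon> / k))"
  have "\<delta>' > 0" using \<delta>(1) k \<open>0 < \<epsilon>\<close> omega_nonneg by (simp add: \<delta>'_def)
  moreover have "r y y - \<epsilon> \<le> r y' y" if *: "(x', y') \<in> A" "nr (x' - x) < \<delta>'" "nr y' \<le> K" for x' y'
  proof -
    have n: "nr (x' - x) < \<delta>" "nr (x' - x) \<le> 1 / (\<omega> + 1)" "nr (x' - x) \<le> \<epsilon> / k"
      using *(2) by (auto simp: \<delta>'_def)
    have "\<omega> * nr (x' - x) \<le> (\<omega> + 1) * (1 / (\<omega> + 1))" using omega_nonneg n(2) by (intro mult_mono) auto
    then have 1: "\<omega> * nr (x' - x) \<le> 1" using omega_nonneg by simp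
    have "nr (y' + \<omega> *\<^sub>R (x' - x)) \<le> K + 1"
      using nr_triangle[of y' "\<omega> *\<^sub>R (x' - x)"] 1 *(3) omega_nonneg by (simp add: nr_scale)
    then have 2: "r y y - \<epsilon> / 2 \<le> r (y' + \<omega> *\<^sub>R (x' - x)) y" using \<delta>(2) *(1) n(1) by blast
    have "r (\<omega> *\<^sub>R (x' - x)) y \<le> (\<omega> * nr (x' - x)) * nr y"
      using le_nr[of "\<omega> *\<^sub>R (x' - x)" y] omega_nonneg by (simp add: nr_scale)
    also have "\<dots> \<le> ((\<omega> + 1) * (\<epsilon> / k)) * (nr y + 1)"
      using omega_nonneg n(3) \<open>0 < \<epsilon>\<close> k by (intro mult_mono) auto
    also have "\<dots> = ((\<omega> + 1) * (nr y + 1)) * (\<epsilon> / k)" by (simp only: mult_ac)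
    also have "(\<omega> + 1) * (nr y + 1) = k / 2" by (simp add: k_def)
    also have "k / 2 * (\<epsilon> / k) = \<epsilon> / 2" using k by simp
    finally show ?thesis using 2 by (simp add: add_left)
  qed
  ultimately show ?thesis by blast
qed

end

section \<open>Equivalence of complete norms\<close>

context psd_form
begin

text \<open>
  The inverse mapping theorem for the identity between the two norms: by Baire's theorem some ball of
  \<open>norm\<close> is \<open>nr\<close>-dense in a ball of \<open>nr\<close>, and successive approximation removes the density.
\<close>

lemma norm_le_of_complete:
  assumes definite: "\<And>x. x \<noteq> 0 \<Longrightarrow> 0 < r x x"
    and upper: "\<And>x. nr x \<le> M * norm x"
    and nr_complete: "\<And>x. (\<forall>e>0. \<exists>N. \<forall>m\<ge>N. \<forall>n\<ge>N. nr (x m - x n) < e) \<Longrightarrow>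
        (\<exists>l. (\<lambda>n::nat. nr (x n - l)) \<longlonglongrightarrow> 0)"
    and complete: "complete (UNIV :: 'a set)"
  shows "\<exists>m>0. \<forall>x. m * norm x \<le> nr x"
proof -
  have nr0: "nr x = 0 \<longleftrightarrow> x = 0" for x using definite[of x] by (cases "x = 0") (auto simp: nr_def)
  interpret Metric_space "UNIV :: 'a set" "\<lambda>x y. nr (x - y)"
    by unfold_locales (simp, rule nr_diff_commute, simp add: nr0, rule nr_triangle_diff)
  have mcomplete: mcomplete
    unfolding mcomplete_def MCauchy_def limitin_metric_dist_null
  proof (intro allI impI)
    fix x :: "nat \<Rightarrow> 'a"
    assume "range x \<subseteq> UNIV \<and> (\<forall>e>0. \<exists>N. \<forall>m n. N \<le> m \<longrightarrow> N \<le> n \<longrightarrow> nr (x m - x n) < e)"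
    then have "\<forall>e>0. \<exists>N. \<forall>m\<ge>N. \<forall>n\<ge>N. nr (x m - x n) < e" by meson
    from nr_complete[OF this]
    show "\<exists>l. l \<in> UNIV \<and> (\<forall>\<^sub>F n in sequentially. x n \<in> UNIV) \<and> (\<lambda>n. nr (x n - l)) \<longlonglongrightarrow> 0"
      by simp
  qed
  define F where "F n = mtopology closure_of {x. norm x \<le> real n}" for n
  \<comment> \<open>The closures \<open>F n\<close> cover the space, so Baire's theorem forbids that
    all of them have empty interior.\<close>
  have "\<exists>n. mtopology interior_of F n \<noteq> {}"
  proof (rule ccontr)
    assume none: "\<not> ?thesis"
    have "mtopology interior_of \<Union>(range F) = {}"
      
      by (rule metric_Baire_category_alt[OF mcomplete]) (use none in \<open>auto simp: F_def\<close>)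
    moreover have "\<Union>(range F) = UNIV"
    proof -
      have "x \<in> F (nat \<lceil>norm x\<rceil>)" for x
        unfolding F_def
        using closure_of_subset[of "{y. norm y \<le> real (nat \<lceil>norm x\<rceil>)}" mtopology]
        by (simp add: subset_iff of_nat_ceiling)
      then show ?thesis by blast
    qed
    ultimately show False using interior_of_topspace[of mtopology] by simp
  qed
  then obtain n x0 where "x0 \<in> mtopology interior_of F n" by blast
  then obtain \<rho> where \<rho>: "\<rho> > 0" "mball x0 \<rho> \<subseteq> F n"
    using openin_interior_of[of mtopology "F n"] interior_of_subset[of mtopology "F n"]
    unfolding openin_mtopology by blast
  have F_approx: "\<exists>y. norm y \<le> real n \<and> nr (x - y) < \<epsilon>" if x: "x \<in> F n" "\<epsilon> > 0" for x \<epsilon>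
  proof -
    obtain y where "norm y \<le> n" "y \<in> mball x \<epsilon>"
      using x(1)[unfolded F_def metric_closure_of] x(2) by blast
    then show ?thesis by auto
  qed
  \<comment> \<open>Subtracting approximants of \<open>x0 + z\<close> and \<open>x0\<close> moves
    the ball from \<open>x0\<close> to the origin; this doubles the norm bound.\<close>
  have near: "\<exists>y. norm y \<le> 2 * real n \<and> nr (z - y) < \<epsilon>" if z: "nr z < \<rho>" and "\<epsilon> > 0" for z \<epsilon>
  proof -
    have "x0 + z \<in> F n" "x0 \<in> F n" using \<rho> z by (auto simp: nr_minus intro!: subsetD[OF \<rho>(2)])
    then obtain y1 y2 where y: "norm y1 \<le> n" "nr (x0 + z - y1) < \<epsilon> / 2" "norm y2 \<le> n" "nr (x0 - y2) < \<epsilon> / 2"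
      using F_approx[of "x0 + z" "\<epsilon> / 2"] F_approx[of x0 "\<epsilon> / 2"] \<open>\<epsilon> > 0\<close> by auto
    have "nr (z - (y1 - y2)) \<le> nr (x0 + z - y1) + nr (x0 - y2)"
      using nr_triangle[of "x0 + z - y1" "- (x0 - y2)"] nr_minus[of "x0 - y2"] by (simp add: algebra_simps)
    moreover have "norm (y1 - y2) \<le> 2 * real n" using norm_triangle_ineq4[of y1 y2] y by simp
    ultimately show ?thesis using y by (intro exI[of _ "y1 - y2"]) auto
  qed
  \<comment> \<open>The factor 4 is 2 from \<open>near\<close> times 2 from the rescaling to radius
    \<open>\<rho> / 2\<close>; the summand 1 keeps \<open>K\<close> positive when
    \<open>n = 0\<close>.\<close>
  define K where "K = 4 * real n / \<rho> + 1"
  have K: "K > 0" using \<rho>(1) by (auto simp: K_def intro: add_nonneg_pos)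
  have approx: "\<exists>y. norm y \<le> K * nr z \<and> nr (z - y) < \<epsilon>" if \<epsilon>: "\<epsilon> > 0" for z \<epsilon>
  proof (cases "z = 0")
    case True
    then show ?thesis using \<epsilon> by (intro exI[of _ 0]) auto
  next
    case False
    then have z: "nr z > 0" using nr0[of z] nr_nonneg[of z] by linarith
    define s where "s = 2 * nr z / \<rho>"
    have s: "s > 0" using z \<rho> by (simp add: s_def)
    have "nr ((1 / s) *\<^sub>R z) < \<rho>" using z \<rho>(1) by (simp add: nr_scale s_def)
    then obtain y where y: "norm y \<le> 2 * real n" "nr ((1 / s) *\<^sub>R z - y) < \<epsilon> / s"
      using near[of "(1 / s) *\<^sub>R z" "\<epsilon> / s"] s \<epsilon> by auto
    have "z - s *\<^sub>R y = s *\<^sub>R ((1 / s) *\<^sub>R z - y)" using s by (simp add: algebra_simps)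
    then have "nr (z - s *\<^sub>R y) = \<bar>s\<bar> * nr ((1 / s) *\<^sub>R z - y)" by (simp only: nr_scale)
    then have "nr (z - s *\<^sub>R y) < \<epsilon>" using y(2) s by (simp add: field_simps)
    moreover have "norm (s *\<^sub>R y) \<le> K * nr z"
    proof -
      have "norm (s *\<^sub>R y) \<le> s * (2 * real n)" using s y(1) by (simp add: mult_left_mono)
      also have "\<dots> = (4 * real n / \<rho>) * nr z" by (simp add: s_def)
      also have "\<dots> \<le> K * nr z" by (intro mult_right_mono) (auto simp: K_def)
      finally show ?thesis .
    qed
    ultimately show ?thesis by blast
  qed
  have "norm x \<le> 2 * K * nr x" for x
  proof (cases "x = 0")
    case False
    then have nx: "nr x > 0" using nr0[of x] nr_nonneg[of x] by linarith
    \<comment> \<open>\<open>z k\<close> is the residual after \<open>k\<close> approximations. Each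
      step halves the bound on \<open>nr\<close>, so the corrections form a geometric series in
      \<open>norm\<close> with sum at most \<open>2 * K * nr x\<close>.\<close>
    have "\<exists>z. \<forall>k. (nr (z k) \<le> nr x / 2 ^ k \<and> (k = 0 \<longrightarrow> z k = x)) \<and> norm (z k - z (Suc k)) \<le> K * nr x / 2 ^ k"
    proof (rule dependent_nat_choice)
      show "\<exists>z. nr z \<le> nr x / 2 ^ 0 \<and> (0 = (0::nat) \<longrightarrow> z = x)" by auto
      fix z k assume z: "nr z \<le> nr x / 2 ^ k \<and> (k = 0 \<longrightarrow> z = x)"
      obtain y where y: "norm y \<le> K * nr z" "nr (z - y) < nr x / 2 ^ Suc k"
        using approx[of "nr x / 2 ^ Suc k" z] nx by auto
      have "K * nr z \<le> K * (nr x / 2 ^ k)" using z K by (intro mult_left_mono) auto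
      then show "\<exists>z'. (nr z' \<le> nr x / 2 ^ Suc k \<and> (Suc k = 0 \<longrightarrow> z' = x)) \<and> norm (z - z') \<le> K * nr x / 2 ^ k"
        using y by (intro exI[of _ "z - y"]) auto
    qed
    then obtain z where z: "\<And>k. nr (z k) \<le> nr x / 2 ^ k" "z 0 = x" "\<And>k. norm (z k - z (Suc k)) \<le> K * nr x / 2 ^ k"
      by metis
    have tail: "norm (z j - z (j + i)) \<le> K * nr x * (2 / 2 ^ j - 2 / 2 ^ (j + i))" for i j
    proof (induction i)
      case (Suc i)
      have "norm (z j - z (j + Suc i)) \<le> norm (z j - z (j + i)) + norm (z (j + i) - z (Suc (j + i)))"
        using norm_triangle_ineq[of "z j - z (j + i)" "z (j + i) - z (Suc (j + i))"] by simp
      also have "\<dots> \<le> K * nr x * (2 / 2 ^ j - 2 / 2 ^ (j + i)) + K * nr x / 2 ^ (j + i)"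
        using Suc z(3)[of "j + i"] by linarith
      also have "\<dots> = K * nr x * (2 / 2 ^ j - 2 / 2 ^ (j + Suc i))"
        by (simp add: algebra_simps)
      finally show ?case .
    qed simp
    have Knx: "0 \<le> K * nr x" using K nx by simp
    have tail': "norm (z j - z i) \<le> K * nr x * (2 / 2 ^ j)" if "j \<le> i" for i j
    proof -
      have "K * nr x * (2 / 2 ^ j - 2 / 2 ^ i) \<le> K * nr x * (2 / 2 ^ j)" using Knx by (intro mult_left_mono) auto
      then show ?thesis using tail[of j "i - j"] that by simp
    qed
    have lim: "(\<lambda>j. K * nr x * (2 / 2 ^ j)) \<longlonglongrightarrow> 0"
      by (intro tendsto_mult_right_zero) (use LIMSEQ_divide_realpow_zero[of 2 2] in auto)
    have "Cauchy z"
    proof (rule metric_CauchyI)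
      fix e :: real assume "e > 0"
      then obtain N where N: "K * nr x * (2 / 2 ^ N) < e / 2"
        using order_tendstoD(2)[OF lim, of "e / 2"] by (auto simp: eventually_sequentially)
      show "\<exists>N. \<forall>i\<ge>N. \<forall>j\<ge>N. dist (z i) (z j) < e"
      proof (intro exI allI impI)
        fix i j assume "N \<le> i" "N \<le> j"
        then have "norm (z N - z i) < e / 2" "norm (z N - z j) < e / 2"
          using tail'[of N i] tail'[of N j] N by auto
        then show "dist (z i) (z j) < e"
          by (metis dist_commute dist_norm dist_triangle_half_l)
      qed
    qed
    then obtain l where l: "z \<longlonglongrightarrow> l" using complete by (metis UNIV_I complete_def)
    \<comment> \<open>The residuals converge in \<open>norm\<close>; as \<open>nr\<close> is
      dominated by \<open>norm\<close>, their limit has \<open>nr\<close> equal to 0 and so is 0.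
      Hence \<open>x\<close> is the full sum of the corrections.\<close>
    have "(\<lambda>k. nr x / 2 ^ k + M * norm (z k - l)) \<longlonglongrightarrow> 0 + M * norm (l - l)"
      by (intro tendsto_intros l LIMSEQ_divide_realpow_zero) auto
    moreover have "nr l \<le> nr x / 2 ^ k + M * norm (z k - l)" for k
      using nr_triangle[of "z k" "l - z k"] z(1)[of k] upper[of "l - z k"] by (simp add: norm_minus_commute)
    ultimately have "nr l \<le> 0" by (intro LIMSEQ_le_const[of _ 0]) auto
    then have "l = 0" using nr0[of l] nr_nonneg[of l] by linarith
    have "(\<lambda>k. norm (z 0 - z k)) \<longlonglongrightarrow> norm (z 0 - l)" by (intro tendsto_intros l)
    moreover have "norm (z 0 - z k) \<le> 2 * K * nr x" for k using tail'[of 0 k] by (simp add: mult_ac)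
    ultimately have "norm (z 0 - l) \<le> 2 * K * nr x" by (intro LIMSEQ_le_const2) auto
    then show ?thesis using \<open>l = 0\<close> z(2) by simp
  qed simp
  then have "1 / (2 * K) * norm x \<le> nr x" for x using K by (simp add: field_simps)
  moreover have "1 / (2 * K) > 0" using K by simp
  ultimately show ?thesis by blast
qed

end

section \<open>Time-dependent forms\<close>

lemma has_vector_derivative_quotient:
  "(f has_vector_derivative D) (at x within S) \<Longrightarrow>
    ((\<lambda>y. (1 / (y - x)) *\<^sub>R (f y - f x)) \<longlongrightarrow> D) (at x within S)"
proof -
  assume "(f has_vector_derivative D) (at x within S)"
  then have *: "((\<lambda>y. norm (f y - f x - (y - x) *\<^sub>R D) / norm (y - x)) \<longlongrightarrow> 0) (at x within S)"
    unfolding has_vector_derivative_def has_derivative_iff_norm by simp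
  have "\<forall>\<^sub>F y in at x within S. norm (f y - f x - (y - x) *\<^sub>R D) / norm (y - x) =
      norm ((1 / (y - x)) *\<^sub>R (f y - f x) - D)"
    unfolding eventually_at_filter
  proof (intro always_eventually allI impI)
    fix y assume "y \<noteq> x"
    then have "(1 / (y - x)) *\<^sub>R (f y - f x) - D = (1 / (y - x)) *\<^sub>R (f y - f x - (y - x) *\<^sub>R D)"
      by (simp add: scaleR_diff_right)
    then show "norm (f y - f x - (y - x) *\<^sub>R D) / norm (y - x) = norm ((1 / (y - x)) *\<^sub>R (f y - f x) - D)"
      by simp
  qed
  from Lim_transform_eventually[OF * this] show ?thesis
    by (simp add: tendsto_norm_zero_iff LIM_zero_iff)
qed

text \<open>Kept outside the time-dependent locale because growth of the norms is what first
  produces the constants \<open>m\<close> and \<open>M\<close> that the locale presupposes.\<close>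

lemma exponential_growth:
  fixes f :: "real \<Rightarrow> real"
  assumes deriv: "\<And>t. t \<in> {0..T} \<Longrightarrow> \<exists>d. (f has_real_derivative d) (at t within {0..T}) \<and> d \<le> 2 * c * f t"
    and c: "0 \<le> c" and st: "0 \<le> s" "s \<le> t" "t \<le> T"
  shows "f t \<le> exp (2 * c * (t - s)) * f s"
proof -
  have cont: "continuous_on {0..T} f"
    unfolding continuous_on_eq_continuous_within
  proof
    fix t assume "t \<in> {0..T}"
    then obtain d where "(f has_real_derivative d) (at t within {0..T})" using deriv by blast
    then show "continuous (at t within {0..T}) f" by (rule DERIV_continuous)
  qed
  have "f t \<le> exp (2 * c * (t - s)) * (f s + 0 * (t - s))"
  proof (rule right_gronwall[where N = "{}"])
    show "continuous_on {s..t} f" using st by (intro continuous_on_subset[OF cont]) auto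
    fix \<tau> assume "\<tau> \<in> {s..<t} - {}"
    moreover from this obtain d where "(f has_real_derivative d) (at \<tau> within {0..T})" "d \<le> 2 * c * f \<tau>"
      using deriv[of \<tau>] st by auto
    ultimately show "\<exists>d. (f has_real_derivative d) (at \<tau> within {\<tau>..t}) \<and> d \<le> 2 * c * f \<tau> + 0"
      using st by (intro exI[of _ d]) (auto intro: DERIV_subset)
  qed (use st c in auto)
  then show ?thesis by simp
qed

text \<open>All norms in \<open>lipschitz\<close> are the type norm, and \<open>m\<close>,
  \<open>M\<close> are uniform in \<open>t\<close>; both forms of the hypotheses are prepared in the
  final theorem.\<close>

locale evolution =
  fixes \<rho> :: "real \<Rightarrow> 'a::real_normed_vector \<Rightarrow> 'a \<Rightarrow> real"
    and m M T c \<omega> L :: real and A :: "real \<Rightarrow> 'a operator"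
  assumes form: "t \<in> {0..T} \<Longrightarrow> quasi_maximal (\<rho> t) m M (A t) \<omega>"
    and T_pos: "0 < T" and c_nonneg: "0 \<le> c" and L_nonneg: "0 \<le> L"
    and smooth: "t \<in> {0..T} \<Longrightarrow>
      \<exists>d. ((\<lambda>s. \<rho> s x x) has_real_derivative d) (at t within {0..T}) \<and> d \<le> 2 * c * \<rho> t x x"
    and domain: "s \<in> {0..T} \<Longrightarrow> t \<in> {0..T} \<Longrightarrow> (x, v) \<in> A s \<Longrightarrow> \<exists>v'. (x, v') \<in> A t"
    and lipschitz: "s \<in> {0..T} \<Longrightarrow> t \<in> {0..T} \<Longrightarrow> (x, v) \<in> A s \<Longrightarrow> (x, v') \<in> A t \<Longrightarrow>
      norm (v' - v) \<le> L * \<bar>t - s\<bar> * (1 + norm x + norm v)"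
begin

abbreviation nrm :: "real \<Rightarrow> 'a \<Rightarrow> real" where "nrm t \<equiv> psd_form.nr (\<rho> t)"

lemma m_pos: "0 < m" and M_pos: "0 < M" and omega_nonneg: "0 \<le> \<omega>"
proof -
  interpret quasi_maximal "\<rho> 0" m M "A 0" \<omega> by (rule form) (use T_pos in auto)
  show "0 < m" "0 < M" "0 \<le> \<omega>" using m_pos M_pos omega_nonneg by auto
qed

lemma equiv: "t \<in> {0..T} \<Longrightarrow> equiv_form (\<rho> t) m M"
  using form by (simp add: quasi_maximal_def hilbert_form_def)

lemma psd: "t \<in> {0..T} \<Longrightarrow> psd_form (\<rho> t)"
  using equiv by (simp add: equiv_form_def)

lemma rho_le_norm: "t \<in> {0..T} \<Longrightarrow> \<bar>\<rho> t x y\<bar> \<le> M\<^sup>2 * norm x * norm y"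
  by (rule equiv_form.le_norm[OF equiv])

lemma norm_le_nrm: "t \<in> {0..T} \<Longrightarrow> norm x \<le> nrm t x / m"
  by (rule equiv_form.norm_le_nr[OF equiv])

lemma unique: "t \<in> {0..T} \<Longrightarrow> (x, v) \<in> A t \<Longrightarrow> (x, v') \<in> A t \<Longrightarrow> v = v'"
  using quasi_maximal.single[OF form] by (auto simp: single_valued_def)

lemma continuous_square: "continuous_on {0..T} (\<lambda>s. \<rho> s x x)"
  unfolding continuous_on_eq_continuous_within
proof
  fix t assume "t \<in> {0..T}"
  then obtain d where "((\<lambda>s. \<rho> s x x) has_real_derivative d) (at t within {0..T})" using smooth by blast
  then show "continuous (at t within {0..T}) (\<lambda>s. \<rho> s x x)" by (rule DERIV_continuous)
qed

lemma square_growth: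
  assumes "0 \<le> s" "s \<le> t" "t \<le> T"
  shows "\<rho> t x x \<le> exp (2 * c * (t - s)) * \<rho> s x x"
  by (rule exponential_growth[OF smooth c_nonneg assms])

lemma nrm_growth:
  assumes "0 \<le> s" "s \<le> t" "t \<le> T"
  shows "nrm t x \<le> exp (c * (t - s)) * nrm s x"
proof -
  interpret t: psd_form "\<rho> t" by (rule psd) (use assms in auto)
  interpret s: psd_form "\<rho> s" by (rule psd) (use assms in auto)
  have E: "(exp (c * (t - s)))\<^sup>2 = exp (2 * c * (t - s))"
    by (simp only: exp_double[symmetric] mult.assoc)
  have "(nrm t x)\<^sup>2 \<le> (exp (c * (t - s)) * nrm s x)\<^sup>2"
    unfolding power_mult_distrib E t.nr_square s.nr_square by (rule square_growth[OF assms])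
  then show ?thesis by (rule power2_le_imp_le) (intro mult_nonneg_nonneg exp_ge_zero s.nr_nonneg)
qed

section \<open>Continuity and one-sided differentiation of squares whose form and vector both
  move\<close>

lemma tendsto_pairing:
  assumes t: "t \<in> {0..T}"
  shows "((\<lambda>s. \<rho> s x y) \<longlongrightarrow> \<rho> t x y) (at t within {0..T})"
proof -
  have pol: "\<rho> s x y = (\<rho> s (x + y) (x + y) - \<rho> s x x - \<rho> s y y) / 2" if "s \<in> {0..T}" for s
    using psd_form.square_add[OF psd[OF that], of x y] by simp
  have sq: "((\<lambda>s. \<rho> s z z) \<longlongrightarrow> \<rho> t z z) (at t within {0..T})" for z
    using continuous_square[of z] t by (simp add: continuous_on_def)
  have "((\<lambda>s. (\<rho> s (x + y) (x + y) - \<rho> s x x - \<rho> s y y) / 2) \<longlongrightarrow> \<rho> t x y) (at t within {0..T})"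
    unfolding pol[OF t] by (intro tendsto_intros sq) auto
  then show ?thesis
    by (rule Lim_transform_eventually) (auto simp: eventually_at_filter pol)
qed

lemma tendsto_pairing_zero:
  assumes S: "S \<subseteq> {0..T}" and lim: "((\<lambda>s. norm (x s) * norm (y s)) \<longlongrightarrow> 0) (at t within S)"
  shows "((\<lambda>s. \<rho> s (x s) (y s)) \<longlongrightarrow> 0) (at t within S)"
proof (rule Lim_null_comparison)
  show "\<forall>\<^sub>F s in at t within S. norm (\<rho> s (x s) (y s)) \<le> M\<^sup>2 * (norm (x s) * norm (y s))"
    using S rho_le_norm by (auto simp: eventually_at_filter mult.assoc intro!: always_eventually)
  show "((\<lambda>s. M\<^sup>2 * (norm (x s) * norm (y s))) \<longlongrightarrow> 0) (at t within S)"
    by (rule tendsto_mult_right_zero[OF lim])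
qed

lemma square_expand:
  assumes "s \<in> {0..T}"
  shows "\<rho> s x x = \<rho> s a a + 2 * \<rho> s a (x - a) + \<rho> s (x - a) (x - a)"
  using psd_form.square_add[OF psd[OF assms], of a "x - a"] by simp

lemma continuous_moving_square:
  assumes S: "S \<subseteq> {0..T}" and w: "continuous_on S w"
  shows "continuous_on S (\<lambda>s. \<rho> s (w s) (w s))"
  unfolding continuous_on_def
proof
  fix t assume t: "t \<in> S"
  have sq: "((\<lambda>s. \<rho> s z z) \<longlongrightarrow> \<rho> t z z) (at t within S)" for z
    using continuous_on_subset[OF continuous_square S] t by (simp add: continuous_on_def)
  have w': "((\<lambda>s. norm (w s - w t)) \<longlongrightarrow> 0) (at t within S)"
    using w t by (simp add: continuous_on_def LIM_zero tendsto_norm_zero)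
  have "((\<lambda>s. \<rho> s (w t) (w t) + 2 * \<rho> s (w t) (w s - w t) + \<rho> s (w s - w t) (w s - w t)) \<longlongrightarrow>
      \<rho> t (w t) (w t) + 2 * 0 + 0) (at t within S)"
    using tendsto_mult_right_zero[OF w'] tendsto_mult_zero[OF w' w']
    by (intro tendsto_intros sq tendsto_pairing_zero[OF S]) auto
  then have "((\<lambda>s. \<rho> s (w t) (w t) + 2 * \<rho> s (w t) (w s - w t) + \<rho> s (w s - w t) (w s - w t)) \<longlongrightarrow>
      \<rho> t (w t) (w t)) (at t within S)" by simp
  then show "((\<lambda>s. \<rho> s (w s) (w s)) \<longlongrightarrow> \<rho> t (w t) (w t)) (at t within S)"
    by (rule Lim_transform_eventually)
      (use S in \<open>auto simp: eventually_at_filter intro!: always_eventually square_expand[symmetric]\<close>)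
qed

lemma moving_square_deriv:
  assumes S: "S \<subseteq> {0..T}" and t: "t \<in> S" and w: "(w has_vector_derivative w') (at t within S)"
  shows "\<exists>d. ((\<lambda>s. \<rho> s (w s) (w s)) has_real_derivative d) (at t within S) \<and>
    d \<le> 2 * \<rho> t (w t) w' + 2 * c * \<rho> t (w t) (w t)"
proof -
  obtain d where d: "((\<lambda>s. \<rho> s (w t) (w t)) has_real_derivative d) (at t within {0..T})"
    "d \<le> 2 * c * \<rho> t (w t) (w t)" using smooth[of t "w t"] t S by blast
  have d': "((\<lambda>s. (\<rho> s (w t) (w t) - \<rho> t (w t) (w t)) / (s - t)) \<longlongrightarrow> d) (at t within S)"
    using DERIV_subset[OF d(1) S] by (simp add: has_field_derivative_iff)
  define q where "q s = (1 / (s - t)) *\<^sub>R (w s - w t)" for s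
  have q: "(q \<longlongrightarrow> w') (at t within S)"
    using has_vector_derivative_quotient[OF w] by (simp add: q_def[abs_def])
  have q0: "((\<lambda>s. norm (q s - w')) \<longlongrightarrow> 0) (at t within S)"
    using q by (simp add: LIM_zero tendsto_norm_zero)
  have "continuous (at t within S) w" using w by (rule has_vector_derivative_continuous)
  then have w0: "((\<lambda>s. norm (w s - w t)) \<longlongrightarrow> 0) (at t within S)"
    by (simp add: continuous_within LIM_zero tendsto_norm_zero)
  have tT: "t \<in> {0..T}" using t S by blast
  have 1: "((\<lambda>s. \<rho> s (w t) (q s - w')) \<longlongrightarrow> 0) (at t within S)"
    using tendsto_mult_right_zero[OF q0] by (intro tendsto_pairing_zero[OF S]) auto
  have 2: "((\<lambda>s. \<rho> s (w t) w') \<longlongrightarrow> \<rho> t (w t) w') (at t within S)"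
    by (rule tendsto_within_subset[OF tendsto_pairing[OF tT] S])
  have 3: "((\<lambda>s. \<rho> s (q s) (w s - w t)) \<longlongrightarrow> 0) (at t within S)"
    using tendsto_mult[OF tendsto_norm[OF q] w0] by (intro tendsto_pairing_zero[OF S]) auto
  have lim: "((\<lambda>s. (\<rho> s (w t) (w t) - \<rho> t (w t) (w t)) / (s - t) + 2 * (\<rho> s (w t) (q s - w') + \<rho> s (w t) w') + \<rho> s (q s) (w s - w t))
      \<longlongrightarrow> d + 2 * (0 + \<rho> t (w t) w') + 0) (at t within S)"
    by (intro tendsto_intros d' 1 2 3)
  have ev: "\<forall>\<^sub>F s in at t within S. (\<rho> s (w t) (w t) - \<rho> t (w t) (w t)) / (s - t) + 2 * (\<rho> s (w t) (q s - w') + \<rho> s (w t) w') + \<rho> s (q s) (w s - w t) =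
      (\<rho> s (w s) (w s) - \<rho> t (w t) (w t)) / (s - t)"
    unfolding eventually_at_filter
  proof (intro always_eventually allI impI)
    fix s assume s: "s \<noteq> t" "s \<in> S"
    then have sT: "s \<in> {0..T}" using S by blast
    interpret psd_form "\<rho> s" by (rule psd[OF sT])
    have ws: "w s - w t = (s - t) *\<^sub>R q s" using s(1) by (simp add: q_def)
    have "\<rho> s (w t) (w s - w t) = (s - t) * \<rho> s (w t) (q s)" unfolding ws by (rule scale_right)
    moreover have "\<rho> s (w s - w t) (w s - w t) = (s - t) * \<rho> s (q s) (w s - w t)"
      unfolding scale_left[symmetric] ws by (rule refl)
    ultimately have expand: "\<rho> s (w s) (w s) =
        \<rho> s (w t) (w t) + (s - t) * (2 * \<rho> s (w t) (q s)) + (s - t) * \<rho> s (q s) (w s - w t)"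
      using square_expand[OF sT, of "w s" "w t"] by simp
    show "(\<rho> s (w t) (w t) - \<rho> t (w t) (w t)) / (s - t) + 2 * (\<rho> s (w t) (q s - w') + \<rho> s (w t) w') + \<rho> s (q s) (w s - w t) =
      (\<rho> s (w s) (w s) - \<rho> t (w t) (w t)) / (s - t)"
      using s(1) unfolding expand diff_right[of _ "q s" w']
      by (simp add: add_divide_distrib diff_divide_distrib)
  qed
  from Lim_transform_eventually[OF lim ev]
  have "((\<lambda>s. (\<rho> s (w s) (w s) - \<rho> t (w t) (w t)) / (s - t)) \<longlongrightarrow> d + 2 * \<rho> t (w t) w') (at t within S)"
    by simp
  then have "((\<lambda>s. \<rho> s (w s) (w s)) has_real_derivative d + 2 * \<rho> t (w t) w') (at t within S)"
    by (simp add: has_field_derivative_iff)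
  then show ?thesis using d(2) by (intro exI[of _ "d + 2 * \<rho> t (w t) w'"]) auto
qed

text \<open>Cauchy--Schwarz for the nonnegative form \<open>exp (2 c (t - s)) \<rho>(s) - \<rho>(t)\<close>.\<close>

lemma pairing_diff_le:
  assumes st: "0 \<le> s" "s \<le> t" "t \<le> T"
  defines "E \<equiv> exp (2 * c * (t - s)) - 1"
  shows "\<bar>\<rho> t z y - \<rho> s z y\<bar> \<le> E * (M\<^sup>2 * norm z * norm y) +
    sqrt ((1 + E) * (M\<^sup>2 * norm z * norm z)) * sqrt (E * (M\<^sup>2 * norm y * norm y) + \<bar>\<rho> t y y - \<rho> s y y\<bar>)"
proof -
  have s: "s \<in> {0..T}" and t: "t \<in> {0..T}" using st by auto
  interpret t: psd_form "\<rho> t" by (rule psd[OF t])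
  interpret s: psd_form "\<rho> s" by (rule psd[OF s])
  have E: "0 \<le> E" using st c_nonneg by (simp add: E_def)
  define \<sigma> where "\<sigma> x y = (1 + E) * \<rho> s x y - \<rho> t x y" for x y
  have growth: "\<rho> t x x \<le> (1 + E) * \<rho> s x x" for x
    using square_growth[OF st, of x] by (simp add: E_def)
  interpret \<sigma>: psd_form \<sigma>
  proof
    show "\<sigma> x y = \<sigma> y x" for x y using s.sym[of x y] t.sym[of x y] by (simp add: \<sigma>_def)
    show "0 \<le> \<sigma> x x" for x using growth[of x] by (simp add: \<sigma>_def)
  qed (simp_all add: \<sigma>_def s.add_left t.add_left s.scale_left t.scale_left algebra_simps)
  have "\<bar>\<sigma> z y\<bar> = sqrt ((\<sigma> z y)\<^sup>2)" by simp
  also have "\<dots> \<le> sqrt (\<sigma> z z * \<sigma> y y)" by (intro real_sqrt_le_mono \<sigma>.Cauchy_Schwarz)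
  also have "\<dots> = sqrt (\<sigma> z z) * sqrt (\<sigma> y y)" by (rule real_sqrt_mult)
  also have "\<dots> \<le> sqrt ((1 + E) * (M\<^sup>2 * norm z * norm z)) * sqrt (E * (M\<^sup>2 * norm y * norm y) + \<bar>\<rho> t y y - \<rho> s y y\<bar>)"
  proof (intro mult_mono real_sqrt_le_mono)
    have "(1 + E) * \<rho> s z z \<le> (1 + E) * (M\<^sup>2 * norm z * norm z)"
      using rho_le_norm[OF s, of z z] E by (intro mult_left_mono) auto
    then show "\<sigma> z z \<le> (1 + E) * (M\<^sup>2 * norm z * norm z)" using t.nonneg[of z] by (simp add: \<sigma>_def)
    have "E * \<rho> s y y \<le> E * (M\<^sup>2 * norm y * norm y)"
      using rho_le_norm[OF s, of y y] E by (intro mult_left_mono) auto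
    then show "\<sigma> y y \<le> E * (M\<^sup>2 * norm y * norm y) + \<bar>\<rho> t y y - \<rho> s y y\<bar>" by (simp add: \<sigma>_def algebra_simps)
  qed (use E s.nonneg \<sigma>.nonneg in auto)
  finally have "\<bar>\<sigma> z y\<bar> \<le> sqrt ((1 + E) * (M\<^sup>2 * norm z * norm z)) * sqrt (E * (M\<^sup>2 * norm y * norm y) + \<bar>\<rho> t y y - \<rho> s y y\<bar>)" .
  moreover have "\<bar>E * \<rho> s z y\<bar> \<le> E * (M\<^sup>2 * norm z * norm y)"
    using rho_le_norm[OF s, of z y] E by (simp add: abs_mult mult_left_mono)
  moreover have "\<rho> t z y - \<rho> s z y = E * \<rho> s z y - \<sigma> z y" by (simp add: \<sigma>_def algebra_simps)
  ultimately show ?thesis by linarith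
qed

text \<open>The vectors \<open>z s\<close> are merely bounded, so continuity of each pairing with
  fixed vectors is too weak. \<open>pairing_diff_le\<close> bounds the difference uniformly over
  bounded \<open>z\<close>, and it is applied in both orders of the two times.\<close>

lemma tendsto_pairing_diff:
  assumes t: "t \<in> {0..T}" and z: "\<And>s. s \<in> {0..T} \<Longrightarrow> norm (z s) \<le> K"
  shows "((\<lambda>s. \<rho> s (z s) y - \<rho> t (z s) y) \<longlongrightarrow> 0) (at t within {0..T})"
proof -
  define E where "E s = exp (2 * c * \<bar>s - t\<bar>) - 1" for s
  have E0: "0 \<le> E s" for s using c_nonneg by (simp add: E_def)
  have K: "0 \<le> K" using z[OF t] norm_ge_zero order_trans by blast
  define g where "g s = E s * (M\<^sup>2 * K * norm y) +
    sqrt ((1 + E s) * (M\<^sup>2 * K * K)) * sqrt (E s * (M\<^sup>2 * norm y * norm y) + \<bar>\<rho> s y y - \<rho> t y y\<bar>)" for s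
  have "\<bar>\<rho> s (z s) y - \<rho> t (z s) y\<bar> \<le> g s" if s: "s \<in> {0..T}" for s
  proof -
    have "\<bar>\<rho> s (z s) y - \<rho> t (z s) y\<bar> \<le> E s * (M\<^sup>2 * norm (z s) * norm y) +
      sqrt ((1 + E s) * (M\<^sup>2 * norm (z s) * norm (z s))) * sqrt (E s * (M\<^sup>2 * norm y * norm y) + \<bar>\<rho> s y y - \<rho> t y y\<bar>)"
      using pairing_diff_le[of t s "z s" y] pairing_diff_le[of s t "z s" y] s t
      by (cases "t \<le> s") (auto simp: E_def abs_minus_commute)
    also have "\<dots> \<le> g s"
      unfolding g_def using E0 z[OF s] K
      by (intro add_mono mult_mono mult_left_mono mult_right_mono real_sqrt_le_mono) auto
    finally show ?thesis .
  qed
  then have "\<forall>\<^sub>F s in at t within {0..T}. norm (\<rho> s (z s) y - \<rho> t (z s) y) \<le> g s"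
    by (auto simp: eventually_at_filter intro!: always_eventually)
  moreover have "(g \<longlongrightarrow> 0) (at t within {0..T})"
  proof -
    have sq: "((\<lambda>s. \<rho> s y y) \<longlongrightarrow> \<rho> t y y) (at t within {0..T})" by (rule tendsto_pairing[OF t])
    have E: "(E \<longlongrightarrow> exp (2 * c * \<bar>t - t\<bar>) - 1) (at t within {0..T})"
      unfolding E_def by (intro tendsto_intros)
    have "(g \<longlongrightarrow> (exp (2 * c * \<bar>t - t\<bar>) - 1) * (M\<^sup>2 * K * norm y) +
      sqrt ((1 + (exp (2 * c * \<bar>t - t\<bar>) - 1)) * (M\<^sup>2 * K * K)) *
      sqrt ((exp (2 * c * \<bar>t - t\<bar>) - 1) * (M\<^sup>2 * norm y * norm y) + \<bar>\<rho> t y y - \<rho> t y y\<bar>)) (at t within {0..T})"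
      unfolding g_def by (intro tendsto_intros sq E)
    then show ?thesis by simp
  qed
  ultimately show ?thesis by (rule Lim_null_comparison)
qed

text \<open>
  The value of \<open>A t\<close> at the new point \<open>p\<close> is controlled by comparing \<open>p\<close> with the old point \<open>u\<close>
  through quasi-monotonicity at time \<open>t\<close>.
\<close>

definition \<Gamma> :: real where "\<Gamma> = 1 + 2 * \<omega> + c + M * L * (1 + 1 / m)"

lemma euler_step:
  assumes st: "0 \<le> s" "s < t" "t \<le> T" and h: "(t - s) * \<omega> \<le> 1 / 2"
    and uv: "(u, v) \<in> A s" and pq: "(p, q) \<in> A t" and eq: "p + (t - s) *\<^sub>R q = u"
  shows "1 + nrm t p + nrm t q \<le> exp (\<Gamma> * (t - s)) * (1 + nrm s u + nrm s v)"
proof -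
  define h where "h = t - s"
  have hpos: "h > 0" and h2: "h * \<omega> \<le> 1 / 2" using st assms by (auto simp: h_def)
  have s: "s \<in> {0..T}" and t: "t \<in> {0..T}" using st by auto
  interpret t: quasi_maximal "\<rho> t" m M "A t" \<omega> by (rule form[OF t])
  interpret s: quasi_maximal "\<rho> s" m M "A s" \<omega> by (rule form[OF s])
  define a where "a = 1 + nrm s u + nrm s v"
  define E where "E = exp (c * h)"
  define C where "C = M * L * (1 + 1 / m)"
  have C: "0 \<le> C" using M_pos L_nonneg m_pos by (simp add: C_def)
  have E: "1 \<le> E" using c_nonneg hpos by (simp add: E_def)
  have a: "1 \<le> a" by (simp add: a_def)
  obtain v' where v': "(u, v') \<in> A t" using domain[OF s t uv] by blast
  have pu: "p - u = - (h *\<^sub>R q)" using eq by (auto simp: h_def)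
  have "- \<omega> * (h\<^sup>2 * \<rho> t q q) \<le> - h * (\<rho> t q q - \<rho> t v' q)"
    using t.quasi_monotone[OF pq v'] unfolding pu by (simp add: t.bilinear_simps power2_eq_square mult.assoc)
  then have "h * ((1 - h * \<omega>) * \<rho> t q q) \<le> h * \<rho> t v' q" by (simp add: algebra_simps power2_eq_square)
  then have "(1 - h * \<omega>) * \<rho> t q q \<le> \<rho> t v' q" using hpos by simp
  also have "\<dots> \<le> t.nr v' * t.nr q" by (rule t.le_nr)
  finally have "((1 - h * \<omega>) * t.nr q) * t.nr q \<le> t.nr v' * t.nr q"
    using t.nr_square[of q] by (simp add: power2_eq_square mult.assoc)
  then have q1: "(1 - h * \<omega>) * t.nr q \<le> t.nr v'"
    using t.nr_nonneg[of q] t.nr_nonneg[of v'] by (cases "t.nr q = 0") auto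
  \<comment> \<open>The Lipschitz condition lives in the type norm: passing to the norm at
    \<open>t\<close> costs \<open>M\<close>, returning to the norm at \<open>s\<close> costs
    \<open>1 / m\<close>, and the summand 1 in \<open>a\<close> matches the 1 in the
    condition.\<close>
  have v'1: "t.nr v' \<le> E * s.nr v + C * h * a"
  proof -
    have "t.nr v' \<le> t.nr v + t.nr (v' - v)" using t.nr_triangle[of v "v' - v"] by simp
    moreover have "t.nr v \<le> E * s.nr v" using nrm_growth[of s t v] st by (simp add: E_def h_def)
    moreover have "t.nr (v' - v) \<le> C * h * a"
    proof -
      have "t.nr (v' - v) \<le> M * (L * h * (1 + norm u + norm v))"
        using lipschitz[OF s t uv v'] t.upper[of "v' - v"] M_pos st
        by (smt (verit) h_def mult_left_mono abs_of_pos)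
      also have "1 + norm u + norm v \<le> a + a / m"
        using norm_le_nrm[OF s, of u] norm_le_nrm[OF s, of v] m_pos
        by (simp add: a_def add_divide_distrib) (smt (verit) divide_pos_pos s.nr_nonneg)
      finally have "t.nr (v' - v) \<le> M * (L * h * (a + a / m))"
        using M_pos L_nonneg hpos by (simp add: mult_left_mono)
      then show ?thesis by (simp add: C_def algebra_simps)
    qed
    ultimately show ?thesis by linarith
  qed
  define B where "B = E * s.nr v + C * h * a"
  have B0: "0 \<le> B" using E C hpos a by (simp add: B_def)
  have q2: "t.nr q \<le> (1 + 2 * \<omega> * h) * B"
  proof -
    \<comment> \<open>For x in [0, 1/2] the inverse of 1 - x is at most 1 + 2x; this is what the
      restriction on the step is for.\<close>
    have "1 \<le> (1 + 2 * \<omega> * h) * (1 - h * \<omega>)"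
    proof -
      have "0 \<le> (h * \<omega>) * (1 - 2 * (h * \<omega>))" using h2 hpos omega_nonneg by (intro mult_nonneg_nonneg) auto
      then show ?thesis by (simp add: algebra_simps)
    qed
    then have "1 * t.nr q \<le> ((1 + 2 * \<omega> * h) * (1 - h * \<omega>)) * t.nr q" by (intro mult_right_mono) auto
    also have "\<dots> = (1 + 2 * \<omega> * h) * ((1 - h * \<omega>) * t.nr q)" by simp
    also have "\<dots> \<le> (1 + 2 * \<omega> * h) * B"
      using q1 v'1 omega_nonneg hpos by (intro mult_left_mono) (auto simp: B_def)
    finally show ?thesis by simp
  qed
  have p1: "t.nr p \<le> E * s.nr u + h * t.nr q"
  proof -
    have "p = u + - (h *\<^sub>R q)" using pu by (simp add: algebra_simps)
    then have "t.nr p \<le> t.nr u + h * t.nr q"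
      using t.nr_triangle[of u "- (h *\<^sub>R q)"] hpos by (simp add: t.nr_minus t.nr_scale)
    moreover have "t.nr u \<le> E * s.nr u" using nrm_growth[of s t u] st by (simp add: E_def h_def)
    ultimately show ?thesis by linarith
  qed
  \<comment> \<open>Each summand of \<open>\<Gamma>\<close> is now visible: 1 and
    \<open>2 * \<omega>\<close> from the factors of \<open>F\<close>, \<open>c\<close> from the
    growth of the norm, and \<open>C\<close> from the change of the operator in time.\<close>
  define F where "F = (1 + h) * (1 + 2 * \<omega> * h)"
  have F1: "1 \<le> F" unfolding F_def
    using hpos omega_nonneg mult_mono[of 1 "1 + h" 1 "1 + 2 * \<omega> * h"] by simp
  have "1 + t.nr p + t.nr q \<le> 1 + E * s.nr u + (1 + h) * t.nr q" using p1 by (simp add: algebra_simps)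
  also have "\<dots> \<le> E * 1 + E * s.nr u + F * B"
  proof -
    have "(1 + h) * t.nr q \<le> F * B"
      using mult_left_mono[OF q2, of "1 + h"] hpos by (simp add: F_def mult.assoc)
    then show ?thesis using E by linarith
  qed
  also have "\<dots> \<le> F * (E * 1 + E * s.nr u) + F * B"
    using mult_right_mono[OF F1, of "E * 1 + E * s.nr u"] E by simp
  also have "\<dots> = F * ((E + C * h) * a)" by (simp add: B_def a_def algebra_simps)
  also have "\<dots> \<le> (exp h * exp (2 * \<omega> * h)) * ((E * exp (C * h)) * a)"
  proof (intro mult_mono)
    show "F \<le> exp h * exp (2 * \<omega> * h)" unfolding F_def
      using hpos omega_nonneg by (intro mult_mono exp_ge_add_one_self) auto
    have "E + C * h \<le> E * (1 + C * h)" using mult_right_mono[OF E, of "C * h"] C hpos by (simp add: algebra_simps)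
    also have "\<dots> \<le> E * exp (C * h)" using E by (intro mult_left_mono exp_ge_add_one_self) auto
    finally show "E + C * h \<le> E * exp (C * h)" .
  qed (use a E C hpos F1 in auto)
  also have "\<dots> = exp (\<Gamma> * h) * a"
  proof -
    have "\<Gamma> * h = h + 2 * \<omega> * h + (c * h + C * h)" by (simp add: \<Gamma>_def C_def algebra_simps)
    then show ?thesis by (simp add: exp_add E_def)
  qed
  finally show ?thesis by (simp add: a_def h_def)
qed

end

section \<open>The implicit Euler scheme\<close>

context evolution
begin

lemma Gamma_nonneg: "0 \<le> \<Gamma>"
  unfolding \<Gamma>_def using omega_nonneg c_nonneg M_pos L_nonneg m_pos by (auto intro!: add_nonneg_nonneg)

text \<open>The growth factors of the single steps multiply to at most
  \<open>exp (\<Gamma> * T)\<close>, whatever the number of steps; this makes the bounds uniform in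
  \<open>N\<close>.\<close>

lemma euler_scheme:
  assumes ab: "(a, b) \<in> A 0" and "0 < N" and h: "h = T / real N" and small: "h * \<omega> \<le> 1 / 2"
  shows "\<exists>u v. u 0 = a \<and> (\<forall>k\<le>N. (u k, v k) \<in> A (k * h)) \<and> (\<forall>k<N. u (Suc k) + h *\<^sub>R v (Suc k) = u k) \<and>
    (\<forall>k\<le>N. norm (u k) \<le> exp (\<Gamma> * T) * (1 + nrm 0 a + nrm 0 b) / m \<and>
      norm (v k) \<le> exp (\<Gamma> * T) * (1 + nrm 0 a + nrm 0 b) / m)"
proof -
  have hpos: "h > 0" using h T_pos \<open>0 < N\<close> by simp
  have hN: "real N * h = T" using h \<open>0 < N\<close> by simp
  have grid: "real k * h \<in> {0..T}" if "k \<le> N" for k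
    using mult_right_mono[of "real k" "real N" h] that hpos hN by simp
  have step: "real (Suc k) * h - real k * h = h" for k by (simp add: algebra_simps)
  have "\<exists>f. \<forall>k. ((k \<le> N \<longrightarrow> f k \<in> A (k * h)) \<and> (k = 0 \<longrightarrow> f k = (a, b))) \<and>
      (k < N \<longrightarrow> fst (f (Suc k)) + h *\<^sub>R snd (f (Suc k)) = fst (f k))"
  proof (rule dependent_nat_choice)
    show "\<exists>x. (0 \<le> N \<longrightarrow> x \<in> A (real 0 * h)) \<and> (0 = (0::nat) \<longrightarrow> x = (a, b))" using ab by auto
    fix x k assume "(k \<le> N \<longrightarrow> x \<in> A (real k * h)) \<and> (k = 0 \<longrightarrow> x = (a, b))"
    show "\<exists>y. ((Suc k \<le> N \<longrightarrow> y \<in> A (real (Suc k) * h)) \<and> (Suc k = 0 \<longrightarrow> y = (a, b))) \<and>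
        (k < N \<longrightarrow> fst y + h *\<^sub>R snd y = fst x)"
    proof (cases "k < N")
      case True
      interpret quasi_maximal "\<rho> (real (Suc k) * h)" m M "A (real (Suc k) * h)" \<omega>
        by (rule form, rule grid) (use True in auto)
      obtain p q where "(p, q) \<in> A (real (Suc k) * h)" "p + h *\<^sub>R q = fst x"
        using quasi_resolvent[OF hpos, of "fst x"] small by auto
      then show ?thesis by (intro exI[of _ "(p, q)"]) auto
    qed auto
  qed
  then obtain f where f: "\<And>k. k \<le> N \<Longrightarrow> f k \<in> A (k * h)" "f 0 = (a, b)"
    "\<And>k. k < N \<Longrightarrow> fst (f (Suc k)) + h *\<^sub>R snd (f (Suc k)) = fst (f k)" by metis
  define u v where "u k = fst (f k)" and "v k = snd (f k)" for k
  have uv: "(u k, v k) \<in> A (k * h)" if "k \<le> N" for k using f(1)[OF that] by (simp add: u_def v_def)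
  have eq: "u (Suc k) + h *\<^sub>R v (Suc k) = u k" if "k < N" for k using f(3)[OF that] by (simp add: u_def v_def)
  define W where "W = 1 + nrm 0 a + nrm 0 b"
  have growth: "1 + nrm (k * h) (u k) + nrm (k * h) (v k) \<le> exp (\<Gamma> * (k * h)) * W" if "k \<le> N" for k
    using that
  proof (induction k)
    case 0
    then show ?case by (simp add: u_def v_def f(2) W_def)
  next
    case (Suc k)
    have "1 + nrm (Suc k * h) (u (Suc k)) + nrm (Suc k * h) (v (Suc k))
        \<le> exp (\<Gamma> * (Suc k * h - k * h)) * (1 + nrm (k * h) (u k) + nrm (k * h) (v k))"
    proof (rule euler_step)
      show "0 \<le> real k * h" using hpos by simp
      show "real k * h < real (Suc k) * h" using hpos by simp
      show "real (Suc k) * h \<le> T" using grid[OF Suc.prems] by simp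
      show "(u k, v k) \<in> A (real k * h)" using Suc.prems by (intro uv) auto
      show "(u (Suc k), v (Suc k)) \<in> A (real (Suc k) * h)" by (rule uv[OF Suc.prems])
      show "(real (Suc k) * h - real k * h) * \<omega> \<le> 1 / 2" unfolding step by (rule small)
      show "u (Suc k) + (real (Suc k) * h - real k * h) *\<^sub>R v (Suc k) = u k"
        unfolding step using Suc.prems by (intro eq) auto
    qed
    also have "\<dots> \<le> exp (\<Gamma> * (Suc k * h - k * h)) * (exp (\<Gamma> * (k * h)) * W)"
      using Suc by (intro mult_left_mono) auto
    also have "\<dots> = exp (\<Gamma> * (Suc k * h - k * h) + \<Gamma> * (k * h)) * W"
      by (simp only: exp_add mult.assoc)
    also have "\<Gamma> * (Suc k * h - k * h) + \<Gamma> * (k * h) = \<Gamma> * (Suc k * h)" by (simp only: right_diff_distrib)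
    finally show ?case .
  qed
  have W: "0 \<le> W" using psd_form.nr_nonneg[OF psd, of 0] T_pos by (simp add: W_def)
  have bound: "norm (u k) \<le> exp (\<Gamma> * T) * W / m \<and> norm (v k) \<le> exp (\<Gamma> * T) * W / m" if "k \<le> N" for k
  proof -
    have "exp (\<Gamma> * (k * h)) * W \<le> exp (\<Gamma> * T) * W"
      using grid[OF that] W Gamma_nonneg by (intro mult_right_mono) (auto intro: mult_left_mono)
    then have *: "1 + nrm (k * h) (u k) + nrm (k * h) (v k) \<le> exp (\<Gamma> * T) * W" using growth[OF that] by simp
    interpret psd_form "\<rho> (k * h)" by (rule psd[OF grid[OF that]])
    have "nr (u k) \<le> exp (\<Gamma> * T) * W" "nr (v k) \<le> exp (\<Gamma> * T) * W"
      using * nr_nonneg[of "u k"] nr_nonneg[of "v k"] by linarith+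
    then have "nr (u k) / m \<le> exp (\<Gamma> * T) * W / m" "nr (v k) / m \<le> exp (\<Gamma> * T) * W / m"
      using m_pos by (auto intro: divide_right_mono)
    then show ?thesis
      using norm_le_nrm[OF grid[OF that], of "u k"] norm_le_nrm[OF grid[OF that], of "v k"] by linarith
  qed
  have "u 0 = a" by (simp add: u_def f(2))
  with uv eq bound show ?thesis unfolding W_def by blast
qed

text \<open>The velocity \<open>v\<close> comes from the operator at the next grid time,
  \<open>v'\<close> from the operator at the actual time \<open>t\<close>, both at the grid value
  \<open>x\<close>; thus the equation holds up to \<open>C * \<delta>\<close>. At
  \<open>t = T\<close> the interval is a point and the derivative clause is vacuous.\<close>

definition approx_solution :: "'a \<Rightarrow> real \<Rightarrow> real \<Rightarrow> (real \<Rightarrow> 'a) \<Rightarrow> bool" where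
  "approx_solution a C \<delta> w \<longleftrightarrow> continuous_on {0..T} w \<and> w 0 = a \<and>
    (\<forall>t\<in>{0..T}. \<exists>x v v'. (w has_vector_derivative - v) (at t within {t..T}) \<and> (x, v') \<in> A t \<and>
      norm (v' - v) \<le> C * \<delta> \<and> norm (x - w t) \<le> C * \<delta> \<and>
      norm v \<le> C \<and> norm v' \<le> C \<and> norm x \<le> C \<and> norm (w t) \<le> C)"

lemma approx_solution_exists:
  assumes ab: "(a, b) \<in> A 0"
  shows "\<exists>C\<ge>0. \<forall>N>0. T / real N * \<omega> \<le> 1 / 2 \<longrightarrow> (\<exists>w. approx_solution a C (T / real N) w)"
proof -
  define R where "R = exp (\<Gamma> * T) * (1 + nrm 0 a + nrm 0 b) / m"
  have R: "0 \<le> R" unfolding R_def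
    using psd_form.nr_nonneg[OF psd, of 0] T_pos m_pos by (intro divide_nonneg_pos mult_nonneg_nonneg add_nonneg_nonneg) auto
  \<comment> \<open>One constant for all clauses: the summands dominate the values, the interpolant,
    the consistency error per unit step and the values moved to time \<open>t\<close>.\<close>
  define C where "C = R + T * R + L * (1 + 2 * R) + L * T * (1 + 2 * R)"
  have C: "R \<le> C" "R + T * R \<le> C" "L * (1 + 2 * R) \<le> C" "R + L * T * (1 + 2 * R) \<le> C" "0 \<le> C"
    using R T_pos L_nonneg by (simp_all add: C_def)
  have "\<exists>w. approx_solution a C (T / real N) w" if N: "0 < N" and small: "T / real N * \<omega> \<le> 1 / 2" for N
  proof -
    define h where "h = T / real N"
    have hpos: "h > 0" using N T_pos by (simp add: h_def)
    have hN: "real N * h = T" using N by (simp add: h_def)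
    have hT: "h \<le> T" using hN hpos N mult_right_mono[of 1 "real N" h] by simp
    obtain u v where u0: "u 0 = a" and uv: "\<And>k. k \<le> N \<Longrightarrow> (u k, v k) \<in> A (k * h)"
      and eq: "\<And>k. k < N \<Longrightarrow> u (Suc k) + h *\<^sub>R v (Suc k) = u k"
      and bound: "\<And>k. k \<le> N \<Longrightarrow> norm (u k) \<le> R" "\<And>k. k \<le> N \<Longrightarrow> norm (v k) \<le> R"
      using euler_scheme[OF ab N h_def] small unfolding R_def h_def by metis
    \<comment> \<open>A sum of clipped ramps is continuous by construction, with no gluing of
      pieces; on each cell it reduces to the linear interpolant.\<close>
    define w where "w t = a - (\<Sum>j<N. max 0 (min (t - j * h) h) *\<^sub>R v (Suc j))" for t
    have u_eq: "u k = a - (\<Sum>j<k. h *\<^sub>R v (Suc j))" if "k \<le> N" for k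
      using that
    proof (induction k)
      case (Suc k)
      have "u (Suc k) = u k - h *\<^sub>R v (Suc k)" using eq[of k] Suc.prems by (simp add: eq_diff_eq)
      also have "u k = a - (\<Sum>j<k. h *\<^sub>R v (Suc j))" using Suc.prems by (intro Suc.IH) simp
      finally show ?case by (simp add: diff_diff_eq)
    qed (simp add: u0)
    have w_eq: "w t = u k - (t - k * h) *\<^sub>R v (Suc k)" if "k < N" "k * h \<le> t" "t \<le> Suc k * h" for k t
    proof -
      have split: "{..<N} = {..<k} \<union> {k} \<union> {Suc k..<N}" using \<open>k < N\<close> by auto
      have low: "max 0 (min (t - j * h) h) = h" if "j < k" for j
      proof -
        have "real (Suc j) * h \<le> real k * h" using that hpos by (intro mult_right_mono) auto
        then have "real j * h + h \<le> real k * h" by (simp add: algebra_simps)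
        then have "h \<le> t - real j * h" using \<open>k * h \<le> t\<close> by linarith
        then show ?thesis using hpos by simp
      qed
      have high: "max 0 (min (t - j * h) h) = 0" if "Suc k \<le> j" for j
      proof -
        have "real (Suc k) * h \<le> real j * h" using that hpos by (intro mult_right_mono) auto
        then show ?thesis using \<open>t \<le> Suc k * h\<close> by simp
      qed
      have mid: "max 0 (min (t - k * h) h) = t - k * h"
        using that by (simp add: algebra_simps)
      have "(\<Sum>j<N. max 0 (min (t - j * h) h) *\<^sub>R v (Suc j)) =
          (\<Sum>j<k. max 0 (min (t - j * h) h) *\<^sub>R v (Suc j)) + max 0 (min (t - k * h) h) *\<^sub>R v (Suc k) +
          (\<Sum>j\<in>{Suc k..<N}. max 0 (min (t - j * h) h) *\<^sub>R v (Suc j))"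
        unfolding split by (subst sum.union_disjoint; (subst sum.union_disjoint)?; auto)+
      also have "\<dots> = (\<Sum>j<k. h *\<^sub>R v (Suc j)) + (t - k * h) *\<^sub>R v (Suc k)"
        by (simp add: low high mid)
      finally show ?thesis using u_eq[of k] \<open>k < N\<close> by (simp add: w_def)
    qed
    \<comment> \<open>Cells are half-open for \<open>t < T\<close>, so that a right neighbourhood of
      \<open>t\<close> stays in one cell; the last cell also takes \<open>T\<close>.\<close>
    have cell: "\<exists>k<N. k * h \<le> t \<and> t \<le> Suc k * h \<and> (t < T \<longrightarrow> t < Suc k * h)" if t: "t \<in> {0..T}" for t
    proof (cases "t < T")
      case True
      define k where "k = nat \<lfloor>t / h\<rfloor>"
      have th: "0 \<le> t / h" using t hpos by simp
      then have "real k \<le> t / h" "t / h < real k + 1" unfolding k_def by linarith+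
      then have k: "k * h \<le> t" "t < Suc k * h" using hpos by (auto simp: field_simps)
      have "real k * h < real N * h" using k(1) True hN by linarith
      then have "k < N" using hpos by simp
      with k show ?thesis by (intro exI[of _ k]) auto
    next
      case False
      then have "t = T" using t by simp
      moreover have "real (N - 1) * h \<le> T" using hN hpos N by (simp add: of_nat_diff algebra_simps)
      ultimately show ?thesis using N hN by (intro exI[of _ "N - 1"]) auto
    qed
    have "approx_solution a C h w"
      unfolding approx_solution_def
    proof (intro conjI ballI)
      show "continuous_on {0..T} w" unfolding w_def by (intro continuous_intros)
      show "w 0 = a" using w_eq[of 0 0] N hpos u0 by simp
      fix t assume t: "t \<in> {0..T}"
      obtain k where k: "k < N" "k * h \<le> t" "t \<le> Suc k * h" "t < T \<Longrightarrow> t < Suc k * h"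
        using cell[OF t] by blast
      have Sk: "Suc k \<le> N" using k(1) by simp
      have grid: "Suc k * h \<in> {0..T}" using mult_right_mono[of "real (Suc k)" "real N" h] Sk hpos hN by simp
      define x where "x = u (Suc k)"
      obtain v' where v': "(x, v') \<in> A t" using domain[OF grid t uv[OF Sk]] unfolding x_def by blast
      have deriv: "(w has_vector_derivative - v (Suc k)) (at t within {t..T})"
      proof (cases "t < T")
        case True
        have lin: "((\<lambda>s. u k - (s - k * h) *\<^sub>R v (Suc k)) has_vector_derivative - v (Suc k)) (at t within {t..T})"
          by (auto intro!: derivative_eq_intros)
        show ?thesis
        proof (rule has_vector_derivative_transform_within[OF lin])
          show "0 < Suc k * h - t" using k(4) True by simp
          fix s assume s: "s \<in> {t..T}" "dist s t < Suc k * h - t"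
          have le: "s \<le> Suc k * h" using s(2) abs_ge_self[of "s - t"] unfolding dist_real_def by linarith
          have ge: "k * h \<le> s" using k(2) s(1) unfolding atLeastAtMost_iff by linarith
          show "u k - (s - k * h) *\<^sub>R v (Suc k) = w s" by (rule w_eq[OF k(1) ge le, symmetric])
        qed (use t in auto)
      next
        case False
        then have "t = T" using t by simp
        then have single: "{t..T} = {t}" by simp
        show ?thesis
          unfolding single has_vector_derivative_def has_derivative_within_singleton_iff
          by (rule bounded_linear_scaleR_left)
      qed
      have xR: "norm x \<le> R" "norm (v (Suc k)) \<le> R" using bound[OF Sk] by (auto simp: x_def)
      have gap: "0 \<le> Suc k * h - t" "Suc k * h - t \<le> h" using k(2,3) unfolding of_nat_Suc distrib_right by linarith+
      have "norm (v' - v (Suc k)) \<le> L * \<bar>t - Suc k * h\<bar> * (1 + norm x + norm (v (Suc k)))"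
        using lipschitz[OF grid t uv[OF Sk]] v' unfolding x_def by blast
      also have "\<dots> \<le> L * h * (1 + 2 * R)"
        using gap xR L_nonneg hpos by (intro mult_mono mult_nonneg_nonneg) auto
      finally have v'h: "norm (v' - v (Suc k)) \<le> L * (1 + 2 * R) * h" by (simp add: mult_ac)
      also have "\<dots> \<le> C * h" using C hpos by (intro mult_right_mono) auto
      finally have 1: "norm (v' - v (Suc k)) \<le> C * h" .
      have xw: "x - w t = - ((Suc k * h - t) *\<^sub>R v (Suc k))"
        using w_eq[OF k(1-3)] eq[OF k(1)] unfolding x_def by (simp add: algebra_simps)
      have "norm (x - w t) = (Suc k * h - t) * norm (v (Suc k))" unfolding xw using gap(1) by simp
      also have "\<dots> \<le> h * R" using gap xR hpos by (intro mult_mono) auto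
      finally have xw_le: "norm (x - w t) \<le> R * h" by (simp add: mult.commute)
      also have "\<dots> \<le> C * h" using C hpos by (intro mult_right_mono) auto
      finally have 2: "norm (x - w t) \<le> C * h" .
      have "norm (w t) \<le> norm x + norm (x - w t)" using norm_triangle_ineq4[of x "x - w t"] by simp
      also have "\<dots> \<le> R + R * T"
        using xw_le xR mult_left_mono[OF hT R] by simp
      finally have 3: "norm (w t) \<le> C" using C by (simp add: mult.commute)
      have "norm v' \<le> norm (v (Suc k)) + norm (v' - v (Suc k))"
        using norm_triangle_ineq[of "v (Suc k)" "v' - v (Suc k)"] by simp
      also have "\<dots> \<le> R + L * (1 + 2 * R) * T"
        using v'h xR mult_left_mono[OF hT, of "L * (1 + 2 * R)"] L_nonneg R by simp
      also have "\<dots> = R + L * T * (1 + 2 * R)" by (simp only: mult_ac)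
      finally have 4: "norm v' \<le> C" using C by simp
      show "\<exists>x v v'. (w has_vector_derivative - v) (at t within {t..T}) \<and> (x, v') \<in> A t \<and>
          norm (v' - v) \<le> C * h \<and> norm (x - w t) \<le> C * h \<and> norm v \<le> C \<and> norm v' \<le> C \<and> norm x \<le> C \<and> norm (w t) \<le> C"
        by (intro exI[of _ x] exI[of _ "v (Suc k)"] exI[of _ v'] conjI deriv v' 1 2 3 4
            order_trans[OF xR(1) C(1)] order_trans[OF xR(2) C(1)])
    qed
    then show ?thesis unfolding h_def by blast
  qed
  with C(5) show ?thesis by blast
qed

end

section \<open>Convergence of the scheme\<close>

context evolution
begin

lemma approx_solutionD:
  assumes "approx_solution a C \<delta> w"
  shows "continuous_on {0..T} w" "w 0 = a"
    and "t \<in> {0..T} \<Longrightarrow> \<exists>x v v'. (w has_vector_derivative - v) (at t within {t..T}) \<and> (x, v') \<in> A t \<and>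
      norm (v' - v) \<le> C * \<delta> \<and> norm (x - w t) \<le> C * \<delta> \<and>
      norm v \<le> C \<and> norm v' \<le> C \<and> norm x \<le> C \<and> norm (w t) \<le> C"
  using assms unfolding approx_solution_def by blast+

text \<open>Quasi-monotonicity controls \<open>x1 - x2\<close> rather than \<open>w1 - w2\<close>.
  The exchange produces errors linear in \<open>\<delta>\<^sub>1 + \<delta>\<^sub>2\<close>, and
  Gronwall's inequality carries them into the squared distance.\<close>

lemma approx_solutions_close:
  assumes w1: "approx_solution a C \<delta>\<^sub>1 w1" and w2: "approx_solution a C \<delta>\<^sub>2 w2"
    and \<delta>: "0 < \<delta>\<^sub>1" "\<delta>\<^sub>1 \<le> 1" "0 < \<delta>\<^sub>2" "\<delta>\<^sub>2 \<le> 1" and C: "0 \<le> C" and t: "t \<in> {0..T}"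
  shows "(norm (w1 t - w2 t))\<^sup>2 \<le>
    exp ((4 * \<omega> + 2 * c) * T) * ((8 * \<omega> + 8) * M\<^sup>2 * C\<^sup>2) * T / m\<^sup>2 * (\<delta>\<^sub>1 + \<delta>\<^sub>2)"
proof -
  define \<eta> where "\<eta> = \<delta>\<^sub>1 + \<delta>\<^sub>2"
  have \<eta>: "0 \<le> \<eta>" "\<eta> \<le> 2" using \<delta> by (auto simp: \<eta>_def)
  define w where "w s = w1 s - w2 s" for s
  define \<beta> \<kappa> where "\<beta> = 4 * \<omega> + 2 * c" and "\<kappa> = (8 * \<omega> + 8) * M\<^sup>2 * C\<^sup>2 * \<eta>"
  have nonneg: "0 \<le> \<beta>" "0 \<le> \<kappa>" using omega_nonneg c_nonneg \<eta> by (auto simp: \<beta>_def \<kappa>_def)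
  have wcont: "continuous_on {0..T} w"
    unfolding w_def by (intro continuous_intros approx_solutionD(1)[OF w1] approx_solutionD(1)[OF w2])
  have gronwall: "\<rho> t (w t) (w t) \<le> exp (\<beta> * (t - 0)) * (\<rho> 0 (w 0) (w 0) + \<kappa> * (t - 0))"
  proof (rule right_gronwall[where N = "{}"])
    show "continuous_on {0..t} (\<lambda>s. \<rho> s (w s) (w s))"
      using t by (intro continuous_moving_square continuous_on_subset[OF wcont]) auto
    fix s assume "s \<in> {0..<t} - {}"
    then have s: "s \<in> {0..T}" "s \<in> {s..t}" "{s..t} \<subseteq> {0..T}" "{s..t} \<subseteq> {s..T}" using t by auto
    obtain x1 v1 v1' where 1: "(w1 has_vector_derivative - v1) (at s within {s..T})" "(x1, v1') \<in> A s"
      "norm (v1' - v1) \<le> C * \<delta>\<^sub>1" "norm (x1 - w1 s) \<le> C * \<delta>\<^sub>1" "norm v1 \<le> C" "norm x1 \<le> C"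
      using approx_solutionD(3)[OF w1 s(1)] by blast
    obtain x2 v2 v2' where 2: "(w2 has_vector_derivative - v2) (at s within {s..T})" "(x2, v2') \<in> A s"
      "norm (v2' - v2) \<le> C * \<delta>\<^sub>2" "norm (x2 - w2 s) \<le> C * \<delta>\<^sub>2" "norm v2 \<le> C" "norm x2 \<le> C"
      using approx_solutionD(3)[OF w2 s(1)] by blast
    interpret quasi_maximal "\<rho> s" m M "A s" \<omega> by (rule form[OF s(1)])
    have "(w has_vector_derivative - (v1 - v2)) (at s within {s..t})"
      unfolding w_def using has_vector_derivative_diff[OF 1(1) 2(1)] s(4)
      by (auto intro: has_vector_derivative_within_subset)
    then obtain d where d: "((\<lambda>s. \<rho> s (w s) (w s)) has_real_derivative d) (at s within {s..t})"
      "d \<le> 2 * \<rho> s (w s) (- (v1 - v2)) + 2 * c * \<rho> s (w s) (w s)"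
      using moving_square_deriv[OF s(3,2)] by blast
    \<comment> \<open>The two defects: interpolant against grid value, and velocity against the
      operator at the current time.\<close>
    define e e' where "e = (x1 - w1 s) - (x2 - w2 s)" and "e' = (v1' - v1) - (v2' - v2)"
    have e: "norm e \<le> C * \<eta>" "norm e' \<le> C * \<eta>"
      using norm_triangle_ineq4[of "x1 - w1 s" "x2 - w2 s"] norm_triangle_ineq4[of "v1' - v1" "v2' - v2"] 1 2
      by (auto simp: e_def e'_def \<eta>_def algebra_simps)
    have diffs: "norm (x1 - x2) \<le> 2 * C" "norm (v1 - v2) \<le> 2 * C"
      using norm_triangle_ineq4[of x1 x2] norm_triangle_ineq4[of v1 v2] 1 2 by auto
    have bound: "M\<^sup>2 * norm p * norm q \<le> M\<^sup>2 * P * Q" if "norm p \<le> P" "norm q \<le> Q" for p q :: 'a and P Q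
    proof -
      have "0 \<le> P" using that(1) norm_ge_zero order_trans by blast
      then show ?thesis using that by (intro mult_mono) auto
    qed
    have w_eq: "w s = (x1 - x2) - e" and v_eq: "v1 - v2 = (v1' - v2') - e'"
      by (simp_all add: w_def e_def e'_def)
    have split: "\<rho> s (w s) (v1 - v2) = \<rho> s (x1 - x2) (v1' - v2') - \<rho> s (x1 - x2) e' - \<rho> s e (v1 - v2)"
    proof -
      have "\<rho> s (w s) (v1 - v2) = \<rho> s (x1 - x2) (v1 - v2) - \<rho> s e (v1 - v2)" unfolding w_eq by (rule diff_left)
      also have "\<rho> s (x1 - x2) (v1 - v2) = \<rho> s (x1 - x2) (v1' - v2') - \<rho> s (x1 - x2) e'" unfolding v_eq by (rule diff_right)
      finally show ?thesis .
    qed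
    have "\<rho> s (x1 - x2) e' \<le> M\<^sup>2 * (2 * C) * (C * \<eta>)"
      using le_norm[of "x1 - x2" e'] bound[OF diffs(1) e(2)] by linarith
    then have r1: "\<rho> s (x1 - x2) e' \<le> 2 * (M\<^sup>2 * C\<^sup>2 * \<eta>)" by (simp add: power2_eq_square mult_ac)
    have "\<rho> s e (v1 - v2) \<le> M\<^sup>2 * (C * \<eta>) * (2 * C)"
      using le_norm[of e "v1 - v2"] bound[OF e(1) diffs(2)] by linarith
    then have r2: "\<rho> s e (v1 - v2) \<le> 2 * (M\<^sup>2 * C\<^sup>2 * \<eta>)" by (simp add: power2_eq_square mult_ac)
    have "\<rho> s e e \<le> M\<^sup>2 * (C * \<eta>) * (C * \<eta>)" using le_norm[of e e] bound[OF e(1) e(1)] by linarith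
    also have "\<dots> = M\<^sup>2 * C\<^sup>2 * (\<eta> * \<eta>)" by (simp add: power2_eq_square mult_ac)
    \<comment> \<open>Steps of length at most 1 give \<open>\<eta> \<le> 2\<close>, which makes the
      quadratic error linear.\<close>
    also have "\<dots> \<le> M\<^sup>2 * C\<^sup>2 * (2 * \<eta>)" using \<eta> by (intro mult_left_mono mult_right_mono) auto
    finally have ee: "\<rho> s e e \<le> 2 * (M\<^sup>2 * C\<^sup>2 * \<eta>)" by simp
    have "\<rho> s (x1 - x2) (x1 - x2) \<le> 2 * \<rho> s (w s) (w s) + 2 * \<rho> s e e"
    proof -
      have "w s + e = x1 - x2" by (simp add: w_def e_def)
      then show ?thesis using square_sum_le[of "w s" e] by metis
    qed
    then have "\<omega> * \<rho> s (x1 - x2) (x1 - x2) \<le> \<omega> * (2 * \<rho> s (w s) (w s) + 4 * (M\<^sup>2 * C\<^sup>2 * \<eta>))"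
      using ee omega_nonneg by (intro mult_left_mono) auto
    moreover have "- \<omega> * \<rho> s (x1 - x2) (x1 - x2) \<le> \<rho> s (x1 - x2) (v1' - v2')"
      using quasi_monotone[OF 1(2) 2(2)] sym[of "x1 - x2" "v1' - v2'"] by linarith
    ultimately have neg: "- \<rho> s (w s) (v1 - v2) \<le> \<omega> * (2 * \<rho> s (w s) (w s) + 4 * (M\<^sup>2 * C\<^sup>2 * \<eta>)) + 4 * (M\<^sup>2 * C\<^sup>2 * \<eta>)"
      using split r1 r2 by linarith
    have "d \<le> 2 * (\<omega> * (2 * \<rho> s (w s) (w s) + 4 * (M\<^sup>2 * C\<^sup>2 * \<eta>)) + 4 * (M\<^sup>2 * C\<^sup>2 * \<eta>)) + 2 * c * \<rho> s (w s) (w s)"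
      using d(2) neg unfolding minus_right by argo
    also have "\<dots> = \<beta> * \<rho> s (w s) (w s) + \<kappa>" by (simp add: \<beta>_def \<kappa>_def algebra_simps)
    finally show "\<exists>d. ((\<lambda>s. \<rho> s (w s) (w s)) has_real_derivative d) (at s within {s..t}) \<and> d \<le> \<beta> * \<rho> s (w s) (w s) + \<kappa>"
      using d(1) by blast
  qed (use t nonneg in auto)
  have "w 0 = 0" by (simp add: w_def approx_solutionD(2)[OF w1] approx_solutionD(2)[OF w2])
  then have w0: "\<rho> 0 (w 0) (w 0) = 0" using psd_form.zero_left[OF psd, of 0] T_pos by simp
  have "\<rho> t (w t) (w t) \<le> exp (\<beta> * t) * (\<kappa> * t)" using gronwall unfolding w0 by simp
  also have "\<dots> \<le> exp (\<beta> * T) * (\<kappa> * T)"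
  proof (rule mult_mono)
    have "\<beta> * t \<le> \<beta> * T" using t nonneg by (intro mult_left_mono) auto
    then show "exp (\<beta> * t) \<le> exp (\<beta> * T)" by simp
    show "\<kappa> * t \<le> \<kappa> * T" using t nonneg by (intro mult_left_mono) auto
    show "0 \<le> \<kappa> * t" using t nonneg by simp
  qed simp
  finally have "\<rho> t (w t) (w t) \<le> exp (\<beta> * T) * (\<kappa> * T)" .
  then have "m\<^sup>2 * (norm (w t))\<^sup>2 \<le> exp (\<beta> * T) * (\<kappa> * T)"
    using equiv_form.lower_square[OF equiv[OF t], of "w t"] by linarith
  then have "(norm (w t))\<^sup>2 \<le> exp (\<beta> * T) * (\<kappa> * T) / m\<^sup>2"
    using m_pos by (simp add: field_simps)
  then show ?thesis unfolding w_def \<beta>_def \<kappa>_def \<eta>_def by (simp add: mult_ac)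
qed

end

text \<open>Collects what the limit passage retains. The grid values are compared with
  \<open>u\<close> itself, and the single null sequence \<open>\<eta>\<close> bounds all
  errors.\<close>

locale limit_solution = evolution \<rho> m M T c \<omega> L A
  for \<rho> :: "real \<Rightarrow> 'a::real_normed_vector \<Rightarrow> 'a \<Rightarrow> real" and m M T c \<omega> L :: real and A +
  fixes a :: 'a and C :: real and \<eta> :: "nat \<Rightarrow> real" and w :: "nat \<Rightarrow> real \<Rightarrow> 'a" and u :: "real \<Rightarrow> 'a"
  assumes eta: "\<eta> \<longlonglongrightarrow> 0" and C_nonneg: "0 \<le> C"
    and u_0: "u 0 = a" and u_cont: "continuous_on {0..T} u" and w_cont: "continuous_on {0..T} (w n)"
    and approx: "t \<in> {0..T} \<Longrightarrow> \<exists>x v v'. (w n has_vector_derivative - v) (at t within {t..T}) \<and>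
      (x, v') \<in> A t \<and> norm (v' - v) \<le> \<eta> n \<and> norm (x - u t) \<le> \<eta> n \<and>
      norm v \<le> C \<and> norm v' \<le> C \<and> norm x \<le> C"
    and w_close: "t \<in> {0..T} \<Longrightarrow> norm (w n t - u t) \<le> \<eta> n"

lemma (in evolution) limit_solution_exists:
  assumes ab: "(a, b) \<in> A 0"
  shows "\<exists>C \<eta> w u. limit_solution \<rho> m M T c \<omega> L A a C \<eta> w u"
proof -
  obtain C where C: "0 \<le> C" "\<And>N. N > 0 \<Longrightarrow> T / real N * \<omega> \<le> 1 / 2 \<Longrightarrow> \<exists>w. approx_solution a C (T / real N) w"
    using approx_solution_exists[OF ab] by blast
  \<comment> \<open>Large enough that \<open>e n * (2 * \<omega> + 1) \<le> 1\<close>, which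
    contains both \<open>e n \<le> 1\<close> and the step restriction
    \<open>e n * \<omega> \<le> 1 / 2\<close>.\<close>
  define n0 where "n0 = nat \<lceil>T * (2 * \<omega> + 1)\<rceil>"
  have n0: "T * (2 * \<omega> + 1) \<le> real n0" unfolding n0_def by (rule real_nat_ceiling_ge)
  define e where "e n = T / real (n + Suc n0)" for n
  have e_pos: "0 < e n" for n using T_pos by (simp add: e_def)
  have e_small: "e n * (2 * \<omega> + 1) \<le> 1" for n using n0 by (simp add: e_def field_simps)
  have e1: "e n \<le> 1" "e n * \<omega> \<le> 1 / 2" for n
  proof -
    have "e n * (2 * \<omega> + 1) = 2 * (e n * \<omega>) + e n" by (simp add: algebra_simps)
    then show "e n \<le> 1" "e n * \<omega> \<le> 1 / 2"
      using e_small[of n] e_pos[of n] mult_nonneg_nonneg[of "e n" \<omega>] omega_nonneg by linarith+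
  qed
  have e_lim: "e \<longlonglongrightarrow> 0"
    unfolding e_def by (rule LIMSEQ_ignore_initial_segment) (rule lim_const_over_n)
  have "\<exists>w. approx_solution a C (e n) w" for n
    using C(2)[of "n + Suc n0"] e1(2)[of n] unfolding e_def by simp
  then obtain w where w: "\<And>n. approx_solution a C (e n) (w n)" by metis
  define K where "K = exp ((4 * \<omega> + 2 * c) * T) * ((8 * \<omega> + 8) * M\<^sup>2 * C\<^sup>2) * T / m\<^sup>2"
  have K: "0 \<le> K" using omega_nonneg T_pos by (simp add: K_def)
  have close: "(norm (w i t - w j t))\<^sup>2 \<le> K * (e i + e j)" if "t \<in> {0..T}" for i j t
    unfolding K_def by (rule approx_solutions_close[OF w w e_pos e1(1) e_pos e1(1) C(1) that])
  have "\<exists>l. (\<lambda>n. w n t) \<longlonglongrightarrow> l" if t: "t \<in> {0..T}" for t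
  proof -
    interpret quasi_maximal "\<rho> t" m M "A t" \<omega> by (rule form[OF t])
    show ?thesis
    proof (rule convergent_if_square_le)
      show "(\<lambda>n. M\<^sup>2 * K * e n) \<longlonglongrightarrow> 0" by (rule tendsto_mult_right_zero[OF e_lim])
      fix i j
      have "M\<^sup>2 * (norm (w i t - w j t))\<^sup>2 \<le> M\<^sup>2 * (K * (e i + e j))"
        by (intro mult_left_mono close[OF t]) auto
      then show "\<rho> t (w i t - w j t) (w i t - w j t) \<le> M\<^sup>2 * K * e i + M\<^sup>2 * K * e j"
        using upper_square[of "w i t - w j t"] by (simp add: algebra_simps)
    qed
  qed
  then obtain u where u: "\<And>t. t \<in> {0..T} \<Longrightarrow> (\<lambda>n. w n t) \<longlonglongrightarrow> u t" by metis
  have wu: "norm (w n t - u t) \<le> sqrt (K * e n)" if t: "t \<in> {0..T}" for n t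
  proof -
    have "(norm (w n t - u t))\<^sup>2 \<le> K * (e n + 0)"
    proof (rule LIMSEQ_le)
      show "(\<lambda>j. (norm (w n t - w j t))\<^sup>2) \<longlonglongrightarrow> (norm (w n t - u t))\<^sup>2" by (intro tendsto_intros u t)
      show "(\<lambda>j. K * (e n + e j)) \<longlonglongrightarrow> K * (e n + 0)" by (intro tendsto_intros e_lim)
    qed (use close[OF t] in auto)
    then show ?thesis by (simp add: real_le_rsqrt)
  qed
  \<comment> \<open>The root is the distance to the limit, the linear term the consistency error of
    the scheme.\<close>
  define \<eta> where "\<eta> n = sqrt (K * e n) + C * e n" for n
  have Ce: "0 \<le> C * e n" "0 \<le> sqrt (K * e n)" for n using C(1) K e_pos[of n] by auto
  have \<eta>: "\<eta> \<longlonglongrightarrow> 0"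
  proof -
    have "\<eta> \<longlonglongrightarrow> sqrt (K * 0) + C * 0" unfolding \<eta>_def by (intro tendsto_intros e_lim)
    then show ?thesis by simp
  qed
  have wcont: "continuous_on {0..T} (w n)" for n by (rule approx_solutionD(1)[OF w])
  have "uniform_limit {0..T} w u sequentially"
  proof (rule uniform_limitI)
    fix \<epsilon> :: real assume "0 < \<epsilon>"
    then have "\<forall>\<^sub>F n in sequentially. \<eta> n < \<epsilon>" by (rule order_tendstoD(2)[OF \<eta>])
    then show "\<forall>\<^sub>F n in sequentially. \<forall>t\<in>{0..T}. dist (w n t) (u t) < \<epsilon>"
    proof eventually_elim
      case (elim n)
      show ?case
      proof
        fix t assume "t \<in> {0..T}"
        then show "dist (w n t) (u t) < \<epsilon>" using wu[of t n] Ce[of n] elim by (simp add: dist_norm \<eta>_def)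
      qed
    qed
  qed
  then have ucont: "continuous_on {0..T} u"
    by (rule uniform_limit_theorem[rotated]) (auto intro: always_eventually wcont)
  have "limit_solution \<rho> m M T c \<omega> L A a C \<eta> w u"
  proof
    show "0 \<le> C" by (rule C(1))
    show "u 0 = a"
    proof (rule LIMSEQ_unique)
      show "(\<lambda>n. w n 0) \<longlonglongrightarrow> u 0" using T_pos by (intro u) auto
      show "(\<lambda>n. w n 0) \<longlonglongrightarrow> a" by (simp add: approx_solutionD(2)[OF w])
    qed
    fix t n assume t: "t \<in> {0..T}"
    show "norm (w n t - u t) \<le> \<eta> n" using wu[OF t, of n] Ce[of n] by (simp add: \<eta>_def)
    obtain x v v' where *: "(w n has_vector_derivative - v) (at t within {t..T})" "(x, v') \<in> A t"
      "norm (v' - v) \<le> C * e n" "norm (x - w n t) \<le> C * e n" "norm v \<le> C" "norm v' \<le> C" "norm x \<le> C"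
      using approx_solutionD(3)[OF w[of n] t] by blast
    have "norm (x - u t) \<le> norm (x - w n t) + norm (w n t - u t)"
      using norm_triangle_ineq[of "x - w n t" "w n t - u t"] by simp
    then have "norm (x - u t) \<le> \<eta> n" "norm (v' - v) \<le> \<eta> n"
      using *(3,4) wu[OF t, of n] Ce[of n] unfolding \<eta>_def by linarith+
    then show "\<exists>x v v'. (w n has_vector_derivative - v) (at t within {t..T}) \<and>
      (x, v') \<in> A t \<and> norm (v' - v) \<le> \<eta> n \<and> norm (x - u t) \<le> \<eta> n \<and>
      norm v \<le> C \<and> norm v' \<le> C \<and> norm x \<le> C" using * by blast
  qed (use \<eta> ucont wcont in auto)
  then show ?thesis by blast
qed

section \<open>Right derivative of the limit\<close>

lemma (in equiv_form) has_real_derivative_square: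
  assumes "(w has_vector_derivative w') (at t within S)"
  shows "((\<lambda>s. r (w s) (w s)) has_real_derivative 2 * r (w t) w') (at t within S)"
proof -
  have "((\<lambda>s. r (w s) (w s)) has_vector_derivative r (w t) w' + r w' (w t)) (at t within S)"
    by (rule bounded_bilinear.has_vector_derivative[OF bounded_bilinear assms assms])
  then show ?thesis
    unfolding has_real_derivative_iff_has_vector_derivative sym[of w' "w t"] by simp
qed

context limit_solution
begin

text \<open>Bounds \<open>norm\<close> of the value of \<open>A t\<close> at \<open>u t\<close>:
  nearby values have \<open>nr\<close> at most \<open>M * C\<close>, \<open>quasi_closed\<close>
  adds 1, and \<open>1 / m\<close> returns to \<open>norm\<close>.\<close>

definition Y :: real where "Y = (M * C + 1) / m"

lemma Y_nonneg: "0 \<le> Y"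
  using M_pos C_nonneg m_pos by (simp add: Y_def)

lemma u_in_domain:
  assumes t: "t \<in> {0..T}"
  shows "\<exists>y. (u t, y) \<in> A t \<and> norm y \<le> Y"
proof -
  interpret quasi_maximal "\<rho> t" m M "A t" \<omega> by (rule form[OF t])
  have "\<exists>x y. (x, y) \<in> A t \<and> norm (x - u t) \<le> \<eta> n \<and> norm y \<le> C" for n
    using approx[OF t, of n] by blast
  then obtain x y where xy: "\<And>n. (x n, y n) \<in> A t" "\<And>n. norm (x n - u t) \<le> \<eta> n" "\<And>n. norm (y n) \<le> C"
    by metis
  have "(\<lambda>n. x n - u t) \<longlonglongrightarrow> 0"
    by (rule Lim_null_comparison[OF _ eta]) (simp add: xy(2))
  then have x: "x \<longlonglongrightarrow> u t" by (simp add: LIM_zero_iff)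
  have "nr (y n) \<le> M * C" for n
    using upper[of "y n"] mult_left_mono[OF xy(3), of M n] M_pos by linarith
  then obtain z where z: "(u t, z) \<in> A t" "nr z \<le> M * C + 1"
    using quasi_closed[OF x, of y "M * C"] xy(1) by auto
  have "norm z \<le> nr z / m" by (rule norm_le_nr)
  also have "\<dots> \<le> Y" unfolding Y_def using z(2) m_pos by (intro divide_right_mono) auto
  finally show ?thesis using z(1) by blast
qed

definition y :: "real \<Rightarrow> 'a" where "y t = op_apply (A t) (u t)"

lemma y_eq: "t \<in> {0..T} \<Longrightarrow> (u t, z) \<in> A t \<Longrightarrow> y t = z"
  unfolding y_def op_apply_def using unique by (intro the_equality) blast+

lemma y_mem: "t \<in> {0..T} \<Longrightarrow> (u t, y t) \<in> A t"
  and norm_y: "t \<in> {0..T} \<Longrightarrow> norm (y t) \<le> Y"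
  using u_in_domain[of t] y_eq[of t] by auto

lemma norm_u:
  assumes t: "t \<in> {0..T}"
  shows "norm (u t) \<le> C"
proof -
  have "norm (u t) \<le> C + \<eta> n" for n
  proof -
    obtain x where "norm (x - u t) \<le> \<eta> n" "norm x \<le> C" using approx[OF t, of n] by blast
    then show ?thesis using norm_triangle_sub[of "u t" x] by (simp add: norm_minus_commute)
  qed
  moreover have "(\<lambda>n. C + \<eta> n) \<longlonglongrightarrow> C + 0" by (intro tendsto_intros eta)
  ultimately show ?thesis using LIMSEQ_le_const[of "\<lambda>n. C + \<eta> n"] by auto
qed

text \<open>The Lipschitz constant of \<open>u\<close>; the factor \<open>M / m\<close> arises
  because the mean value estimate is made in the form at time 0.\<close>

definition C' :: real where "C' = M * C / m"

lemma C'_nonneg: "0 \<le> C'" using M_pos C_nonneg m_pos by (simp add: C'_def)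

lemma w_tendsto: "t \<in> {0..T} \<Longrightarrow> (\<lambda>n. w n t) \<longlonglongrightarrow> u t"
  by (rule LIM_zero_cancel, rule Lim_null_comparison[OF _ eta]) (simp add: w_close)

lemma u_lipschitz:
  assumes "0 \<le> s" "s \<le> t" "t \<le> T"
  shows "norm (u t - u s) \<le> C' * (t - s)"
proof -
  interpret equiv_form "\<rho> 0" m M by (rule equiv) (use T_pos in auto)
  have "nr (w n t - w n s) \<le> (M * C) * (t - s)" for n
  proof (rule right_deriv_bound)
    show "continuous_on {s..t} (w n)" using assms by (intro continuous_on_subset[OF w_cont]) auto
    show "0 \<le> M * C" using M_pos C_nonneg by simp
    fix \<tau> assume \<tau>: "\<tau> \<in> {s..<t}"
    then obtain v where v: "(w n has_vector_derivative - v) (at \<tau> within {\<tau>..T})" "norm v \<le> C"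
      using approx[of \<tau> n] assms by auto
    have "nr (- v) \<le> M * C" unfolding nr_minus
      using upper[of v] mult_left_mono[OF v(2), of M] M_pos by linarith
    then show "\<exists>w'. (w n has_vector_derivative w') (at \<tau> within {\<tau>..t}) \<and> nr w' \<le> M * C"
      using has_vector_derivative_within_subset[OF v(1), of "{\<tau>..t}"] assms by auto
  qed (use assms in auto)
  moreover have "(\<lambda>n. nr (w n t - w n s)) \<longlonglongrightarrow> nr (u t - u s)"
    using assms by (intro tendsto_intros w_tendsto) auto
  ultimately have "nr (u t - u s) \<le> (M * C) * (t - s)" by (intro LIMSEQ_le_const2) auto
  then have "nr (u t - u s) / m \<le> (M * C) * (t - s) / m" using m_pos by (intro divide_right_mono) auto
  then show ?thesis using norm_le_nr[of "u t - u s"] by (simp add: C'_def)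
qed

text \<open>
  The estimate behind the right differentiability of \<open>u\<close>. Expanding the square of
  \<open>w n \<tau> - u s + (\<tau> - s) y s\<close>, quasi-monotonicity handles the quadratic part, while the linear part is
  small because \<open>A s\<close> is demicontinuous on bounded sets.
\<close>

lemma right_deriv_estimate:
  assumes s: "0 \<le> s" "s < T" and "0 < \<epsilon>"
  shows "\<exists>K h0. 0 \<le> K \<and> 0 < h0 \<and> (\<forall>t. s < t \<longrightarrow> t \<le> T \<longrightarrow> t - s < h0 \<longrightarrow>
    \<rho> s (u t - u s + (t - s) *\<^sub>R y s) (u t - u s + (t - s) *\<^sub>R y s) \<le> 2 * (t - s)\<^sup>2 * (\<epsilon> + K * (t - s)))"
proof -
  have sT: "s \<in> {0..T}" using s by simp
  interpret quasi_maximal "\<rho> s" m M "A s" \<omega> by (rule form[OF sT])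
  define L1 where "L1 = L * (1 + 2 * C)"
  have L1: "0 \<le> L1" using L_nonneg C_nonneg by (simp add: L1_def)
  obtain \<delta> where \<delta>: "\<delta> > 0" "\<And>x z. (x, z) \<in> A s \<Longrightarrow> nr (x - u s) < \<delta> \<Longrightarrow> nr z \<le> M * (C + L1 * T) \<Longrightarrow>
      \<rho> s (y s) (y s) - \<epsilon> \<le> \<rho> s z (y s)"
    using quasi_demicontinuous[OF y_mem[OF sT] \<open>0 < \<epsilon>\<close>, of "M * (C + L1 * T)"] M_pos C_nonneg L1 T_pos by auto
  \<comment> \<open>The coefficients of the terms of higher order in \<open>t - s\<close> that
    remain once \<open>n\<close> has gone to infinity.\<close>
  define K where "K = \<omega> * M\<^sup>2 * C'\<^sup>2 + M\<^sup>2 * C' * L1 + M\<^sup>2 * L1 * Y"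
  have K: "0 \<le> K" using omega_nonneg C'_nonneg L1 Y_nonneg by (simp add: K_def)
  \<comment> \<open>For \<open>t - s < h0\<close> the points \<open>x\<close> of the approximation,
    which lie within \<open>\<theta> n\<close> of \<open>u s\<close>, eventually enter the
    \<open>\<delta>\<close>-neighbourhood where demicontinuity applies.\<close>
  define h0 where "h0 = \<delta> / (M * (C' + 1))"
  have MC: "M * (C' + 1) > 0" using M_pos C'_nonneg by simp
  have h0: "0 < h0" using \<delta>(1) MC by (simp add: h0_def)
  have "\<rho> s (u t - u s + (t - s) *\<^sub>R y s) (u t - u s + (t - s) *\<^sub>R y s) \<le> 2 * (t - s)\<^sup>2 * (\<epsilon> + K * (t - s))"
    if t: "s < t" "t \<le> T" "t - s < h0" for t
  proof -
    define h where "h = t - s"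
    have h: "0 < h" "h \<le> T" using t s by (auto simp: h_def)
    \<comment> \<open>\<open>\<theta>\<close> bounds the distance of grid values from
      \<open>u s\<close>; \<open>\<zeta>\<close> bounds the distance of the velocity from the value
      of \<open>A s\<close> at the same grid value.\<close>
    define \<theta> \<zeta> where "\<theta> n = \<eta> n + C' * h" and "\<zeta> n = L1 * h + \<eta> n" for n
    define \<kappa> where "\<kappa> n = 2 * (\<omega> * (M\<^sup>2 * \<theta> n * \<theta> n) + M\<^sup>2 * \<theta> n * \<zeta> n + M\<^sup>2 * (2 * \<eta> n) * (C + Y) + h * (\<epsilon> + M\<^sup>2 * \<zeta> n * Y))" for n
    have eta0: "0 \<le> \<eta> n" for n using w_close[OF sT, of n] norm_ge_zero order_trans by blast
    have \<theta>0: "0 \<le> \<theta> n" "0 \<le> \<zeta> n" for n using eta0[of n] C'_nonneg L1 h by (auto simp: \<theta>_def \<zeta>_def)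
    have \<kappa>0: "0 \<le> \<kappa> n" for n unfolding \<kappa>_def
      using \<theta>0[of n] eta0[of n] omega_nonneg C_nonneg Y_nonneg h \<open>0 < \<epsilon>\<close> by (intro mult_nonneg_nonneg add_nonneg_nonneg) auto
    have \<theta>_lim: "\<theta> \<longlonglongrightarrow> 0 + C' * h" and \<zeta>_lim: "\<zeta> \<longlonglongrightarrow> L1 * h + 0"
      unfolding \<theta>_def \<zeta>_def by (intro tendsto_intros eta)+
    have "M * (C' * h) < \<delta>"
    proof -
      have "M * (C' * h) \<le> M * (C' + 1) * h" using M_pos h by (simp add: algebra_simps)
      also have "\<dots> < M * (C' + 1) * h0" using t(3) MC by (intro mult_strict_left_mono) (auto simp: h_def)
      also have "\<dots> = \<delta>" unfolding h0_def times_divide_eq_right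
        by (rule nonzero_mult_div_cancel_left[OF less_imp_neq[OF MC, symmetric]])
      finally show ?thesis .
    qed
    moreover have "(\<lambda>n. M * \<theta> n) \<longlonglongrightarrow> M * (0 + C' * h)" by (intro tendsto_intros \<theta>_lim)
    ultimately have ev: "\<forall>\<^sub>F n in sequentially. M * \<theta> n < \<delta>"
      by (intro order_tendstoD(2)) auto
    define z where "z n \<tau> = w n \<tau> - u s + (\<tau> - s) *\<^sub>R y s" for n \<tau>
    have bound: "\<rho> s p q \<le> M\<^sup>2 * P * Q" "- (M\<^sup>2 * P * Q) \<le> \<rho> s p q" if "norm p \<le> P" "norm q \<le> Q" for p q P Q
    proof -
      have "0 \<le> P" using that(1) norm_ge_zero order_trans by blast
      then have "M\<^sup>2 * norm p * norm q \<le> M\<^sup>2 * P * Q" using that by (intro mult_mono) auto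
      then show "\<rho> s p q \<le> M\<^sup>2 * P * Q" "- (M\<^sup>2 * P * Q) \<le> \<rho> s p q" using le_norm[of p q] by linarith+
    qed
    have est: "\<rho> s (z n t) (z n t) \<le> M\<^sup>2 * \<eta> n * \<eta> n + \<kappa> n * h" if n: "M * \<theta> n < \<delta>" for n
    proof -
      have "\<rho> s (z n t) (z n t) \<le> exp (0 * (t - s)) * (\<rho> s (z n s) (z n s) + \<kappa> n * (t - s))"
      proof (rule right_gronwall[where N = "{}"])
        show "continuous_on {s..t} (\<lambda>\<tau>. \<rho> s (z n \<tau>) (z n \<tau>))"
          unfolding z_def using s t by (intro continuous_intros continuous_on_subset[OF w_cont]) auto
        fix \<tau> assume "\<tau> \<in> {s..<t} - {}"
        then have \<tau>: "\<tau> \<in> {0..T}" "s \<le> \<tau>" "\<tau> < t" using s t by auto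
        define k where "k = \<tau> - s"
        have k: "0 \<le> k" "k \<le> h" using \<tau> by (auto simp: k_def h_def)
        obtain x v v' where xv: "(w n has_vector_derivative - v) (at \<tau> within {\<tau>..T})" "(x, v') \<in> A \<tau>"
          "norm (v' - v) \<le> \<eta> n" "norm (x - u \<tau>) \<le> \<eta> n" "norm v \<le> C" "norm v' \<le> C" "norm x \<le> C"
          using approx[OF \<tau>(1), of n] by blast
        obtain q where q: "(x, q) \<in> A s" using domain[OF \<tau>(1) sT xv(2)] by blast
        have "norm (q - v') \<le> L * \<bar>s - \<tau>\<bar> * (1 + norm x + norm v')" by (rule lipschitz[OF \<tau>(1) sT xv(2) q])
        also have "\<dots> \<le> L * h * (1 + 2 * C)"
          using k xv L_nonneg h by (intro mult_mono mult_nonneg_nonneg) (auto simp: k_def)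
        finally have qv': "norm (q - v') \<le> L1 * h" by (simp add: L1_def mult_ac)
        have vq: "norm (v - q) \<le> \<zeta> n"
          using norm_triangle_ineq[of "q - v'" "v' - v"] qv' xv(3) unfolding \<zeta>_def norm_minus_commute[of v q] by simp
        have "norm q \<le> C + L1 * T"
          using norm_triangle_ineq[of v' "q - v'"] qv' xv(6) mult_left_mono[OF h(2) L1] by simp
        then have nq: "nr q \<le> M * (C + L1 * T)"
          using upper[of q] mult_left_mono[of "norm q" "C + L1 * T" M] M_pos by linarith
        have "norm (u \<tau> - u s) \<le> C' * k" unfolding k_def using u_lipschitz s \<tau> by simp
        also have "\<dots> \<le> C' * h" using k C'_nonneg by (intro mult_left_mono) auto
        finally have xu: "norm (x - u s) \<le> \<theta> n"
          using norm_triangle_ineq[of "x - u \<tau>" "u \<tau> - u s"] xv(4) by (simp add: \<theta>_def)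
        have nxu: "nr (x - u s) < \<delta>"
          using upper[of "x - u s"] mult_left_mono[OF xu, of M] M_pos n by linarith
        have wx: "norm (w n \<tau> - x) \<le> 2 * \<eta> n"
          using norm_triangle_ineq4[of "w n \<tau> - u \<tau>" "x - u \<tau>"] w_close[OF \<tau>(1), of n] xv(4) by simp
        have vy: "norm (v - y s) \<le> C + Y"
          using norm_triangle_ineq4[of v "y s"] xv(5) norm_y[OF sT] by linarith
        have demi: "\<rho> s (y s) (y s) - \<epsilon> \<le> \<rho> s q (y s)" by (rule \<delta>(2)[OF q nxu nq])
        have 1: "- \<omega> * \<rho> s (x - u s) (x - u s) \<le> \<rho> s (q - y s) (x - u s)"
          by (rule quasi_monotone[OF q y_mem[OF sT]])
        have "\<omega> * \<rho> s (x - u s) (x - u s) \<le> \<omega> * (M\<^sup>2 * \<theta> n * \<theta> n)"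
          using bound(1)[OF xu xu] omega_nonneg by (intro mult_left_mono) auto
        moreover have 2: "- (M\<^sup>2 * \<theta> n * \<zeta> n) \<le> \<rho> s (x - u s) (v - q)" by (rule bound(2)[OF xu vq])
        moreover have 3: "- (M\<^sup>2 * (2 * \<eta> n) * (C + Y)) \<le> \<rho> s (w n \<tau> - x) (v - y s)" by (rule bound(2)[OF wx vy])
        \<comment> \<open>The first term is bounded by quasi-monotonicity at the fixed time
          \<open>s\<close>; the second carries the change of the operator, the third the
          interpolation error.\<close>
        moreover have "\<rho> s (w n \<tau> - u s) (v - y s) =
            \<rho> s (q - y s) (x - u s) + \<rho> s (x - u s) (v - q) + \<rho> s (w n \<tau> - x) (v - y s)"
          using sym[of "q - y s" "x - u s"] by (simp add: diff_left diff_right)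
        ultimately have A: "- (\<omega> * (M\<^sup>2 * \<theta> n * \<theta> n) + M\<^sup>2 * \<theta> n * \<zeta> n + M\<^sup>2 * (2 * \<eta> n) * (C + Y))
            \<le> \<rho> s (w n \<tau> - u s) (v - y s)"
          using 1 by linarith
        have "- (\<epsilon> + M\<^sup>2 * \<zeta> n * Y) \<le> \<rho> s (v - y s) (y s)"
          using demi bound(2)[OF vq norm_y[OF sT]] by (simp add: diff_left)
        then have "k * - (\<epsilon> + M\<^sup>2 * \<zeta> n * Y) \<le> k * \<rho> s (v - y s) (y s)"
          using k by (intro mult_left_mono) auto
        moreover have "0 \<le> \<epsilon> + M\<^sup>2 * \<zeta> n * Y"
          using \<theta>0[of n] \<open>0 < \<epsilon>\<close> Y_nonneg by (intro add_nonneg_nonneg mult_nonneg_nonneg) auto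
        then have "h * - (\<epsilon> + M\<^sup>2 * \<zeta> n * Y) \<le> k * - (\<epsilon> + M\<^sup>2 * \<zeta> n * Y)"
          using k by (intro mult_right_mono_neg) auto
        ultimately have B: "- (h * (\<epsilon> + M\<^sup>2 * \<zeta> n * Y)) \<le> k * \<rho> s (v - y s) (y s)" by linarith
        have "\<rho> s (z n \<tau>) (v - y s) = \<rho> s (w n \<tau> - u s) (v - y s) + k * \<rho> s (v - y s) (y s)"
          unfolding z_def add_left scale_left k_def sym[of "y s" "v - y s"] by (rule refl)
        then have "2 * \<rho> s (z n \<tau>) (- (v - y s)) \<le> \<kappa> n"
          using A B unfolding minus_right \<kappa>_def by argo
        moreover have "(z n has_vector_derivative - (v - y s)) (at \<tau> within {\<tau>..t})"
        proof -
          have "{\<tau>..t} \<subseteq> {\<tau>..T}" using t by auto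
          from has_vector_derivative_within_subset[OF xv(1) this]
          show ?thesis unfolding z_def by (auto intro!: derivative_eq_intros)
        qed
        ultimately show "\<exists>d. ((\<lambda>\<tau>. \<rho> s (z n \<tau>) (z n \<tau>)) has_real_derivative d) (at \<tau> within {\<tau>..t}) \<and>
            d \<le> 0 * \<rho> s (z n \<tau>) (z n \<tau>) + \<kappa> n"
          using has_real_derivative_square by fastforce
      qed (use t \<kappa>0 in auto)
      moreover have "\<rho> s (z n s) (z n s) \<le> M\<^sup>2 * \<eta> n * \<eta> n"
        using bound(1)[OF w_close[OF sT] w_close[OF sT], of n n] by (simp add: z_def)
      ultimately show ?thesis by (simp add: h_def)
    qed
    have lim: "(\<lambda>n. M\<^sup>2 * \<eta> n * \<eta> n + \<kappa> n * h) \<longlonglongrightarrow> M\<^sup>2 * 0 * 0 +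
        (2 * (\<omega> * (M\<^sup>2 * (0 + C' * h) * (0 + C' * h)) + M\<^sup>2 * (0 + C' * h) * (L1 * h + 0) + M\<^sup>2 * (2 * 0) * (C + Y) +
          h * (\<epsilon> + M\<^sup>2 * (L1 * h + 0) * Y))) * h"
      unfolding \<kappa>_def by (intro tendsto_intros \<theta>_lim \<zeta>_lim eta)
    have "(\<lambda>n. \<rho> s (z n t) (z n t)) \<longlonglongrightarrow> \<rho> s (u t - u s + (t - s) *\<^sub>R y s) (u t - u s + (t - s) *\<^sub>R y s)"
      unfolding z_def using s t by (intro tendsto_intros w_tendsto) auto
    from tendsto_le[OF _ lim this eventually_mono[OF ev est]]
    have "\<rho> s (u t - u s + (t - s) *\<^sub>R y s) (u t - u s + (t - s) *\<^sub>R y s) \<le>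
        (2 * (\<omega> * (M\<^sup>2 * (C' * h) * (C' * h)) + M\<^sup>2 * (C' * h) * (L1 * h) + h * (\<epsilon> + M\<^sup>2 * (L1 * h) * Y))) * h"
      by simp
    also have "\<dots> = 2 * h\<^sup>2 * (\<epsilon> + K * h)" by (simp add: K_def power2_eq_square algebra_simps)
    finally show ?thesis by (simp add: h_def)
  qed
  with K h0 show ?thesis by blast
qed

lemma u_right_deriv:
  assumes s: "0 \<le> s" "s < T"
  shows "(u has_vector_derivative - y s) (at s within {s..T})"
  unfolding has_vector_derivative_def has_derivative_within_alt
proof (intro conjI allI impI)
  show "bounded_linear (\<lambda>x. x *\<^sub>R - y s)" by (rule bounded_linear_scaleR_left)
  fix e :: real assume "e > 0"
  have sT: "s \<in> {0..T}" using s by simp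
  interpret quasi_maximal "\<rho> s" m M "A s" \<omega> by (rule form[OF sT])
  \<comment> \<open>With \<open>K * (t - s) \<le> \<epsilon>\<close> the estimate becomes
    \<open>4 * \<epsilon> * (t - s)\<^sup>2\<close>, which is the square of
    \<open>m * e * (t - s)\<close>.\<close>
  define \<epsilon> where "\<epsilon> = m\<^sup>2 * e\<^sup>2 / 4"
  have "\<epsilon> > 0" using \<open>e > 0\<close> m_pos by (simp add: \<epsilon>_def)
  obtain K h0 where K: "0 \<le> K" "0 < h0" and est: "\<And>t. s < t \<Longrightarrow> t \<le> T \<Longrightarrow> t - s < h0 \<Longrightarrow>
    \<rho> s (u t - u s + (t - s) *\<^sub>R y s) (u t - u s + (t - s) *\<^sub>R y s) \<le> 2 * (t - s)\<^sup>2 * (\<epsilon> + K * (t - s))"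
    using right_deriv_estimate[OF s \<open>\<epsilon> > 0\<close>] by blast
  define d where "d = min h0 (\<epsilon> / (K + 1))"
  have "d > 0" using K \<open>\<epsilon> > 0\<close> by (simp add: d_def)
  moreover have "norm (u t - u s - (t - s) *\<^sub>R - y s) \<le> e * norm (t - s)"
    if t: "t \<in> {s..T}" "norm (t - s) < d" for t
  proof (cases "t = s")
    case False
    then have st: "s < t" "t \<le> T" "t - s < h0" "t - s < \<epsilon> / (K + 1)" using t by (auto simp: d_def)
    have "(K + 1) * (t - s) < \<epsilon>" using st(4) K by (simp add: pos_less_divide_eq mult.commute)
    then have "K * (t - s) \<le> \<epsilon>" using st(1) K by (simp add: algebra_simps)
    then have "2 * (t - s)\<^sup>2 * (\<epsilon> + K * (t - s)) \<le> 2 * (t - s)\<^sup>2 * (\<epsilon> + \<epsilon>)" by (intro mult_left_mono) auto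
    also have "\<dots> = m\<^sup>2 * (e * (t - s))\<^sup>2" by (simp add: \<epsilon>_def power_mult_distrib)
    finally have "m\<^sup>2 * (norm (u t - u s + (t - s) *\<^sub>R y s))\<^sup>2 \<le> m\<^sup>2 * (e * (t - s))\<^sup>2"
      using est[OF st(1-3)] lower_square[of "u t - u s + (t - s) *\<^sub>R y s"] by linarith
    then have "(norm (u t - u s + (t - s) *\<^sub>R y s))\<^sup>2 \<le> (e * (t - s))\<^sup>2" using m_pos by simp
    then have "norm (u t - u s + (t - s) *\<^sub>R y s) \<le> e * (t - s)"
      by (rule power2_le_imp_le) (use \<open>e > 0\<close> st in auto)
    then show ?thesis using st by simp
  qed simp
  ultimately show "\<exists>d>0. \<forall>t\<in>{s..T}. norm (t - s) < d \<longrightarrow>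
      norm (u t - u s - (t - s) *\<^sub>R - y s) \<le> e * norm (t - s)" by blast
qed

end

section \<open>Continuity of the derivative, and uniqueness\<close>

context limit_solution
begin

text \<open>The rate consists of \<open>2 * \<omega>\<close> from quasi-monotonicity,
  \<open>2 * c\<close> from the moving form and 1 from Young's inequality; \<open>drift\<close> is
  the other part of Young's inequality, the squared Lipschitz perturbation per unit shift.\<close>

definition growth_rate :: real where "growth_rate = 2 * \<omega> + 2 * c + 1"
definition drift :: real where "drift = (M * (L * (1 + C + Y)))\<^sup>2"

lemma growth_rate_nonneg: "0 \<le> growth_rate"
  using omega_nonneg c_nonneg by (simp add: growth_rate_def)

lemma u_value_lipschitz:
  assumes "s \<in> {0..T}" "t \<in> {0..T}" "(u s, q) \<in> A t"
  shows "norm (q - y s) \<le> L * \<bar>t - s\<bar> * (1 + C + Y)"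
proof -
  have "norm (q - y s) \<le> L * \<bar>t - s\<bar> * (1 + norm (u s) + norm (y s))"
    by (rule lipschitz[OF assms(1,2) y_mem[OF assms(1)] assms(3)])
  also have "\<dots> \<le> L * \<bar>t - s\<bar> * (1 + C + Y)"
    using norm_u[OF assms(1)] norm_y[OF assms(1)] L_nonneg by (intro mult_left_mono) auto
  finally show ?thesis .
qed

text \<open>The shifted function follows the operator at time \<open>\<tau> + h\<close>. Its value
  there is replaced by \<open>q\<close>, taken from \<open>A \<tau>\<close> at the same point; the
  error of order \<open>h\<close> contributes a term of order \<open>h\<^sup>2\<close>, the same
  order as the squared difference.\<close>

lemma shifted_difference_growth:
  assumes st: "0 \<le> s" "s \<le> t" and h: "0 < h" "t + h \<le> T"
  shows "\<rho> t (u (t + h) - u t) (u (t + h) - u t) \<le>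
    exp (growth_rate * (t - s)) * (\<rho> s (u (s + h) - u s) (u (s + h) - u s) + drift * h\<^sup>2 * (t - s))"
proof (rule right_gronwall[where N = "{}"])
  have shift: "continuous_on {s..t} (\<lambda>\<tau>. u (\<tau> + h))"
    by (rule continuous_on_compose2[OF u_cont]) (use st h in \<open>auto intro!: continuous_intros\<close>)
  show "continuous_on {s..t} (\<lambda>\<tau>. \<rho> \<tau> (u (\<tau> + h) - u \<tau>) (u (\<tau> + h) - u \<tau>))"
    using st h
    by (intro continuous_moving_square continuous_on_diff shift continuous_on_subset[OF u_cont]) auto
  fix \<tau> assume "\<tau> \<in> {s..<t} - {}"
  then have \<tau>: "\<tau> \<in> {0..T}" "\<tau> + h \<in> {0..T}" "\<tau> < T" "\<tau> + h < T" "0 \<le> \<tau>" "\<tau> \<in> {\<tau>..t}" "{\<tau>..t} \<subseteq> {0..T}" "{\<tau>..t} \<subseteq> {\<tau>..T}"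
    using st h by auto
  interpret quasi_maximal "\<rho> \<tau>" m M "A \<tau>" \<omega> by (rule form[OF \<tau>(1)])
  define d where "d = u (\<tau> + h) - u \<tau>"
  have 1: "(u has_vector_derivative - y \<tau>) (at \<tau> within {\<tau>..t})"
    by (rule has_vector_derivative_within_subset[OF u_right_deriv[OF \<tau>(5,3)] \<tau>(8)])
  have "((\<lambda>\<tau>. \<tau> + h) has_vector_derivative 1) (at \<tau> within {\<tau>..t})"
    by (auto intro!: derivative_eq_intros)
  moreover have "(u has_vector_derivative - y (\<tau> + h)) (at (\<tau> + h) within (\<lambda>\<tau>. \<tau> + h) ` {\<tau>..t})"
    by (rule has_vector_derivative_within_subset[OF u_right_deriv]) (use \<tau> h in auto)
  ultimately have 2: "((\<lambda>\<tau>. u (\<tau> + h)) has_vector_derivative - y (\<tau> + h)) (at \<tau> within {\<tau>..t})"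
    using vector_diff_chain_within[of "\<lambda>\<tau>. \<tau> + h" 1 \<tau> "{\<tau>..t}" u "- y (\<tau> + h)"] by (simp add: o_def)
  have "((\<lambda>\<tau>. u (\<tau> + h) - u \<tau>) has_vector_derivative - (y (\<tau> + h) - y \<tau>)) (at \<tau> within {\<tau>..t})"
    using has_vector_derivative_diff[OF 2 1] by simp
  from moving_square_deriv[OF \<tau>(7,6) this]
  obtain D where D: "((\<lambda>\<tau>. \<rho> \<tau> (u (\<tau> + h) - u \<tau>) (u (\<tau> + h) - u \<tau>)) has_real_derivative D) (at \<tau> within {\<tau>..t})"
    "D \<le> 2 * \<rho> \<tau> d (- (y (\<tau> + h) - y \<tau>)) + 2 * c * \<rho> \<tau> d d"
    unfolding d_def by blast
  obtain q where q: "(u (\<tau> + h), q) \<in> A \<tau>" using domain[OF \<tau>(2,1) y_mem[OF \<tau>(2)]] by blast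
  define G where "G = M * (L * (1 + C + Y))"
  have "norm (q - y (\<tau> + h)) \<le> L * h * (1 + C + Y)"
    using u_value_lipschitz[OF \<tau>(2,1) q] h by simp
  then have "M * norm (q - y (\<tau> + h)) \<le> M * (L * h * (1 + C + Y))"
    using M_pos by (intro mult_left_mono) auto
  then have nq: "nr (q - y (\<tau> + h)) \<le> G * h"
    using upper[of "q - y (\<tau> + h)"] by (simp add: G_def mult_ac)
  have mono: "- \<omega> * \<rho> \<tau> d d \<le> \<rho> \<tau> d (q - y \<tau>)"
    using quasi_monotone[OF q y_mem[OF \<tau>(1)]] sym[of d "q - y \<tau>"] unfolding d_def by linarith
  have "nr d * nr (q - y (\<tau> + h)) \<le> nr d * (G * h)" by (rule mult_left_mono[OF nq nr_nonneg])
  moreover have "0 \<le> (nr d - G * h)\<^sup>2" by simp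
  then have "2 * (nr d * (G * h)) \<le> \<rho> \<tau> d d + (G * h)\<^sup>2"
    unfolding power2_diff nr_square by (simp add: mult_ac)
  ultimately have cross: "2 * \<rho> \<tau> d (q - y (\<tau> + h)) \<le> \<rho> \<tau> d d + (G * h)\<^sup>2"
    using le_nr[of d "q - y (\<tau> + h)"] by linarith
  have "\<rho> \<tau> d (y (\<tau> + h) - y \<tau>) = \<rho> \<tau> d (q - y \<tau>) - \<rho> \<tau> d (q - y (\<tau> + h))" by (simp add: diff_right)
  then have "2 * \<rho> \<tau> d (- (y (\<tau> + h) - y \<tau>)) + 2 * c * \<rho> \<tau> d d \<le>
      2 * \<omega> * \<rho> \<tau> d d + \<rho> \<tau> d d + (G * h)\<^sup>2 + 2 * c * \<rho> \<tau> d d"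
    using mono cross unfolding minus_right by argo
  also have "(G * h)\<^sup>2 = drift * h\<^sup>2" by (simp add: drift_def G_def power_mult_distrib)
  also have "2 * \<omega> * \<rho> \<tau> d d + \<rho> \<tau> d d + drift * h\<^sup>2 + 2 * c * \<rho> \<tau> d d = growth_rate * \<rho> \<tau> d d + drift * h\<^sup>2"
    by (simp add: growth_rate_def algebra_simps)
  finally show "\<exists>D. ((\<lambda>\<tau>. \<rho> \<tau> (u (\<tau> + h) - u \<tau>) (u (\<tau> + h) - u \<tau>)) has_real_derivative D) (at \<tau> within {\<tau>..t}) \<and>
      D \<le> growth_rate * \<rho> \<tau> (u (\<tau> + h) - u \<tau>) (u (\<tau> + h) - u \<tau>) + drift * h\<^sup>2"
    using D unfolding d_def by (meson order_trans)
qed (use st growth_rate_nonneg in \<open>auto simp: drift_def\<close>)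

text \<open>Dividing the growth of shifted differences by the squared shift and letting the shift
  tend to 0 turns differences into right derivatives, so no differentiability of \<open>y\<close> is
  required.\<close>

lemma y_growth:
  assumes st: "0 \<le> s" "s \<le> t" "t < T"
  shows "\<rho> t (y t) (y t) \<le> exp (growth_rate * (t - s)) * (\<rho> s (y s) (y s) + drift * (t - s))"
proof -
  define h where "h n = (T - t) / real (Suc n)" for n
  have h: "0 < h n" "h n \<le> T - t" for n
    using st divide_left_mono[of 1 "real (Suc n)" "T - t"] by (auto simp: h_def)
  have h_lim: "h \<longlonglongrightarrow> 0"
    unfolding h_def using LIMSEQ_ignore_initial_segment[OF lim_const_over_n[of "T - t"], of 1] by simp
  have quot: "(\<lambda>n. (1 / h n) *\<^sub>R (u (\<tau> + h n) - u \<tau>)) \<longlonglongrightarrow> - y \<tau>" if \<tau>: "0 \<le> \<tau>" "\<tau> \<le> t" for \<tau>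
  proof -
    have "filterlim (\<lambda>n. \<tau> + h n) (at \<tau> within {\<tau>..T}) sequentially"
      unfolding filterlim_at
    proof
      show "(\<lambda>n. \<tau> + h n) \<longlonglongrightarrow> \<tau>" using tendsto_add[OF tendsto_const h_lim, of \<tau>] by simp
      have "\<tau> + h n \<in> {\<tau>..T} \<and> \<tau> + h n \<noteq> \<tau>" for n using h[of n] \<tau> by auto
      then show "\<forall>\<^sub>F n in sequentially. \<tau> + h n \<in> {\<tau>..T} \<and> \<tau> + h n \<noteq> \<tau>" by simp
    qed
    from filterlim_compose[OF has_vector_derivative_quotient[OF u_right_deriv] this]
    show ?thesis using \<tau> st by simp
  qed
  have t: "t \<in> {0..T}" and s: "s \<in> {0..T}" using st by auto
  interpret t: equiv_form "\<rho> t" m M by (rule equiv[OF t])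
  interpret s: equiv_form "\<rho> s" m M by (rule equiv[OF s])
  define Q where "Q \<tau> n = (1 / h n) *\<^sub>R (u (\<tau> + h n) - u \<tau>)" for \<tau> n
  have "\<rho> t (Q t n) (Q t n) \<le> exp (growth_rate * (t - s)) * (\<rho> s (Q s n) (Q s n) + drift * (t - s))" for n
  proof -
    let ?d = "\<lambda>\<tau>. u (\<tau> + h n) - u \<tau>"
    have t2: "\<rho> t (?d t) (?d t) = (h n)\<^sup>2 * \<rho> t (Q t n) (Q t n)"
      and s2: "\<rho> s (?d s) (?d s) = (h n)\<^sup>2 * \<rho> s (Q s n) (Q s n)"
      using h(1)[of n] unfolding Q_def t.scale_left t.scale_right s.scale_left s.scale_right
      by (simp_all add: power2_eq_square)
    have "(h n)\<^sup>2 * \<rho> t (Q t n) (Q t n) \<le> exp (growth_rate * (t - s)) * ((h n)\<^sup>2 * \<rho> s (Q s n) (Q s n) + drift * (h n)\<^sup>2 * (t - s))"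
      using shifted_difference_growth[OF st(1,2) h(1)[of n]] h(2)[of n] unfolding t2 s2 by simp
    also have "\<dots> = (h n)\<^sup>2 * (exp (growth_rate * (t - s)) * (\<rho> s (Q s n) (Q s n) + drift * (t - s)))"
      by (simp add: algebra_simps)
    finally show ?thesis using h(1)[of n] by simp
  qed
  moreover have "(\<lambda>n. \<rho> t (Q t n) (Q t n)) \<longlonglongrightarrow> \<rho> t (- y t) (- y t)"
    unfolding Q_def using st by (intro t.tendsto_form quot) auto
  moreover have "(\<lambda>n. exp (growth_rate * (t - s)) * (\<rho> s (Q s n) (Q s n) + drift * (t - s))) \<longlonglongrightarrow>
      exp (growth_rate * (t - s)) * (\<rho> s (- y s) (- y s) + drift * (t - s))"
    unfolding Q_def using st by (intro tendsto_mult tendsto_add tendsto_const s.tendsto_form quot) auto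
  ultimately have "\<rho> t (- y t) (- y t) \<le> exp (growth_rate * (t - s)) * (\<rho> s (- y s) (- y s) + drift * (t - s))"
    by (meson LIMSEQ_le)
  then show ?thesis by (simp add: t.minus_left t.minus_right s.minus_left s.minus_right)
qed

definition damped_speed :: "real \<Rightarrow> real" where "damped_speed t = exp (- growth_rate * t) * \<rho> t (y t) (y t) - drift * t"

lemma countable_discontinuities: "countable {t \<in> {0<..<T}. \<not> isCont damped_speed t}"
proof -
  have "mono_on {0<..<T} (\<lambda>t. - damped_speed t)"
  proof (rule mono_onI)
    fix s t assume st: "s \<in> {0<..<T}" "t \<in> {0<..<T}" "s \<le> t"
    have "exp (- growth_rate * t) * \<rho> t (y t) (y t) \<le>
        exp (- growth_rate * t) * (exp (growth_rate * (t - s)) * (\<rho> s (y s) (y s) + drift * (t - s)))"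
      using st by (intro mult_left_mono y_growth) auto
    also have "\<dots> = exp (- growth_rate * t + growth_rate * (t - s)) * (\<rho> s (y s) (y s) + drift * (t - s))"
      by (simp only: exp_add mult.assoc)
    also have "- growth_rate * t + growth_rate * (t - s) = - growth_rate * s" by (simp add: algebra_simps)
    \<comment> \<open>The factor is at most 1 since \<open>s\<close> is positive, so the source
      costs no more than the linear term subtracted in \<open>damped_speed\<close>.\<close>
    also have "exp (- growth_rate * s) * (\<rho> s (y s) (y s) + drift * (t - s)) \<le>
        exp (- growth_rate * s) * \<rho> s (y s) (y s) + 1 * (drift * (t - s))"
      unfolding distrib_left using st growth_rate_nonneg
      by (intro add_mono mult_right_mono order_refl) (auto simp: drift_def)
    finally show "- damped_speed s \<le> - damped_speed t" by (simp add: damped_speed_def algebra_simps)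
  qed
  then have "countable {t \<in> {0<..<T}. \<not> isCont (\<lambda>t. - damped_speed t) t}" by (intro mono_on_ctble_discont_open) auto
  moreover have "isCont (\<lambda>t. - damped_speed t) t \<longleftrightarrow> isCont damped_speed t" for t
    using continuous_minus[of "at t" "\<lambda>t. - damped_speed t"] continuous_minus[of "at t" damped_speed] by auto
  ultimately show ?thesis by simp
qed

text \<open>In the expansion of the square of \<open>y s - y t\<close>, convergence of the speeds
  handles the pure squares. Demicontinuity of \<open>A t\<close> bounds the cross term from below,
  after \<open>y s\<close> is replaced by the value \<open>q\<close> of \<open>A t\<close> at
  \<open>u s\<close> and the form is changed from \<open>s\<close> to \<open>t\<close>.\<close>

lemma y_continuous:
  assumes t: "t \<in> {0<..<T}" and cont: "isCont damped_speed t"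
  shows "isCont y t"
proof -
  have tT: "t \<in> {0..T}" and at: "at t within {0..T} = at t" using t by (auto simp: at_within_Icc_at)
  interpret quasi_maximal "\<rho> t" m M "A t" \<omega> by (rule form[OF tT])
  have g_eq: "\<rho> s (y s) (y s) = exp (growth_rate * s) * (damped_speed s + drift * s)" for s
    by (simp add: damped_speed_def exp_minus)
  have g: "((\<lambda>s. \<rho> s (y s) (y s)) \<longlongrightarrow> \<rho> t (y t) (y t)) (at t)"
    unfolding g_eq by (intro tendsto_intros cont[unfolded isCont_def])
  have ut: "(u \<longlongrightarrow> u t) (at t)" using u_cont[unfolded continuous_on_def, rule_format, OF tT] unfolding at .
  define B where "B = L * (1 + C + Y)"
  have "\<forall>\<^sub>F s in at t. norm (y s - y t) < e" if "0 < e" for e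
  proof -
    define \<epsilon> where "\<epsilon> = m\<^sup>2 * e\<^sup>2 / 4"
    have \<epsilon>: "\<epsilon> > 0" using that m_pos by (simp add: \<epsilon>_def)
    obtain \<delta> where \<delta>: "\<delta> > 0" "\<And>x z. (x, z) \<in> A t \<Longrightarrow> nr (x - u t) < \<delta> \<Longrightarrow> nr z \<le> M * (Y + B * T) \<Longrightarrow>
        \<rho> t (y t) (y t) - \<epsilon> \<le> \<rho> t z (y t)"
      using quasi_demicontinuous[OF y_mem[OF tT] \<epsilon>, of "M * (Y + B * T)"] M_pos Y_nonneg C_nonneg L_nonneg T_pos
      by (auto simp: B_def)
    have "((\<lambda>s. nr (u s - u t)) \<longlongrightarrow> nr (u t - u t)) (at t)" by (intro tendsto_intros ut)
    then have ev1: "\<forall>\<^sub>F s in at t. nr (u s - u t) < \<delta>" by (rule order_tendstoD(2)) (use \<delta> in simp)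
    have ev2: "\<forall>\<^sub>F s in at t. s \<in> {0..T}"
      using eventually_at_in_open'[of "{0<..<T}" t] t by (auto elim!: eventually_mono)
    \<comment> \<open>The four errors: change of speed, change of form in the cross term, change of
      form on \<open>y t\<close>, and replacement of \<open>q\<close> by \<open>y s\<close>. The
      square in question is at most \<open>R s + 2 * \<epsilon>\<close>.\<close>
    define R where "R s = (\<rho> s (y s) (y s) - \<rho> t (y t) (y t)) - 2 * (\<rho> s (y s) (y t) - \<rho> t (y s) (y t)) +
        (\<rho> s (y t) (y t) - \<rho> t (y t) (y t)) + 2 * (M\<^sup>2 * (B * \<bar>t - s\<bar>) * Y)" for s
    have "(R \<longlongrightarrow> (\<rho> t (y t) (y t) - \<rho> t (y t) (y t)) - 2 * 0 + (\<rho> t (y t) (y t) - \<rho> t (y t) (y t)) + 2 * (M\<^sup>2 * (B * \<bar>t - t\<bar>) * Y)) (at t)"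
      unfolding R_def
      by (intro tendsto_intros g tendsto_pairing_diff[OF tT norm_y, unfolded at] tendsto_pairing[OF tT, unfolded at])
    then have "(R \<longlongrightarrow> 0) (at t)" by simp
    then have ev3: "\<forall>\<^sub>F s in at t. R s < \<epsilon>" by (rule order_tendstoD(2)[OF _ \<epsilon>])
    show ?thesis using ev1 ev2 ev3
    proof eventually_elim
      case (elim s)
      obtain q where q: "(u s, q) \<in> A t" using domain[OF elim(2) tT y_mem[OF elim(2)]] by blast
      have qy: "norm (q - y s) \<le> B * \<bar>t - s\<bar>"
        using u_value_lipschitz[OF elim(2) tT q] by (simp add: B_def mult_ac)
      also have "\<dots> \<le> B * T" using elim(2) tT L_nonneg C_nonneg Y_nonneg by (intro mult_left_mono) (auto simp: B_def)
      finally have "norm q \<le> Y + B * T"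
        using norm_triangle_ineq[of "y s" "q - y s"] norm_y[OF elim(2)] by simp
      then have "nr q \<le> M * (Y + B * T)" using upper[of q] mult_left_mono[of "norm q" "Y + B * T" M] M_pos by linarith
      then have 1: "\<rho> t (y t) (y t) - \<epsilon> \<le> \<rho> t q (y t)" by (rule \<delta>(2)[OF q elim(1)])
      have "M\<^sup>2 * norm (q - y s) * norm (y t) \<le> M\<^sup>2 * (B * \<bar>t - s\<bar>) * Y"
        using qy norm_y[OF tT] order_trans[OF norm_ge_zero qy] by (intro mult_mono) auto
      then have 2: "\<rho> t q (y t) - \<rho> t (y s) (y t) \<le> M\<^sup>2 * (B * \<bar>t - s\<bar>) * Y"
        using le_norm[of "q - y s" "y t"] unfolding diff_left by linarith
      have "\<rho> s (y s - y t) (y s - y t) = \<rho> s (y s) (y s) - 2 * \<rho> s (y s) (y t) + \<rho> s (y t) (y t)"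
        by (rule psd_form.square_diff[OF psd[OF elim(2)]])
      also have "\<dots> \<le> R s + 2 * \<epsilon>" using 1 2 unfolding R_def by argo
      also have "\<dots> < m\<^sup>2 * e\<^sup>2" using elim(3) \<epsilon> unfolding \<epsilon>_def by argo
      finally have "m\<^sup>2 * (norm (y s - y t))\<^sup>2 < m\<^sup>2 * e\<^sup>2"
        using equiv_form.lower_square[OF equiv[OF elim(2)], of "y s - y t"] by linarith
      then have "(norm (y s - y t))\<^sup>2 < e\<^sup>2" using m_pos by simp
      then show ?case using \<open>0 < e\<close> by (simp add: power2_less_imp_less)
    qed
  qed
  then show ?thesis unfolding isCont_def by (intro tendstoI) (simp add: dist_norm)
qed

text \<open>Right derivatives on a whole neighbourhood control increments on both sides:
  \<open>u s + s *\<^sub>R y t\<close> has small right derivatives near \<open>t\<close>, and the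
  mean value estimate also covers intervals that end at \<open>t\<close>.\<close>

lemma u_deriv:
  assumes t: "t \<in> {0..<T}" and cont: "isCont y t"
  shows "(u has_vector_derivative - y t) (at t within {0..T})"
  unfolding has_vector_derivative_def has_derivative_within_alt
proof (intro conjI allI impI)
  show "bounded_linear (\<lambda>x. x *\<^sub>R - y t)" by (rule bounded_linear_scaleR_left)
  fix e :: real assume "e > 0"
  interpret equiv_form "\<rho> 0" m M by (rule equiv) (use T_pos in auto)
  \<comment> \<open>Compensates the factor \<open>M / m\<close> lost by passing to the form at time
    0 and back.\<close>
  define \<epsilon> where "\<epsilon> = e * m / M"
  have \<epsilon>: "\<epsilon> > 0" using \<open>e > 0\<close> m_pos M_pos by (simp add: \<epsilon>_def)
  obtain d where d: "d > 0" "\<And>s. \<bar>s - t\<bar> < d \<Longrightarrow> norm (y s - y t) < \<epsilon>"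
    using cont \<epsilon> unfolding continuous_at_eps_delta dist_norm real_norm_def by blast
  have seg: "norm (u b - u a' + (b - a') *\<^sub>R y t) \<le> e * (b - a')"
    if ab: "0 \<le> a'" "a' \<le> b" "b \<le> T" "\<And>s. a' \<le> s \<Longrightarrow> s \<le> b \<Longrightarrow> \<bar>s - t\<bar> < d" for a' b
  proof -
    have "nr ((u b + b *\<^sub>R y t) - (u a' + a' *\<^sub>R y t)) \<le> (M * \<epsilon>) * (b - a')"
    proof (rule right_deriv_bound)
      show "continuous_on {a'..b} (\<lambda>s. u s + s *\<^sub>R y t)"
        using ab by (intro continuous_intros continuous_on_subset[OF u_cont]) auto
      show "0 \<le> M * \<epsilon>" using M_pos \<epsilon> by simp
      fix s assume s: "s \<in> {a'..<b}"
      have sub: "{s..b} \<subseteq> {s..T}" using ab by auto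
      have "(u has_vector_derivative - y s) (at s within {s..b})"
        using has_vector_derivative_within_subset[OF u_right_deriv sub] s ab by auto
      then have "((\<lambda>s. u s + s *\<^sub>R y t) has_vector_derivative - (y s - y t)) (at s within {s..b})"
        by (auto intro!: derivative_eq_intros)
      moreover have "nr (- (y s - y t)) \<le> M * \<epsilon>"
      proof -
        have "norm (y s - y t) \<le> \<epsilon>" using d(2)[OF ab(4), of s] s by simp
        then have "M * norm (y s - y t) \<le> M * \<epsilon>" using M_pos by (intro mult_left_mono) auto
        then show ?thesis unfolding nr_minus using upper[of "y s - y t"] by linarith
      qed
      ultimately show "\<exists>w'. ((\<lambda>s. u s + s *\<^sub>R y t) has_vector_derivative w') (at s within {s..b}) \<and> nr w' \<le> M * \<epsilon>"
        by blast
    qed (rule ab(2))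
    also have "(u b + b *\<^sub>R y t) - (u a' + a' *\<^sub>R y t) = u b - u a' + (b - a') *\<^sub>R y t"
      by (simp add: algebra_simps)
    finally have "nr (u b - u a' + (b - a') *\<^sub>R y t) / m \<le> (M * \<epsilon>) * (b - a') / m"
      using m_pos by (intro divide_right_mono) auto
    also have "(M * \<epsilon>) * (b - a') / m = e * (b - a')" using m_pos M_pos by (simp add: \<epsilon>_def)
    finally show ?thesis using norm_le_nr[of "u b - u a' + (b - a') *\<^sub>R y t"] by linarith
  qed
  have "norm (u s - u t - (s - t) *\<^sub>R - y t) \<le> e * norm (s - t)" if s: "s \<in> {0..T}" "norm (s - t) < d" for s
  proof (cases "t \<le> s")
    case True
    then show ?thesis using seg[of t s] s t by simp
  next
    case False
    then have "norm (u t - u s + (t - s) *\<^sub>R y t) \<le> e * (t - s)" using seg[of s t] s t by simp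
    moreover have "u s - u t - (s - t) *\<^sub>R - y t = - (u t - u s + (t - s) *\<^sub>R y t)" by (simp add: algebra_simps)
    ultimately show ?thesis using False by (simp only: norm_minus_cancel) simp
  qed
  with d(1) show "\<exists>d>0. \<forall>s\<in>{0..T}. norm (s - t) < d \<longrightarrow> norm (u s - u t - (s - t) *\<^sub>R - y t) \<le> e * norm (s - t)"
    by blast
qed

text \<open>A derivative within the whole interval restricts to the right derivative, which is
  unique for \<open>s < T\<close>. Thus the derivative agrees with \<open>- y\<close> wherever it
  exists before \<open>T\<close>, also at exceptional times.\<close>

lemma vector_derivative_u:
  assumes s: "s \<in> {0..<T}" and diff: "u differentiable (at s within {0..T})"
  shows "vector_derivative u (at s within {0..T}) = - y s"
proof (rule vector_derivative_unique_within)
  show "at s within {s..T} \<noteq> bot" using s by (simp add: at_within_Icc_at_right)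
  have "{s..T} \<subseteq> {0..T}" using s by auto
  then show "(u has_vector_derivative vector_derivative u (at s within {0..T})) (at s within {s..T})"
    by (rule has_vector_derivative_within_subset[OF vector_derivative_works[THEN iffD1, OF diff]])
  show "(u has_vector_derivative - y s) (at s within {s..T})" using s by (intro u_right_deriv) auto
qed

lemma u_cauchy_solution:
  assumes D: "\<And>t. t \<in> {0..T} \<Longrightarrow> Domain (A t) = D"
  shows "cauchy_solution T D A a u"
  unfolding cauchy_solution_def
proof (intro conjI ballI exI)
  show "continuous_on {0..T} u" "u 0 = a" by (rule u_cont, rule u_0)
  show "u t \<in> D" if "t \<in> {0..T}" for t using y_mem[OF that] D[OF that] by blast
  \<comment> \<open>The end points are added because monotonicity of \<open>damped_speed\<close> is
    exploited on the open interval.\<close>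
  define N where "N = {t \<in> {0<..<T}. \<not> isCont damped_speed t} \<union> {0, T}"
  show "countable N" using countable_discontinuities by (simp add: N_def)
  fix t assume t: "t \<in> {0..T} - N"
  then have tT: "t \<in> {0<..<T}" "isCont damped_speed t" by (auto simp: N_def)
  have cont: "isCont y t" by (rule y_continuous[OF tT])
  have deriv: "(u has_vector_derivative - y t) (at t within {0..T})" using u_deriv[OF _ cont] tT by simp
  show "(u has_vector_derivative - op_apply (A t) (u t)) (at t within {0..T})"
    using deriv by (simp add: y_def)
  define S where "S = {s \<in> {0..T}. u differentiable (at s within {0..T})}"
  have "u differentiable (at t within {0..T})" using deriv by (rule differentiableI_vector)
  then have val: "vector_derivative u (at t within {0..T}) = - y t" using tT by (intro vector_derivative_u) auto
  have "(y \<longlongrightarrow> y t) (at t within S)"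
    using cont unfolding isCont_def by (rule tendsto_within_subset) simp
  then have lim: "((\<lambda>s. - y s) \<longlongrightarrow> - y t) (at t within S)" by (rule tendsto_minus)
  have "\<forall>\<^sub>F s in at t within S. s < T"
    using tT by (intro order_tendstoD(2)[OF tendsto_ident_at]) auto
  moreover have "\<forall>\<^sub>F s in at t within S. s \<in> S" by (simp add: eventually_at_filter)
  ultimately have "\<forall>\<^sub>F s in at t within S. - y s = vector_derivative u (at s within {0..T})"
    by eventually_elim (auto simp: S_def vector_derivative_u)
  from Lim_transform_eventually[OF lim this]
  show "continuous (at t within {s \<in> {0..T}. u differentiable (at s within {0..T})})
      (\<lambda>s. vector_derivative u (at s within {0..T}))"
    unfolding continuous_within S_def val .
qed

end

text \<open>The exceptional sets of the two solutions may differ; their union is countable, and the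
  Gronwall inequality for the squared distance tolerates it.\<close>

lemma (in evolution) cauchy_solution_unique:
  assumes D: "\<And>t. t \<in> {0..T} \<Longrightarrow> Domain (A t) = D"
    and u: "cauchy_solution T D A a u" and v: "cauchy_solution T D A a v" and t: "t \<in> {0..T}"
  shows "v t = u t"
proof -
  have mem: "(x, op_apply (A s) x) \<in> A s" if x: "x \<in> D" "s \<in> {0..T}" for x s
  proof -
    obtain z where z: "(x, z) \<in> A s" using x D[OF x(2)] by blast
    have "op_apply (A s) x = z" unfolding op_apply_def using z unique[OF x(2)] by (intro the_equality) blast+
    with z show ?thesis by simp
  qed
  obtain Nu where Nu: "countable Nu" "\<And>s. s \<in> {0..T} - Nu \<Longrightarrow> (u has_vector_derivative - op_apply (A s) (u s)) (at s within {0..T})"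
    using u unfolding cauchy_solution_def by blast
  obtain Nv where Nv: "countable Nv" "\<And>s. s \<in> {0..T} - Nv \<Longrightarrow> (v has_vector_derivative - op_apply (A s) (v s)) (at s within {0..T})"
    using v unfolding cauchy_solution_def by blast
  have uD: "continuous_on {0..T} u" "u 0 = a" "\<And>s. s \<in> {0..T} \<Longrightarrow> u s \<in> D"
    and vD: "continuous_on {0..T} v" "v 0 = a" "\<And>s. s \<in> {0..T} \<Longrightarrow> v s \<in> D"
    using u v unfolding cauchy_solution_def by blast+
  define w where "w s = u s - v s" for s
  have wcont: "continuous_on {0..T} w" unfolding w_def by (intro continuous_intros uD vD)
  have gronwall: "\<rho> t (w t) (w t) \<le> exp ((2 * \<omega> + 2 * c) * (t - 0)) * (\<rho> 0 (w 0) (w 0) + 0 * (t - 0))"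
  proof (rule right_gronwall[where N = "Nu \<union> Nv"])
    show "continuous_on {0..t} (\<lambda>s. \<rho> s (w s) (w s))"
      using t by (intro continuous_moving_square continuous_on_subset[OF wcont]) auto
    fix s assume "s \<in> {0..<t} - (Nu \<union> Nv)"
    then have s: "s \<in> {0..T}" "s \<in> {0..T} - Nu" "s \<in> {0..T} - Nv" "s \<in> {s..t}" "{s..t} \<subseteq> {0..T}" using t by auto
    interpret quasi_maximal "\<rho> s" m M "A s" \<omega> by (rule form[OF s(1)])
    define p q where "p = op_apply (A s) (u s)" and "q = op_apply (A s) (v s)"
    have "(w has_vector_derivative - (p - q)) (at s within {0..T})"
      using has_vector_derivative_diff[OF Nu(2)[OF s(2)] Nv(2)[OF s(3)]] unfolding w_def p_def q_def by simp
    from moving_square_deriv[OF s(5,4) has_vector_derivative_within_subset[OF this s(5)]]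
    obtain d where d: "((\<lambda>s. \<rho> s (w s) (w s)) has_real_derivative d) (at s within {s..t})"
      "d \<le> 2 * \<rho> s (w s) (- (p - q)) + 2 * c * \<rho> s (w s) (w s)" by blast
    have "- \<omega> * \<rho> s (w s) (w s) \<le> \<rho> s (p - q) (w s)"
      unfolding w_def p_def q_def using s(1) uD(3) vD(3) by (intro quasi_monotone mem) auto
    then have "d \<le> (2 * \<omega> + 2 * c) * \<rho> s (w s) (w s) + 0"
      using d(2) unfolding minus_right sym[of "w s" "p - q"] by argo
    with d(1) show "\<exists>d. ((\<lambda>s. \<rho> s (w s) (w s)) has_real_derivative d) (at s within {s..t}) \<and>
        d \<le> (2 * \<omega> + 2 * c) * \<rho> s (w s) (w s) + 0" by blast
  qed (use t omega_nonneg c_nonneg Nu(1) Nv(1) in auto)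
  have "\<rho> 0 (w 0) (w 0) = 0"
    using psd_form.zero_left[OF psd, of 0] T_pos by (simp add: w_def uD(2) vD(2))
  then have "\<rho> t (w t) (w t) \<le> 0" using gronwall by simp
  then have "m\<^sup>2 * (norm (w t))\<^sup>2 \<le> 0" using equiv_form.lower_square[OF equiv[OF t], of "w t"] by linarith
  then show ?thesis using m_pos by (simp add: w_def mult_le_0_iff)
qed

section \<open>The Cauchy problem\<close>

lemma real_form_psd:
  fixes ip :: "'a::real_normed_vector \<Rightarrow> 'a \<Rightarrow> 'k::real_or_complex"
  assumes "inner_product sm ip"
  shows "psd_form (\<lambda>x y. Re (to_complex (ip x y)))"
    and "x \<noteq> 0 \<Longrightarrow> 0 < Re (to_complex (ip x x))"
proof -
  have sm: "sm (of_real a) x = a *\<^sub>R x"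
    and add: "ip (x + y) z = ip x z + ip y z"
    and scale: "ip (sm k x) y = k * ip x y"
    and conj: "to_complex (ip y x) = cnj (to_complex (ip x y))"
    and pos: "x \<noteq> 0 \<Longrightarrow> 0 < Re (to_complex (ip x x))" for a k x y z
    using assms unfolding inner_product_def by blast+
  have scale': "Re (to_complex (ip (a *\<^sub>R x) y)) = a * Re (to_complex (ip x y))" for a x y
    using to_complex_of_real[of a, where ?'a = 'k]
    unfolding sm[symmetric] scale to_complex_mult of_real_def[where ?'a = 'k] by simp
  show "psd_form (\<lambda>x y. Re (to_complex (ip x y)))"
  proof
    show "Re (to_complex (ip (x + y) z)) = Re (to_complex (ip x z)) + Re (to_complex (ip y z))" for x y z
      by (simp add: add to_complex_add)
    show "Re (to_complex (ip x y)) = Re (to_complex (ip y x))" for x y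
      using conj[of y x] by simp
    show "0 \<le> Re (to_complex (ip x x))" for x
      using scale'[of 0 0 0] pos[of x] by (cases "x = 0") auto
  qed (rule scale')
  show "x \<noteq> 0 \<Longrightarrow> 0 < Re (to_complex (ip x x))" by (rule pos)
qed

text \<open>Adjoining a monotonically related pair gives a monotone extension, which maximality
  forces to coincide with \<open>B\<close>.\<close>

lemma (in hilbert_form) maximal_of_maximal_monotone_operator:
  assumes r: "r = (\<lambda>x y. Re (to_complex (ip x y)))" and B: "maximal_monotone_operator ip B"
  shows "maximal B"
  unfolding maximal_def
proof (intro conjI allI impI)
  have mono: "0 \<le> r (b - b') (a - a')" if "(a, b) \<in> B" "(a', b') \<in> B" for a b a' b'
    using B that unfolding maximal_monotone_operator_def monotone_operator_def r by blast
  then show "0 \<le> r (b - b') (a - a')" if "(a, b) \<in> B" "(a', b') \<in> B" for a b a' b' using that .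
  fix x y assume xy: "\<forall>a b. (a, b) \<in> B \<longrightarrow> 0 \<le> r (b - y) (a - x)"
  have xy': "0 \<le> r (y - b) (x - a)" if "(a, b) \<in> B" for a b
  proof -
    have "r (y - b) (x - a) = r (b - y) (a - x)" by (simp add: bilinear_simps)
    then show ?thesis using xy that by simp
  qed
  have "monotone_operator ip (insert (x, y) B)"
    unfolding monotone_operator_def
  proof (intro allI impI)
    fix a b a' b' assume ab: "(a, b) \<in> insert (x, y) B" "(a', b') \<in> insert (x, y) B"
    have "0 \<le> r (b - b') (a - a')"
    proof (cases "(a, b) = (x, y)")
      case True
      then show ?thesis using ab(2) xy'[of a' b'] by (cases "(a', b') = (x, y)") auto
    next
      case False
      then have "(a, b) \<in> B" using ab(1) by blast
      then show ?thesis using ab(2) mono[of a b a' b'] xy by (cases "(a', b') = (x, y)") auto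
    qed
    then show "0 \<le> Re (to_complex (ip (b - b') (a - a')))" unfolding r .
  qed
  then have "insert (x, y) B = B" using B unfolding maximal_monotone_operator_def by blast
  then show "(x, y) \<in> B" by blast
qed

theorem theorem2p1:
  fixes sm :: "'k::real_or_complex \<Rightarrow> 'a::real_normed_vector \<Rightarrow> 'a"
    and ipX :: "'a \<Rightarrow> 'a \<Rightarrow> 'k"
    and ip :: "real \<Rightarrow> 'a \<Rightarrow> 'a \<Rightarrow> 'k"
    and A :: "real \<Rightarrow> 'a operator"
    and D :: "'a set"
    and T c \<omega> L :: real
  assumes X_hilbert: "hilbert_inner_product sm ipX" "\<And>x. norm x = ip_norm ipX x"
    and T_pos: "0 < T"
    and ip_hilbert: "\<And>t. t \<in> {0..T} \<Longrightarrow> hilbert_inner_product sm (ip t)"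
    and ip_0_equiv: "\<exists>m>0. \<exists>M>0. \<forall>x. m * norm x \<le> ip_norm (ip 0) x \<and> ip_norm (ip 0) x \<le> M * norm x"
    and c_pos: "0 < c"
    and ip_smooth: "\<And>u t. t \<in> {0..T} \<Longrightarrow>
          \<exists>d. ((\<lambda>s. Re (to_complex (ip s u u))) has_real_derivative d) (at t within {0..T}) \<and>
              d \<le> 2 * c * Re (to_complex (ip t u u))"
    and A_single_valued: "\<And>t. t \<in> {0..T} \<Longrightarrow> single_valued (A t)"
    and omega_nonneg: "0 \<le> \<omega>"
    and A_maximal: "\<And>t. t \<in> {0..T} \<Longrightarrow> maximal_monotone_operator (ip t) (op_shift (A t) \<omega>)"
    and A_domain: "\<And>t. t \<in> {0..T} \<Longrightarrow> Domain (A t) = D"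
    and L_pos: "0 < L"
    and A_lipschitz: "\<And>u s t. u \<in> D \<Longrightarrow> s \<in> {0..T} \<Longrightarrow> t \<in> {0..T} \<Longrightarrow>
          ip_norm (ip 0) (op_apply (A t) u - op_apply (A s) u)
            \<le> L * \<bar>t - s\<bar> * (1 + ip_norm (ip 0) u + ip_norm (ip 0) (op_apply (A s) u))"
  shows "\<forall>a\<in>D. \<exists>u. cauchy_solution T D A a u \<and>
           (\<forall>v. cauchy_solution T D A a v \<longrightarrow> (\<forall>t\<in>{0..T}. v t = u t))"
proof -
  define \<rho> where "\<rho> t x y = Re (to_complex (ip t x y))" for t x y
  have inner: "inner_product sm (ip t)" if "t \<in> {0..T}" for t
    using ip_hilbert[OF that] by (simp add: hilbert_inner_product_def)
  have psd: "psd_form (\<rho> t)" if "t \<in> {0..T}" for t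
    unfolding \<rho>_def by (rule real_form_psd(1)[OF inner[OF that]])
  have nr: "ip_norm (ip t) x = psd_form.nr (\<rho> t) x" if "t \<in> {0..T}" for t x
    unfolding psd_form.nr_def[OF psd[OF that]] by (simp add: ip_norm_def \<rho>_def)
  have zero: "0 \<in> {0..T}" and TT: "T \<in> {0..T}" using T_pos by auto
  have complete: "complete (UNIV :: 'a set)"
    unfolding complete_def
  proof (intro allI impI)
    fix x :: "nat \<Rightarrow> 'a" assume "(\<forall>n. x n \<in> UNIV) \<and> Cauchy x"
    then have "\<forall>e>0. \<exists>N. \<forall>m\<ge>N. \<forall>n\<ge>N. ip_norm ipX (x m - x n) < e"
      by (simp add: Cauchy_def dist_norm X_hilbert(2))
    then obtain l where "(\<lambda>n. ip_norm ipX (x n - l)) \<longlonglongrightarrow> 0"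
      using X_hilbert(1) unfolding hilbert_inner_product_def by blast
    then have "(\<lambda>n. norm (x n - l)) \<longlonglongrightarrow> 0" by (simp only: X_hilbert(2))
    then show "\<exists>l\<in>UNIV. x \<longlonglongrightarrow> l" by (auto simp: tendsto_norm_zero_iff LIM_zero_iff)
  qed
  have smooth: "\<exists>d. ((\<lambda>s. \<rho> s x x) has_real_derivative d) (at t within {0..T}) \<and> d \<le> 2 * c * \<rho> t x x"
    if "t \<in> {0..T}" for t x
    unfolding \<rho>_def by (rule ip_smooth[OF that])
  have growth: "psd_form.nr (\<rho> t) x \<le> exp (c * T) * psd_form.nr (\<rho> s) x"
    if st: "0 \<le> s" "s \<le> t" "t \<le> T" for s t x
  proof -
    have s: "s \<in> {0..T}" and t: "t \<in> {0..T}" using st by auto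
    have "\<rho> t x x \<le> exp (2 * c * (t - s)) * \<rho> s x x"
      using c_pos by (intro exponential_growth[OF smooth _ st]) auto
    also have "\<dots> \<le> exp (2 * (c * T)) * \<rho> s x x"
      using st c_pos psd_form.nonneg[OF psd[OF s]] by (intro mult_right_mono) (auto simp: mult.assoc)
    also have "\<dots> = (exp (c * T))\<^sup>2 * \<rho> s x x" by (simp only: exp_double)
    finally have "sqrt (\<rho> t x x) \<le> sqrt ((exp (c * T))\<^sup>2 * \<rho> s x x)" by (rule real_sqrt_le_mono)
    then show ?thesis
      unfolding psd_form.nr_def[OF psd[OF s]] psd_form.nr_def[OF psd[OF t]] by (simp add: real_sqrt_mult)
  qed
  obtain m0 M0 where m0: "m0 > 0" "\<And>x. m0 * norm x \<le> ip_norm (ip 0) x"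
    and M0: "M0 > 0" "\<And>x. ip_norm (ip 0) x \<le> M0 * norm x"
    using ip_0_equiv by blast
  define M where "M = exp (c * T) * M0"
  have M: "M > 0" using M0(1) by (simp add: M_def)
  have upper: "psd_form.nr (\<rho> t) x \<le> M * norm x" if "t \<in> {0..T}" for t x
  proof -
    have "psd_form.nr (\<rho> t) x \<le> exp (c * T) * psd_form.nr (\<rho> 0) x" using that by (intro growth) auto
    also have "\<dots> \<le> exp (c * T) * (M0 * norm x)"
      using M0(2)[of x] unfolding nr[OF zero] by (intro mult_left_mono) auto
    finally show ?thesis by (simp add: M_def)
  qed
  \<comment> \<open>The growth estimate runs forward, so every earlier norm dominates the one at
    \<open>T\<close> up to \<open>exp (c * T)\<close>; a lower bound at \<open>T\<close> therefore
    serves all times.\<close>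
  have "\<exists>m>0. \<forall>x. m * norm x \<le> psd_form.nr (\<rho> T) x"
  proof (rule psd_form.norm_le_of_complete[OF psd[OF TT] _ upper[OF TT] _ complete])
    show "0 < \<rho> T x x" if "x \<noteq> 0" for x
      unfolding \<rho>_def by (rule real_form_psd(2)[OF inner[OF TT] that])
    show "\<exists>l. (\<lambda>n. psd_form.nr (\<rho> T) (x n - l)) \<longlonglongrightarrow> 0"
      if "\<forall>e>0. \<exists>N. \<forall>m\<ge>N. \<forall>n\<ge>N. psd_form.nr (\<rho> T) (x m - x n) < e" for x :: "nat \<Rightarrow> 'a"
      using ip_hilbert[OF TT] that unfolding hilbert_inner_product_def nr[OF TT] by blast
  qed
  then obtain m1 where m1: "m1 > 0" "\<And>x. m1 * norm x \<le> psd_form.nr (\<rho> T) x" by blast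
  define m where "m = m1 / exp (c * T)"
  have m: "m > 0" using m1(1) by (simp add: m_def)
  have lower: "m * norm x \<le> psd_form.nr (\<rho> t) x" if "t \<in> {0..T}" for t x
  proof -
    have "m1 * norm x \<le> exp (c * T) * psd_form.nr (\<rho> t) x"
      using m1(2)[of x] growth[of t T x] that by simp
    then show ?thesis by (simp add: m_def field_simps)
  qed
  have form: "quasi_maximal (\<rho> t) m M (A t) \<omega>" if t: "t \<in> {0..T}" for t
  proof -
    interpret psd_form "\<rho> t" by (rule psd[OF t])
    interpret hilbert_form "\<rho> t" m M
      by unfold_locales (use m M lower[OF t] upper[OF t] complete in auto)
    show ?thesis
    proof
      show "maximal (op_shift (A t) \<omega>)"
        by (rule maximal_of_maximal_monotone_operator[OF _ A_maximal[OF t]]) (simp add: \<rho>_def fun_eq_iff)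
    qed (rule omega_nonneg, rule A_single_valued[OF t])
  qed
  have value_eq: "op_apply (A t) x = v" if "t \<in> {0..T}" "(x, v) \<in> A t" for t x v
    unfolding op_apply_def using A_single_valued[OF that(1)] that(2)
    by (intro the_equality) (auto simp: single_valued_def)
  \<comment> \<open>The Lipschitz hypothesis uses the norm at time 0. Passing to the type norm
    divides by \<open>m0\<close> on the left and costs at most \<open>1 + M0\<close> on the
    right.\<close>
  define L' where "L' = L * (1 + M0) / m0"
  have evolution: "evolution \<rho> m M T c \<omega> L' A"
  proof (rule evolution.intro)
    show "0 \<le> c" "0 \<le> L'" using c_pos L_pos m0 M0 by (auto simp: L'_def)
    show "\<exists>v'. (x, v') \<in> A t" if "s \<in> {0..T}" "t \<in> {0..T}" "(x, v) \<in> A s" for s t x v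
      using A_domain[OF that(1)] A_domain[OF that(2)] that(3) by blast
    show "norm (v' - v) \<le> L' * \<bar>t - s\<bar> * (1 + norm x + norm v)"
      if st: "s \<in> {0..T}" "t \<in> {0..T}" "(x, v) \<in> A s" "(x, v') \<in> A t" for s t x v v'
    proof -
      have "x \<in> D" using A_domain[OF st(1)] st(3) by blast
      have "m0 * norm (v' - v) \<le> L * \<bar>t - s\<bar> * (1 + ip_norm (ip 0) x + ip_norm (ip 0) v)"
        using m0(2)[of "v' - v"] A_lipschitz[OF \<open>x \<in> D\<close> st(1,2)]
        unfolding value_eq[OF st(1,3)] value_eq[OF st(2,4)] by linarith
      also have "\<dots> \<le> L * \<bar>t - s\<bar> * ((1 + M0) * (1 + norm x + norm v))"
      proof (rule mult_left_mono)
        have "0 \<le> M0 + norm x + norm v" using M0(1) by simp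
        moreover have "(1 + M0) * (1 + norm x + norm v) = 1 + M0 * norm x + M0 * norm v + (M0 + norm x + norm v)"
          by (simp add: algebra_simps)
        ultimately show "1 + ip_norm (ip 0) x + ip_norm (ip 0) v \<le> (1 + M0) * (1 + norm x + norm v)"
          using M0(2)[of x] M0(2)[of v] by linarith
      qed (use L_pos in auto)
      finally show ?thesis using m0(1) by (simp add: L'_def field_simps)
    qed
  qed (erule form | rule T_pos | erule smooth)+
  interpret evolution \<rho> m M T c \<omega> L' A by (rule evolution)
  show ?thesis
  proof
    fix a assume "a \<in> D"
    then obtain b where "(a, b) \<in> A 0" using A_domain[OF zero] by blast
    then obtain C \<eta> w u where "limit_solution \<rho> m M T c \<omega> L' A a C \<eta> w u"
      using limit_solution_exists by blast
    then interpret limit_solution \<rho> m M T c \<omega> L' A a C \<eta> w u .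
    have "cauchy_solution T D A a u" by (rule u_cauchy_solution[OF A_domain])
    then show "\<exists>u. cauchy_solution T D A a u \<and> (\<forall>v. cauchy_solution T D A a v \<longrightarrow> (\<forall>t\<in>{0..T}. v t = u t))"
      using cauchy_solution_unique[OF A_domain] by blast
  qed
qed

end
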